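(* Let $k\geq 3$ and $n\ge1$. There is a bijection $\Phi$ from the set $\mathcal{S}_n(F_k)$ of permutations of $[n]$ avoiding $F_k=2\,3\,\cdots\,k\,1$ to the set $\mathcal{S}_n(H_k,Q_k)$ of permutations of $[n]$ avoiding both $H_k$ and $Q_k$, such that $\mathcal{D}(\Phi(\pi))=\mathcal{D}(\pi)$ for every $\pi\in\mathcal{S}_n(F_k)$.
   Context: For $\pi=\pi_1\cdots\pi_n$ a permutation of $[n]$, $\mathcal{D}(\pi)=\{i:\pi_i>\pi_{i+1}\}$ is its descent set. A subsequence $\pi_{i_1}\cdots\pi_{i_k}$ ($i_1<\cdots<i_k$) is order-isomorphic to a pattern $\tau$ if its entries appear in the same relative order as $\tau$; $\pi$ avoids $\tau$ if no such subsequence exists. Let $J_k=12\cdots k$ and $G_k=1\,2\cdots(k-2)\,k\,(k-1)$. We say $\pi$ contains an occurrence of $H_k$ if there exist indices $i_1<\cdots<i_k$ such that $\pi_{i_1}\cdots\pi_{i_k}$ is order-isomorphic to $J_k$ and there exists $j\in\mathcal{D}(\pi)$ with $i_{k-1}\le j<i_k$; otherwise $\pi$ avoids $H_k$. We say $\pi$ contains an occurrence of $Q_k$ if there exist indices $i_1<\cdots<i_k$ such that $\pi_{i_1}\cdots\pi_{i_k}$ is order-isomorphic to $G_k$ and $\pi_{i_{k-1}}<\pi_{i_{k-1}+1}<\cdots<\pi_{i_k-1}>\pi_{i_k}$; otherwise $\pi$ avoids $Q_k$. $\mathcal{S}_n(H_k,Q_k)$ is the set of permutations of $[n]$ avoiding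 both $H_k$ and $Q_k$. *)

theory Defs
  imports Main "HOL-Combinatorics.Permutations"
begin

text \<open>
  A permutation of \<open>[n]\<close> is a function \<open>\<pi>\<close> with \<open>\<pi> permutes {1..n}\<close>; its one-line notation is
  \<open>\<pi> 1, \<dots>, \<pi> n\<close>. Positions and values are counted from 1, and \<open>\<pi>\<close> is the identity outside
  \<open>{1..n}\<close>, so the functions correspond exactly to the permutations of \<open>[n]\<close>.
\<close>

definition descent_set :: "nat \<Rightarrow> (nat \<Rightarrow> nat) \<Rightarrow> nat set" where
  "descent_set n \<pi> = {i \<in> {1..<n}. \<pi> i > \<pi> (i + 1)}"

text \<open>The index function \<open>s\<close> stands for \<open>s 1 < \<dots> < s k\<close>; only its values on \<open>{1..k}\<close> matter.\<close>

definition occurrence :: "nat \<Rightarrow> nat \<Rightarrow> (nat \<Rightarrow> nat) \<Rightarrow> (nat \<Rightarrow> nat) \<Rightarrow> (nat \<Rightarrow> nat) \<Rightarrow> bool" where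
  "occurrence n k \<tau> \<pi> s \<longleftrightarrow>
     strict_mono_on {1..k} s \<and> s ` {1..k} \<subseteq> {1..n} \<and>
     (\<forall>a\<in>{1..k}. \<forall>b\<in>{1..k}. \<pi> (s a) < \<pi> (s b) \<longleftrightarrow> \<tau> a < \<tau> b)"

definition avoids :: "nat \<Rightarrow> nat \<Rightarrow> (nat \<Rightarrow> nat) \<Rightarrow> (nat \<Rightarrow> nat) \<Rightarrow> bool" where
  "avoids n k \<tau> \<pi> \<longleftrightarrow> \<not> (\<exists>s. occurrence n k \<tau> \<pi> s)"

definition pattern_F :: "nat \<Rightarrow> nat \<Rightarrow> nat" where
  "pattern_F k j = (if 1 \<le> j \<and> j < k then j + 1 else if j = k then 1 else j)"

definition pattern_J :: "nat \<Rightarrow> nat \<Rightarrow> nat" where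
  "pattern_J k j = j"

definition pattern_G :: "nat \<Rightarrow> nat \<Rightarrow> nat" where
  "pattern_G k j = (if j = k - 1 then k else if j = k then k - 1 else j)"

definition contains_H :: "nat \<Rightarrow> nat \<Rightarrow> (nat \<Rightarrow> nat) \<Rightarrow> bool" where
  "contains_H n k \<pi> \<longleftrightarrow>
     (\<exists>s. occurrence n k (pattern_J k) \<pi> s \<and>
          (\<exists>j\<in>descent_set n \<pi>. s (k - 1) \<le> j \<and> j < s k))"

text \<open>
  The chain \<open>\<pi> a < \<pi> (a + 1) < \<dots> < \<pi> (b - 1) > \<pi> b\<close> with \<open>a = s (k - 1)\<close> and \<open>b = s k\<close>;
  for \<open>b = a + 1\<close> it has no ascents and reads \<open>\<pi> a > \<pi> b\<close>.
\<close>

definition contains_Q :: "nat \<Rightarrow> nat \<Rightarrow> (nat \<Rightarrow> nat) \<Rightarrow> bool" where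
  "contains_Q n k \<pi> \<longleftrightarrow>
     (\<exists>s. occurrence n k (pattern_G k) \<pi> s \<and>
          (\<forall>j. s (k - 1) \<le> j \<and> j < s k - 1 \<longrightarrow> \<pi> j < \<pi> (j + 1)) \<and>
          \<pi> (s k - 1) > \<pi> (s k))"

definition S_F :: "nat \<Rightarrow> nat \<Rightarrow> (nat \<Rightarrow> nat) set" where
  "S_F n k = {\<pi>. \<pi> permutes {1..n} \<and> avoids n k (pattern_F k) \<pi>}"

definition S_HQ :: "nat \<Rightarrow> nat \<Rightarrow> (nat \<Rightarrow> nat) set" where
  "S_HQ n k = {\<pi>. \<pi> permutes {1..n} \<and> \<not> contains_H n k \<pi> \<and> \<not> contains_Q n k \<pi>}"

end

theory Submission
  imports Defs "HOL-Library.Product_Lexorder"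
begin

text \<open>
  Let \<open>K = k - 1\<close>. It suffices to count, for every \<open>S\<close>, the permutations with descent set contained in \<open>S\<close>.
  Such a permutation is a word in the blocks cut out by \<open>S\<close>, and it avoids \<open>F\<^sub>k\<close> iff no letter is
  followed by a weakly increasing chain of \<open>K\<close> smaller letters. These words are equinumerous with
  those in which no letter is preceded by such a chain: in the spirit of Backelin, West and Xin, a
  chain \<open>u\<^sub>1 \<le> \<dots> \<le> u\<^sub>K\<close> followed by a larger letter \<open>M\<close> at position \<open>m\<close> is rotated
  to \<open>M, u\<^sub>1, \<dots>, u\<^sub>K\<close>. For the rightmost (greedy) chain this is a bijection between the words
  with the second pattern ending at \<open>m\<close> and those with the first pattern ending at \<open>m\<close>, and it
  creates or destroys neither the first pattern before \<open>m\<close> nor the second one after \<open>m\<close>. Hence the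
  two patterns can be exchanged one position at a time.

  Call a position high if an increasing subsequence of length \<open>K\<close> ends there. Both avoidance of the
  second pattern and avoidance of \<open>H\<^sub>k\<close> and \<open>Q\<^sub>k\<close> leave exactly one relative order for the high
  entries, given the others, and permuting them inside each maximal run of consecutive high
  positions leads from one class to the other.
\<close>

text \<open>A word with prescribed letters only forces increase inside blocks; this is why descent
  sets contained in \<open>S\<close> are counted. Exact descent sets are recovered by subtracting
  proper subsets, and the final bijection is glued from arbitrary bijections between finite fibres,
  so it is not explicit. The word is indexed by values, hence it describes the inverse permutation,
  and \<open>2 3 ... k 1\<close> turns into \<open>k 1 ... k - 1\<close>. The obstacle is that a
  rotation moves \<open>K + 1\<close> letters at once while other chains weave through them. Each
  such chain has to be rerouted through the new points without getting shorter. This works because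
  no chain of \<open>K\<close> letters smaller than \<open>M\<close> fits strictly between the start
  of the greedy chain and \<open>m\<close>, neither before nor after the rotation. Two reroutings
  are needed: one controls letters, for chains that extend beyond this stretch to the left or right;
  the other controls positions, for chains continued by letters that are at least \<open>M\<close>.
  A half-turn yields the reverse direction of each.\<close>

section \<open>Rerouting chains in a transitive relation\<close>

lemma sorted_wrt_prepend:
  assumes "transp R" "sorted_wrt R xs" "sorted_wrt R ys" "xs \<noteq> []" "ys \<noteq> []" "R (last xs) (hd ys)"
  shows "sorted_wrt R (xs @ ys)"
proof -
  have l: "x = last xs \<or> R x (last xs)" if "x \<in> set xs" for x
  proof -
    have eq: "xs = butlast xs @ [last xs]" using assms(4) by simp
    have "sorted_wrt R (butlast xs @ [last xs])" using assms(2) eq by simp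
    then have "\<forall>x\<in>set (butlast xs). R x (last xs)" unfolding sorted_wrt_append by simp
    moreover have "x \<in> set (butlast xs @ [last xs])" using that eq by simp
    ultimately show ?thesis by auto
  qed
  have h: "y = hd ys \<or> R (hd ys) y" if "y \<in> set ys" for y
    using assms(3,5) that by (cases ys) auto
  have "R x y" if "x \<in> set xs" "y \<in> set ys" for x y
    using l[OF that(1)] h[OF that(2)] assms(1,6) by (metis transpD)
  then show ?thesis using assms(2,3) by (simp add: sorted_wrt_append)
qed

text \<open>
  A chain through points \<open>A e\<close> is rerouted through \<open>W e\<close>: following \<open>A e\<close>, the points on the side
  \<open>B\<close> are dropped in favour of \<open>W e, \<dots>, W g\<close>, and the hypotheses say that this is never a loss.
\<close>

lemma shift_chain:
  fixes A W :: "nat \<Rightarrow> 'a" and m :: "'a \<Rightarrow> int"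
  assumes R: "transp R"
    and W: "\<And>i j. 1 \<le> i \<Longrightarrow> i < j \<Longrightarrow> j \<le> N \<Longrightarrow> R (W i) (W j)"
    and up: "\<And>z e. e \<in> {1..N} \<Longrightarrow> R z (A e) \<Longrightarrow> R z (W e)"
    and meet: "\<And>e j ys. \<lbrakk>e \<in> {1..N}; j \<in> {1..N}; sorted_wrt R (A e # ys @ [A j]); set ys \<subseteq> X\<rbrakk>
                \<Longrightarrow> e + length ys < j"
    and cross: "\<And>e z ys. \<lbrakk>e \<in> {1..N}; sorted_wrt R (A e # ys @ [z]); set ys \<subseteq> X \<inter> B; z \<in> X - B\<rbrakk>
                \<Longrightarrow> \<exists>g\<in>{e..N}. e + length ys \<le> g \<and> R (W g) z"
    and stop: "\<And>e ys. \<lbrakk>e \<in> {1..N}; sorted_wrt R (A e # ys); set ys \<subseteq> X \<inter> B\<rbrakk>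
                \<Longrightarrow> \<exists>g\<in>{e..N}. e + length ys \<le> g \<and> m (W g) \<le> m (last (A e # ys))"
  shows "\<lbrakk>Z \<noteq> []; sorted_wrt R Z; set Z \<subseteq> X \<union> A ` {1..N}\<rbrakk> \<Longrightarrow>
    \<exists>Z'. Z' \<noteq> [] \<and> sorted_wrt R Z' \<and> set Z' \<subseteq> X \<union> W ` {1..N} \<and> length Z \<le> length Z' \<and>
      m (last Z') \<le> m (last Z) \<and>
      (hd Z \<in> X \<and> hd Z' = hd Z \<or> (\<exists>e\<in>{1..N}. hd Z = A e \<and> hd Z' = W e))"
proof (induction "length Z" arbitrary: Z rule: less_induct)
  case less
  then obtain z zs where Z: "Z = z # zs" by (cases Z) auto
  \<comment> \<open>The segment \<open>W e, ..., W g\<close> replaces \<open>A e\<close> and the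
    skipped \<open>ys\<close>; as \<open>e + length ys \<le> g\<close>, it has at least
    \<open>1 + length ys\<close> points.\<close>
  have block: "\<exists>Z'. Z' \<noteq> [] \<and> sorted_wrt R Z' \<and> set Z' \<subseteq> X \<union> W ` {1..N} \<and>
      1 + length ys + length U \<le> length Z' \<and> last Z' = last (W g # U) \<and> hd Z' = W e"
    if "e \<in> {1..N}" "g \<in> {e..N}" "e + length ys \<le> g" "sorted_wrt R U" "set U \<subseteq> X \<union> W ` {1..N}"
       "U \<noteq> [] \<Longrightarrow> R (W g) (hd U)" for e g U and ys :: "'a list"
  proof -
    let ?P = "map W [e..<g+1]"
    have P: "sorted_wrt R ?P"
      unfolding sorted_wrt_map
    proof (rule sorted_wrt_mono_rel[OF _ sorted_wrt_upt])
      fix x y assume "x \<in> set [e..<g+1]" "y \<in> set [e..<g+1]" "x < y"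
      then show "R (W x) (W y)" using that(1,2) by (intro W) auto
    qed
    have ne: "?P \<noteq> []" and last: "last ?P = W g"
      using that(2) by auto
    have "[e..<g+1] = e # [Suc e..<g+1]" using that(2) by (simp add: upt_conv_Cons)
    then have hd: "hd ?P = W e" by simp
    have s: "sorted_wrt R (?P @ U)"
    proof (cases "U = []")
      case False
      show ?thesis by (rule sorted_wrt_prepend[OF R P that(4) ne False]) (use last that(6)[OF False] in simp)
    qed (use P in simp)
    have sub: "set (?P @ U) \<subseteq> X \<union> W ` {1..N}" using that(1,2,5) by auto
    have len: "1 + length ys + length U \<le> length (?P @ U)" using that(2,3) by simp
    have l: "last (?P @ U) = last (W g # U)" using last by (cases "U = []") auto
    have h: "hd (?P @ U) = W e" using hd ne by simp
    have "?P @ U \<noteq> []" using ne by simp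
    with s sub len l h show ?thesis by blast
  qed
  show ?case
  proof (cases "z \<in> X")
    case True
    show ?thesis
    proof (cases "zs = []")
      case True
      with \<open>z \<in> X\<close> Z show ?thesis by (intro exI[of _ "[z]"]) auto
    next
      case False
      then obtain U where U: "U \<noteq> []" "sorted_wrt R U" "set U \<subseteq> X \<union> W ` {1..N}" "length zs \<le> length U"
          "m (last U) \<le> m (last zs)" "hd zs \<in> X \<and> hd U = hd zs \<or> (\<exists>e\<in>{1..N}. hd zs = A e \<and> hd U = W e)"
        using less.hyps[of zs] less.prems Z by auto
      have "R z (hd zs)" using less.prems(2) Z False by (cases zs) auto
      then have Rz: "R z (hd U)" using U(6) up by auto
      have "sorted_wrt R ([z] @ U)" by (rule sorted_wrt_prepend[OF R]) (use U Rz in auto)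
      then show ?thesis using U Z False \<open>z \<in> X\<close> by (intro exI[of _ "z # U"]) auto
    qed
  next
    case False
    then obtain e where e: "e \<in> {1..N}" "z = A e" using less.prems(3) Z by auto
    \<comment> \<open>Only the points of \<open>X \<inter> B\<close> directly after
      \<open>A e\<close> are skipped. What follows them is a point of \<open>X - B\<close> or some
      \<open>A j\<close>, the situations covered by \<open>cross\<close> and
      \<open>meet\<close>.\<close>
    define ys where "ys = takeWhile (\<lambda>y. y \<in> X \<inter> B) zs"
    define rs where "rs = dropWhile (\<lambda>y. y \<in> X \<inter> B) zs"
    have zs: "zs = ys @ rs" unfolding ys_def rs_def by simp
    have ysX: "set ys \<subseteq> X \<inter> B" unfolding ys_def using set_takeWhileD by fast
    show ?thesis
    proof (cases "rs = []")
      case True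
      have "sorted_wrt R (A e # ys)" using less.prems(2) Z zs True e by simp
      from stop[OF e(1) this ysX] obtain g where g: "g \<in> {e..N}" "e + length ys \<le> g" "m (W g) \<le> m (last (A e # ys))"
        by blast
      from block[OF e(1) g(1,2), of "[]"] obtain Z' where
        "Z' \<noteq> []" "sorted_wrt R Z'" "set Z' \<subseteq> X \<union> W ` {1..N}" "1 + length ys \<le> length Z'" "last Z' = W g" "hd Z' = W e"
        by auto
      then show ?thesis using Z zs True e g by (intro exI[of _ Z']) auto
    next
      case False
      then obtain r rt where r: "rs = r # rt" by (cases rs) auto
      have "r = hd rs" using r by simp
      then have rn: "r \<notin> X \<inter> B" unfolding rs_def using False rs_def hd_dropWhile by metis
      have srt: "sorted_wrt R (A e # ys @ [r])" "sorted_wrt R rs"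
        using less.prems(2) Z zs r e by (auto simp: sorted_wrt_append)
      have "set rs \<subseteq> X \<union> A ` {1..N}" using less.prems(3) Z zs by auto
      with less.hyps[of rs] srt(2) False Z zs obtain U where U: "U \<noteq> []" "sorted_wrt R U" "set U \<subseteq> X \<union> W ` {1..N}"
          "length rs \<le> length U" "m (last U) \<le> m (last rs)"
          "hd rs \<in> X \<and> hd U = hd rs \<or> (\<exists>e\<in>{1..N}. hd rs = A e \<and> hd U = W e)"
        by auto
      have "\<exists>g\<in>{e..N}. e + length ys \<le> g \<and> R (W g) (hd U)"
        using U(6)
      proof
        assume "hd rs \<in> X \<and> hd U = hd rs"
        then have "r \<in> X - B" "hd U = r" using rn r by auto
        with cross[OF e(1) srt(1) ysX] show ?thesis by simp
      next
        assume "\<exists>e\<in>{1..N}. hd rs = A e \<and> hd U = W e"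
        then obtain j where j: "j \<in> {1..N}" "r = A j" "hd U = W j" using r by auto
        have "e + length ys < j" using meet[OF e(1) j(1)] srt(1) j(2) ysX by auto
        \<comment> \<open>The rerouted remainder begins with \<open>W j\<close>, so the inserted
          segment may run up to \<open>W (j - 1)\<close>.\<close>
        then show ?thesis using j e W[of "j - 1" j] by (intro bexI[of _ "j - 1"]) auto
      qed
      then obtain g where g: "g \<in> {e..N}" "e + length ys \<le> g" "R (W g) (hd U)" by blast
      from block[OF e(1) g(1,2) U(2,3) g(3)] obtain Z' where
        "Z' \<noteq> []" "sorted_wrt R Z'" "set Z' \<subseteq> X \<union> W ` {1..N}" "1 + length ys + length U \<le> length Z'"
        "last Z' = last (W g # U)" "hd Z' = W e"
        by auto
      then show ?thesis using Z zs False e U r by (intro exI[of _ Z']) auto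
    qed
  qed
qed

subsection \<open>Staircases\<close>

text \<open>Points are pairs of a position and a letter, so a chain is a weakly increasing subword
  listed together with its positions.\<close>

definition prec :: "int \<times> int \<Rightarrow> int \<times> int \<Rightarrow> bool" (infix "\<prec>" 50) where
  "x \<prec> y \<longleftrightarrow> fst x < fst y \<and> snd x \<le> snd y"

abbreviation chain :: "(int \<times> int) list \<Rightarrow> bool" where
  "chain \<equiv> sorted_wrt (\<prec>)"

definition pts :: "int set \<Rightarrow> (int \<Rightarrow> int) \<Rightarrow> (int \<times> int) set" where
  "pts D f = (\<lambda>s. (s, f s)) ` D"

definition short :: "nat \<Rightarrow> (int \<times> int) set \<Rightarrow> bool" where
  "short K Y \<longleftrightarrow> (\<forall>xs. chain xs \<longrightarrow> set xs \<subseteq> Y \<longrightarrow> length xs < K)"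

lemma transp_prec: "transp (\<prec>)"
  by (auto simp: transp_def prec_def)

lemma prec_trans: "x \<prec> y \<Longrightarrow> y \<prec> z \<Longrightarrow> x \<prec> z"
  using transp_prec by (rule transpD)

lemma mem_pts_iff: "x \<in> pts D f \<longleftrightarrow> fst x \<in> D \<and> snd x = f (fst x)"
  by (cases x) (auto simp: pts_def)

lemma shortD: "short K Y \<Longrightarrow> chain xs \<Longrightarrow> set xs \<subseteq> Y \<Longrightarrow> length xs < K"
  by (auto simp: short_def)

lemma chain_map_upt:
  assumes "\<And>i j. \<lbrakk>a \<le> i; i < j; j < b\<rbrakk> \<Longrightarrow> P i \<prec> P j"
  shows "chain (map P [a..<b])"
  unfolding sorted_wrt_map
  by (rule sorted_wrt_mono_rel[OF _ sorted_wrt_upt]) (use assms in auto)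

text \<open>
  The graph of \<open>f\<close> passes through the outer corners \<open>(p i, u i)\<close> of an increasing staircase; moving
  these points to the inner corners \<open>(p (i + 1), u i)\<close> gives the graph of \<open>f'\<close>. The end positions
  \<open>p 1\<close> and \<open>p (K + 1)\<close> lie outside \<open>D\<close>. Asking for short chains on both sides makes the notion
  invariant under the half-turn \<open>(s, v) \<mapsto> (-s, -v)\<close>, which exchanges \<open>f\<close> and \<open>f'\<close>.
\<close>

locale staircase =
  fixes K :: nat and p u :: "nat \<Rightarrow> int" and D :: "int set" and f f' :: "int \<Rightarrow> int"
  assumes K: "2 \<le> K"
    and p_Suc: "\<And>i. \<lbrakk>1 \<le> i; i \<le> K\<rbrakk> \<Longrightarrow> p i < p (Suc i)"
    and u_Suc: "\<And>i. \<lbrakk>1 \<le> i; i < K\<rbrakk> \<Longrightarrow> u i \<le> u (Suc i)"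
    and D: "finite D" "D \<subseteq> {p 1<..<p (Suc K)}"
    and corner: "\<And>i. \<lbrakk>2 \<le> i; i \<le> K\<rbrakk> \<Longrightarrow> p i \<in> D \<and> f (p i) = u i \<and> f' (p i) = u (i - 1)"
    and same: "\<And>s. s \<in> D - p ` {2..K} \<Longrightarrow> f' s = f s"
    and short: "short K (pts D f)" "short K (pts D f')"
begin

abbreviation "U i \<equiv> (p i, u i)"
abbreviation "C i \<equiv> (p (Suc i), u i)"

definition X where "X = pts (D - p ` {2..K}) f"

lemma p_less: "\<lbrakk>1 \<le> i; i < j; j \<le> Suc K\<rbrakk> \<Longrightarrow> p i < p j"
proof (induction j)
  case (Suc j)
  then show ?case using p_Suc[of j] by (cases "i = j") auto
qed simp

lemma p_le: "\<lbrakk>1 \<le> i; i \<le> j; j \<le> Suc K\<rbrakk> \<Longrightarrow> p i \<le> p j"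
  using p_less[of i j] by (cases "i = j") auto

lemma u_le: "\<lbrakk>1 \<le> i; i \<le> j; j \<le> K\<rbrakk> \<Longrightarrow> u i \<le> u j"
proof (induction j)
  case (Suc j)
  then show ?case using u_Suc[of j] by (cases "i = Suc j") force+
qed simp

lemma p_less_iff: "\<lbrakk>1 \<le> i; i \<le> Suc K; 1 \<le> j; j \<le> Suc K\<rbrakk> \<Longrightarrow> p i < p j \<longleftrightarrow> i < j"
  using p_less[of i j] p_le[of j i] by (cases "i < j") auto

lemma UU: "\<lbrakk>1 \<le> i; i < j; j \<le> K\<rbrakk> \<Longrightarrow> U i \<prec> U j"
  using p_less[of i j] u_le[of i j] by (auto simp: prec_def)

lemma CC: "\<lbrakk>1 \<le> i; i < j; j \<le> K\<rbrakk> \<Longrightarrow> C i \<prec> C j"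
  using p_less[of "Suc i" "Suc j"] u_le[of i j] by (auto simp: prec_def)

lemma X_sub: "X \<subseteq> pts D f" "X \<subseteq> pts D f'"
  using same by (auto simp: X_def mem_pts_iff)

lemma U_mem: "\<lbrakk>2 \<le> i; i \<le> K\<rbrakk> \<Longrightarrow> U i \<in> pts D f"
  using corner by (auto simp: mem_pts_iff)

lemma C_mem: "\<lbrakk>1 \<le> i; i < K\<rbrakk> \<Longrightarrow> C i \<in> pts D f'"
  using corner[of "Suc i"] by (auto simp: mem_pts_iff)

lemma pts_f: "pts D f = X \<union> U ` {2..K}"
  using corner by (auto simp: X_def mem_pts_iff)

lemma pts_f': "pts D f' = X \<union> C ` {1..<K}"
proof
  show "pts D f' \<subseteq> X \<union> C ` {1..<K}"
  proof
    fix x assume x: "x \<in> pts D f'"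
    show "x \<in> X \<union> C ` {1..<K}"
    proof (cases "fst x \<in> p ` {2..K}")
      case True
      then obtain i where i: "2 \<le> i" "i \<le> K" "fst x = p i" by auto
      then have "x = C (i - 1)" using x corner[of i] by (auto simp: mem_pts_iff prod_eq_iff)
      then show ?thesis using i by force
    next
      case False
      then show ?thesis using x same by (auto simp: X_def mem_pts_iff)
    qed
  qed
  show "X \<union> C ` {1..<K} \<subseteq> pts D f'" using X_sub C_mem by auto
qed

lemma glue:
  assumes "chain xs" "chain ys" "chain zs"
    "\<And>x y. x \<in> set xs \<Longrightarrow> y \<in> set ys \<Longrightarrow> x \<prec> y"
    "\<And>y z. y \<in> set ys \<Longrightarrow> z \<in> set zs \<Longrightarrow> y \<prec> z"
    "ys \<noteq> []"
  shows "chain (xs @ ys @ zs)"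
proof -
  have "x \<prec> z" if "x \<in> set xs" "z \<in> set zs" for x z
    using assms(4)[OF that(1), of "hd ys"] assms(5)[OF _ that(2), of "hd ys"] assms(6) prec_trans by auto
  then show ?thesis using assms by (auto simp: sorted_wrt_append)
qed

text \<open>
  A chain of unmoved points inside a box of the staircase, prolonged along the staircase on both
  sides, is still short; so the chain is no longer than the stretch of staircase it bypasses.
\<close>

lemma box_U:
  assumes ys: "chain ys" "set ys \<subseteq> X" and eg: "1 \<le> e" "e \<le> g" "g \<le> K"
    and lo: "\<And>y. y \<in> set ys \<Longrightarrow> p e < fst y \<and> u e \<le> snd y"
    and hi: "\<And>y. y \<in> set ys \<Longrightarrow> fst y < p (Suc g) \<and> (g < K \<longrightarrow> snd y \<le> u (Suc g))"
  shows "e + length ys \<le> g"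
proof (cases "ys = []")
  case False
  let ?L = "map U [2..<Suc e] @ ys @ map U [Suc g..<Suc K]"
  have "chain ?L"
  proof (rule glue)
    show "chain (map U [2..<Suc e])" using eg by (intro chain_map_upt UU) auto
    show "chain (map U [Suc g..<Suc K])" using eg by (intro chain_map_upt UU) auto
  next
    fix x y assume "x \<in> set (map U [2..<Suc e])" "y \<in> set ys"
    then obtain i where "x = U i" "2 \<le> i" "i \<le> e" by auto
    then show "x \<prec> y" using lo[OF \<open>y \<in> set ys\<close>] p_le[of i e] u_le[of i e] eg by (auto simp: prec_def)
  next
    fix y z assume "y \<in> set ys" "z \<in> set (map U [Suc g..<Suc K])"
    then obtain i where "z = U i" "Suc g \<le> i" "i \<le> K" by auto
    then show "y \<prec> z" using hi[OF \<open>y \<in> set ys\<close>] p_le[of "Suc g" i] u_le[of "Suc g" i] eg by (auto simp: prec_def)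
  qed (use ys False in auto)
  moreover have "set ?L \<subseteq> pts D f" using ys X_sub U_mem eg by auto
  ultimately have "length ?L < K" using short shortD by blast
  then show ?thesis using eg by (simp del: upt_Suc)
qed (use eg in simp)

lemma box_C:
  assumes ys: "chain ys" "set ys \<subseteq> X" and eg: "1 \<le> e" "e \<le> g" "g \<le> K"
    and lo: "\<And>y. y \<in> set ys \<Longrightarrow> p e < fst y \<and> (1 < e \<longrightarrow> u (e - 1) \<le> snd y)"
    and hi: "\<And>y. y \<in> set ys \<Longrightarrow> fst y < p (Suc g) \<and> (g < K \<longrightarrow> snd y \<le> u g)"
  shows "e + length ys \<le> g"
proof (cases "ys = []")
  case False
  let ?L = "map C [1..<e] @ ys @ map C [g..<K]"
  have "chain ?L"
  proof (rule glue)
    show "chain (map C [1..<e])" using eg by (intro chain_map_upt CC) auto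
    show "chain (map C [g..<K])" using eg by (intro chain_map_upt CC) auto
  next
    fix x y assume "x \<in> set (map C [1..<e])" "y \<in> set ys"
    then obtain i where "x = C i" "1 \<le> i" "i < e" by auto
    moreover from this have "p (Suc i) \<le> p e" "u i \<le> u (e - 1)" using eg by (auto intro!: p_le u_le)
    ultimately show "x \<prec> y" using lo[OF \<open>y \<in> set ys\<close>] by (auto simp: prec_def)
  next
    fix y z assume "y \<in> set ys" "z \<in> set (map C [g..<K])"
    then obtain i where "z = C i" "g \<le> i" "i < K" by auto
    then show "y \<prec> z" using hi[OF \<open>y \<in> set ys\<close>] p_le[of "Suc g" "Suc i"] u_le[of g i] eg by (auto simp: prec_def)
  qed (use ys False in auto)
  moreover have "set ?L \<subseteq> pts D f'" using ys X_sub C_mem eg by auto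
  ultimately have "length ?L < K" using short shortD by blast
  then show ?thesis using eg by (simp del: upt_Suc)
qed (use eg in simp)

text \<open>Between \<open>p i\<close> and \<open>p (Suc i)\<close>, the thresholds are the next
  value \<open>u (Suc i)\<close> and the previous value \<open>u (i - 1)\<close> rather than
  \<open>u i\<close>: the band between them is the one that the two box bounds keep free of unmoved
  points.\<close>

definition above where
  "above = {x. \<exists>i. 1 \<le> i \<and> i < K \<and> p i < fst x \<and> fst x < p (Suc i) \<and> u (Suc i) < snd x}"
definition below where
  "below = {x. \<exists>i. 2 \<le> i \<and> i \<le> K \<and> p i < fst x \<and> fst x < p (Suc i) \<and> snd x < u (i - 1)}"

lemma gap:
  assumes "p 1 < s" "s < p (Suc K)"
  obtains i where "1 \<le> i" "i \<le> K" "p i \<le> s" "s < p (Suc i)"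
proof -
  define i where "i = Max {i. 1 \<le> i \<and> i \<le> K \<and> p i \<le> s}"
  have fin: "finite {i. 1 \<le> i \<and> i \<le> K \<and> p i \<le> s}" by simp
  have "1 \<in> {i. 1 \<le> i \<and> i \<le> K \<and> p i \<le> s}" using assms K by auto
  then have "i \<in> {i. 1 \<le> i \<and> i \<le> K \<and> p i \<le> s}" unfolding i_def using Max_in[OF fin] by blast
  moreover have "s < p (Suc i)"
  proof (rule ccontr)
    assume c: "\<not> s < p (Suc i)"
    then have "i \<noteq> K" using assms by auto
    then have "Suc i \<le> i" unfolding i_def using calculation c i_def
      by (intro Max_ge[OF fin]) auto
    then show False by simp
  qed
  ultimately show ?thesis using that by auto
qed

text \<open>A one-point list inside a box with \<open>e = g = i\<close> would give
  \<open>i + 1 \<le> i\<close>. The two boxes of column \<open>i\<close> together cover the values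
  from \<open>u (i - 1)\<close> to \<open>u (Suc i)\<close>, and in the end columns they are
  unbounded on one side.\<close>

lemma above_or_below:
  assumes x: "x \<in> X"
  shows "x \<in> above \<or> x \<in> below"
proof -
  have xD: "fst x \<in> D - p ` {2..K}" using x by (auto simp: X_def mem_pts_iff)
  then have b: "p 1 < fst x" "fst x < p (Suc K)" using D by auto
  then obtain i where i: "1 \<le> i" "i \<le> K" "p i \<le> fst x" "fst x < p (Suc i)" by (rule gap)
  have lt: "p i < fst x"
  proof (cases "i = 1")
    case False
    then have "fst x \<noteq> p i" using xD i by auto
    then show ?thesis using i by simp
  qed (use b in simp)
  have "\<not> (u i \<le> snd x \<and> (i < K \<longrightarrow> snd x \<le> u (Suc i)))"
    using box_U[of "[x]" i i] x i lt by auto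
  moreover have "\<not> ((1 < i \<longrightarrow> u (i - 1) \<le> snd x) \<and> (i < K \<longrightarrow> snd x \<le> u i))"
    using box_C[of "[x]" i i] x i lt by auto
  moreover have "1 < i \<Longrightarrow> u (i - 1) \<le> u i" using u_le[of "i - 1" i] i by simp
  ultimately have "i < K \<and> u (Suc i) < snd x \<or> 2 \<le> i \<and> snd x < u (i - 1)" by force
  then show ?thesis using i lt by (auto simp: above_def below_def)
qed

lemma level:
  assumes "1 \<le> e" "e \<le> K" "u e \<le> v"
  obtains g where "e \<le> g" "g \<le> K" "u g \<le> v" "g < K \<Longrightarrow> v < u (Suc g)"
proof -
  define g where "g = Max {i. e \<le> i \<and> i \<le> K \<and> u i \<le> v}"
  have fin: "finite {i. e \<le> i \<and> i \<le> K \<and> u i \<le> v}" by simp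
  have "e \<in> {i. e \<le> i \<and> i \<le> K \<and> u i \<le> v}" using assms by auto
  then have g: "g \<in> {i. e \<le> i \<and> i \<le> K \<and> u i \<le> v}" unfolding g_def using Max_in[OF fin] by blast
  moreover have "v < u (Suc g)" if "g < K"
  proof (rule ccontr)
    assume "\<not> v < u (Suc g)"
    then have "Suc g \<le> g" unfolding g_def using g that g_def
      by (intro Max_ge[OF fin]) auto
    then show False by simp
  qed
  ultimately show ?thesis using that by auto
qed

text \<open>Each outer corner moves to the right at constant height. Only unmoved points above the
  staircase can then get out of order, and they are traded for further corners. Control of the
  letters at both ends allows the rerouted chain to be inserted between parts that lie further left
  and further right. The corners \<open>U 1\<close> and \<open>C K\<close> outside \<open>D\<close>
  take part.\<close>

lemma value_shift:
  assumes "Z \<noteq> []" "chain Z" "set Z \<subseteq> X \<union> U ` {1..K}"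
  shows "\<exists>Z'. Z' \<noteq> [] \<and> chain Z' \<and> set Z' \<subseteq> X \<union> C ` {1..K} \<and> length Z \<le> length Z' \<and>
    snd (last Z') \<le> snd (last Z) \<and> snd (hd Z') = snd (hd Z)"
proof -
  have "\<exists>Z'. Z' \<noteq> [] \<and> chain Z' \<and> set Z' \<subseteq> X \<union> C ` {1..K} \<and> length Z \<le> length Z' \<and>
    snd (last Z') \<le> snd (last Z) \<and> (hd Z \<in> X \<and> hd Z' = hd Z \<or> (\<exists>e\<in>{1..K}. hd Z = U e \<and> hd Z' = C e))"
  proof (rule shift_chain[OF transp_prec _ _ _ _ _ assms, where B = above])
    fix i j assume "1 \<le> i" "i < j" "j \<le> K" then show "C i \<prec> C j" by (rule CC)
  next
    fix z e assume "e \<in> {1..K}" "z \<prec> U e" then show "z \<prec> C e"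
      using p_Suc[of e] by (auto simp: prec_def)
  next
    fix e j ys assume *: "e \<in> {1..K}" "j \<in> {1..K}" "chain (U e # ys @ [U j])" "set ys \<subseteq> X"
    then have "e < j" using p_le[of j e] by (force simp: sorted_wrt_append prec_def)
    then have "e + length ys \<le> j - 1"
      using * by (intro box_U) (auto simp: sorted_wrt_append prec_def)
    then show "e + length ys < j" using \<open>e < j\<close> by simp
  next
    fix e z ys assume *: "e \<in> {1..K}" "chain (U e # ys @ [z])" "set ys \<subseteq> X \<inter> above" "z \<in> X - above"
    then have "z \<in> below" using above_or_below[of z] by blast
    then obtain h where h: "2 \<le> h" "h \<le> K" "p h < fst z" "snd z < u (h - 1)" by (auto simp: below_def)
    have "u e \<le> snd z" using * by (auto simp: prec_def)
    moreover have "1 \<le> e" "e \<le> K" using *(1) by auto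
    \<comment> \<open>\<open>g\<close> is the last step whose level \<open>z\<close> reaches; since
      \<open>z\<close> lies below the staircase, it is to the right of \<open>C g\<close>.\<close>
    ultimately obtain g where g: "e \<le> g" "g \<le> K" "u g \<le> snd z" "g < K \<Longrightarrow> snd z < u (Suc g)"
      using level by metis
    have gh: "g < h - 1" using u_le[of "h - 1" g] g h by force
    have "p (Suc g) \<le> p h" using gh h by (intro p_le) auto
    then have "C g \<prec> z" using g h by (auto simp: prec_def)
    moreover have "e + length ys \<le> g"
    proof (rule box_U)
      fix y assume y: "y \<in> set ys"
      then obtain i where i: "1 \<le> i" "i < K" "fst y < p (Suc i)" "u (Suc i) < snd y" using * by (auto simp: above_def)
      have yz: "y \<prec> z" using * y by (auto simp: sorted_wrt_append)
      \<comment> \<open>A point above the staircase but not higher than \<open>z\<close> sits in a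
        column that ends at \<open>p (Suc g)\<close> or earlier.\<close>
      have "Suc i \<le> g" using u_le[of "Suc g" "Suc i"] yz g(4) gh h i by (force simp: prec_def)
      then have "fst y < p (Suc g)" using p_le[of "Suc i" "Suc g"] i g by auto
      then show "fst y < p (Suc g) \<and> (g < K \<longrightarrow> snd y \<le> u (Suc g))"
        using yz g by (auto simp: prec_def)
      show "p e < fst y \<and> u e \<le> snd y" using * y by (auto simp: prec_def)
    qed (use * g in \<open>auto simp: sorted_wrt_append\<close>)
    ultimately show "\<exists>g\<in>{e..K}. e + length ys \<le> g \<and> C g \<prec> z" using g by auto
  next
    fix e ys assume *: "e \<in> {1..K}" "chain (U e # ys)" "set ys \<subseteq> X \<inter> above"
    show "\<exists>g\<in>{e..K}. e + length ys \<le> g \<and> snd (C g) \<le> snd (last (U e # ys))"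
    proof (cases "ys = []")
      case False
      let ?z = "last ys"
      have zs: "?z \<in> set ys" using False by simp
      have "u e \<le> snd ?z" using * zs by (auto simp: prec_def)
      moreover have "1 \<le> e" "e \<le> K" using *(1) by auto
      ultimately obtain g where g: "e \<le> g" "g \<le> K" "u g \<le> snd ?z" "g < K \<Longrightarrow> snd ?z < u (Suc g)"
        using level by metis
      have "e + length ys \<le> g"
      proof (rule box_U)
        fix y assume y: "y \<in> set ys"
        then obtain i where i: "1 \<le> i" "i < K" "fst y < p (Suc i)" "u (Suc i) < snd y" using * by (auto simp: above_def)
        have "ys = butlast ys @ [?z]" using False by simp
        then have "sorted_wrt (\<prec>) (butlast ys @ [?z])" using * by simp
        then have "\<forall>y\<in>set (butlast ys). y \<prec> ?z" unfolding sorted_wrt_append by simp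
        moreover have "y \<in> set (butlast ys @ [?z])" using y False by simp
        ultimately have yz: "snd y \<le> snd ?z" by (auto simp: prec_def)
        have "Suc i \<le> g"
        proof (rule ccontr)
          assume "\<not> Suc i \<le> g"
          then show False using u_le[of "Suc g" "Suc i"] yz g(4) i by force
        qed
        then have "fst y < p (Suc g)" using p_le[of "Suc i" "Suc g"] i g by auto
        then show "fst y < p (Suc g) \<and> (g < K \<longrightarrow> snd y \<le> u (Suc g))"
          using yz g by auto
        show "p e < fst y \<and> u e \<le> snd y" using * y by (auto simp: prec_def)
      qed (use * g in auto)
      then show ?thesis using g False by auto
    qed (use * in auto)
  qed
  then show ?thesis by fastforce
qed

text \<open>The counterpart that fixes positions: an inner corner rises to the outer corner at the
  same position, and now unmoved points below the staircase are traded for corners. Everything stays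
  inside \<open>D\<close>.\<close>

lemma position_shift:
  assumes "Z \<noteq> []" "chain Z" "set Z \<subseteq> pts D f'"
  shows "\<exists>Z'. Z' \<noteq> [] \<and> chain Z' \<and> set Z' \<subseteq> pts D f \<and> length Z \<le> length Z' \<and>
    fst (last Z') \<le> fst (last Z) \<and> fst (hd Z') = fst (hd Z)"
proof -
  have Z: "set Z \<subseteq> X \<union> C ` {1..K - 1}" using assms(3) K pts_f'
    by (metis atLeastLessThanSuc_atLeastAtMost Suc_diff_1 Suc_1 Suc_le_lessD less_le_trans zero_less_Suc)
  \<comment> \<open>\<open>C i\<close> and \<open>U (Suc i)\<close> share the position
    \<open>p (Suc i)\<close>, so old and new points are matched with an index shift of one, and
    there are \<open>K - 1\<close> of them.\<close>
  have pf: "pts D f = X \<union> (\<lambda>i. U (Suc i)) ` {1..K - 1}"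
  proof -
    have e: "{2..K} = Suc ` {1..K - 1}" using K by (auto simp: image_Suc_atLeastAtMost)
    show ?thesis unfolding pts_f e image_image ..
  qed
  have "\<exists>Z'. Z' \<noteq> [] \<and> chain Z' \<and> set Z' \<subseteq> X \<union> (\<lambda>i. U (Suc i)) ` {1..K - 1} \<and> length Z \<le> length Z' \<and>
    fst (last Z') \<le> fst (last Z) \<and>
    (hd Z \<in> X \<and> hd Z' = hd Z \<or> (\<exists>e\<in>{1..K - 1}. hd Z = C e \<and> hd Z' = U (Suc e)))"
  proof (rule shift_chain[OF transp_prec _ _ _ _ _ assms(1,2) Z, where B = below])
    fix i j assume "1 \<le> i" "i < j" "j \<le> K - 1" then show "U (Suc i) \<prec> U (Suc j)" by (intro UU) auto
  next
    fix z e assume "e \<in> {1..K - 1}" "z \<prec> C e" moreover have "u e \<le> u (Suc e)" using K \<open>e \<in> {1..K - 1}\<close> by (intro u_Suc) auto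
    ultimately show "z \<prec> U (Suc e)" by (auto simp: prec_def)
  next
    fix e j ys assume *: "e \<in> {1..K - 1}" "j \<in> {1..K - 1}" "chain (C e # ys @ [C j])" "set ys \<subseteq> X"
    then have "p (Suc e) < p (Suc j)" by (auto simp: sorted_wrt_append prec_def)
    then have "e < j" using p_le[of "Suc j" "Suc e"] * by force
    then have "Suc e + length ys \<le> j"
      using * by (intro box_C) (auto simp: sorted_wrt_append prec_def)
    then show "e + length ys < j" using \<open>e < j\<close> by simp
  next
    fix e z ys assume *: "e \<in> {1..K - 1}" "chain (C e # ys @ [z])" "set ys \<subseteq> X \<inter> below" "z \<in> X - below"
    then have "z \<in> above" using above_or_below[of z] by blast
    then obtain h where h: "1 \<le> h" "h < K" "p h < fst z" "fst z < p (Suc h)" "u (Suc h) < snd z" by (auto simp: above_def)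
    have "p (Suc e) < fst z" using * by (auto simp: prec_def)
    then have eh: "e < h" using p_le[of "Suc h" "Suc e"] h * by force
    have "U h \<prec> z" using u_le[of h "Suc h"] h by (auto simp: prec_def)
    moreover have "Suc e + length ys \<le> h"
    proof (rule box_C)
      fix y assume y: "y \<in> set ys"
      then obtain i where i: "2 \<le> i" "i \<le> K" "p i < fst y" "snd y < u (i - 1)" using * by (auto simp: below_def)
      have yz: "y \<prec> z" using * y by (auto simp: sorted_wrt_append)
      have "p i < p (Suc h)" using yz i h by (auto simp: prec_def)
      then have "i \<le> h" using p_less_iff[of i "Suc h"] i h by auto
      then have "u (i - 1) \<le> u h" using i h by (intro u_le) auto
      then have "snd y < u h" using i by simp
      then show "fst y < p (Suc h) \<and> (h < K \<longrightarrow> snd y \<le> u h)"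
        using yz h by (auto simp: prec_def)
      show "p (Suc e) < fst y \<and> (1 < Suc e \<longrightarrow> u (Suc e - 1) \<le> snd y)" using * y by (auto simp: prec_def)
    qed (use * h eh in \<open>auto simp: sorted_wrt_append\<close>)
    ultimately show "\<exists>g\<in>{e..K - 1}. e + length ys \<le> g \<and> U (Suc g) \<prec> z" using eh h
      by (intro bexI[of _ "h - 1"]) auto
  next
    fix e ys assume *: "e \<in> {1..K - 1}" "chain (C e # ys)" "set ys \<subseteq> X \<inter> below"
    show "\<exists>g\<in>{e..K - 1}. e + length ys \<le> g \<and> fst (U (Suc g)) \<le> fst (last (C e # ys))"
    proof (cases "ys = []")
      case False
      let ?z = "last ys"
      have zs: "?z \<in> set ys" using False by simp
      then have "?z \<in> below" using * by auto
      then obtain h where h: "2 \<le> h" "h \<le> K" "p h < fst ?z" "fst ?z < p (Suc h)" "snd ?z < u (h - 1)" by (auto simp: below_def)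
      have "p (Suc e) < fst ?z" using * zs by (auto simp: prec_def)
      then have "p (Suc e) < p (Suc h)" using h by simp
      moreover have "e \<le> K" using * by auto
      ultimately have eh: "Suc e \<le> h" using p_less_iff[of "Suc e" "Suc h"] h by auto
      have "Suc e + length ys \<le> h"
      proof (rule box_C)
        fix y assume y: "y \<in> set ys"
        have "ys = butlast ys @ [?z]" using False by simp
        then have "sorted_wrt (\<prec>) (butlast ys @ [?z])" using * by simp
        then have "\<forall>y\<in>set (butlast ys). y \<prec> ?z" unfolding sorted_wrt_append by simp
        moreover have "y \<in> set (butlast ys @ [?z])" using y False by simp
        ultimately have yz: "fst y \<le> fst ?z" "snd y \<le> snd ?z" by (auto simp: prec_def)
        moreover have "u (h - 1) \<le> u h" using u_le[of "h - 1" h] h by simp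
        ultimately show "fst y < p (Suc h) \<and> (h < K \<longrightarrow> snd y \<le> u h)" using h by linarith
        show "p (Suc e) < fst y \<and> (1 < Suc e \<longrightarrow> u (Suc e - 1) \<le> snd y)" using * y by (auto simp: prec_def)
      qed (use * h eh in auto)
      then show ?thesis using h False eh by (intro bexI[of _ "h - 1"]) auto
    qed (use * in auto)
  qed
  then show ?thesis unfolding pf by fastforce
qed

end

section \<open>The half-turn symmetry of staircases\<close>

definition flip :: "int \<times> int \<Rightarrow> int \<times> int" where "flip x = (- fst x, - snd x)"

lemma flip_flip [simp]: "flip (flip x) = x"
  by (simp add: flip_def)

lemma fst_flip [simp]: "fst (flip x) = - fst x" and snd_flip [simp]: "snd (flip x) = - snd x"
  by (auto simp: flip_def)

lemma chain_flip: "chain xs \<Longrightarrow> chain (rev (map flip xs))"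
  by (auto simp: sorted_wrt_rev sorted_wrt_map prec_def elim!: sorted_wrt_mono_rel[rotated])

lemma pts_flip: "pts (uminus ` D) (\<lambda>s. - f (- s)) = flip ` pts D f"
  by (force simp: pts_def flip_def)

lemma short_flip: "short K Y \<Longrightarrow> short K (flip ` Y)"
  unfolding short_def
proof (intro allI impI)
  fix xs assume Y: "\<forall>xs. chain xs \<longrightarrow> set xs \<subseteq> Y \<longrightarrow> length xs < K" and xs: "chain xs" "set xs \<subseteq> flip ` Y"
  have "set (rev (map flip xs)) \<subseteq> Y" using xs(2) by auto
  then show "length xs < K" using Y chain_flip[OF xs(1)] by fastforce
qed

text \<open>The half-turn reverses the order of the corners. There are \<open>K + 1\<close>
  positions but only \<open>K\<close> values, hence the indices \<open>K + 2 - i\<close> and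
  \<open>K + 1 - i\<close>; outer and inner corners change places.\<close>

lemma (in staircase) staircase_flip:
  "staircase K (\<lambda>i. - p (K + 2 - i)) (\<lambda>i. - u (K + 1 - i)) (uminus ` D) (\<lambda>s. - f' (- s)) (\<lambda>s. - f (- s))"
proof
  fix i assume i: "1 \<le> i" "i \<le> K"
  then have "K + 2 - i = Suc (K + 2 - Suc i)" by simp
  then show "- p (K + 2 - i) < - p (K + 2 - Suc i)" using p_Suc[of "K + 2 - Suc i"] i by simp
next
  fix i assume i: "1 \<le> i" "i < K"
  then have "K + 1 - i = Suc (K + 1 - Suc i)" by simp
  then show "- u (K + 1 - i) \<le> - u (K + 1 - Suc i)" using u_Suc[of "K + 1 - Suc i"] i by simp
next
  show "uminus ` D \<subseteq> {- p (K + 2 - 1)<..<- p (K + 2 - Suc K)}" using D by auto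
next
  fix i assume i: "2 \<le> i" "i \<le> K"
  then have "K + 1 - (i - 1) = K + 2 - i" "K + 2 - i - 1 = K + 1 - i" by auto
  then show "- p (K + 2 - i) \<in> uminus ` D \<and> - f' (- (- p (K + 2 - i))) = - u (K + 1 - i) \<and>
       - f (- (- p (K + 2 - i))) = - u (K + 1 - (i - 1))"
    using corner[of "K + 2 - i"] i by simp
next
  fix s assume s: "s \<in> uminus ` D - (\<lambda>i. - p (K + 2 - i)) ` {2..K}"
  have "- s \<in> D - p ` {2..K}"
  proof
    show "- s \<in> D" using s by auto
    show "- s \<notin> p ` {2..K}"
    proof
      assume "- s \<in> p ` {2..K}"
      then obtain i where "2 \<le> i" "i \<le> K" "s = - p i" by (auto simp: minus_equation_iff)
      then have "s \<in> (\<lambda>i. - p (K + 2 - i)) ` {2..K}" by (intro image_eqI[of _ _ "K + 2 - i"]) auto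
      then show False using s by simp
    qed
  qed
  then show "- f (- s) = - f' (- s)" using same by simp
next
  show "short K (pts (uminus ` D) (\<lambda>s. - f' (- s)))" "short K (pts (uminus ` D) (\<lambda>s. - f (- s)))"
    unfolding pts_flip using short by (auto intro: short_flip)
qed (use K D in auto)

text \<open>Under the half-turn the two ends of a chain are swapped: here the last position is kept
  and the first one can only move to the right.\<close>

lemma (in staircase) position_shift':
  assumes "Z \<noteq> []" "chain Z" "set Z \<subseteq> pts D f"
  shows "\<exists>Z'. Z' \<noteq> [] \<and> chain Z' \<and> set Z' \<subseteq> pts D f' \<and> length Z \<le> length Z' \<and>
    fst (last Z') = fst (last Z) \<and> fst (hd Z) \<le> fst (hd Z')"
proof -
  let ?Z = "rev (map flip Z)"
  have "?Z \<noteq> []" "chain ?Z" "set ?Z \<subseteq> pts (uminus ` D) (\<lambda>s. - f (- s))"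
    using assms chain_flip by (auto simp: pts_flip)
  from staircase.position_shift[OF staircase_flip this] obtain Z' where
    Z': "Z' \<noteq> []" "chain Z'" "set Z' \<subseteq> flip ` pts D f'" "length ?Z \<le> length Z'"
      "fst (last Z') \<le> fst (last ?Z)" "fst (hd Z') = fst (hd ?Z)" unfolding pts_flip by auto
  then show ?thesis using chain_flip[OF Z'(2)] assms(1)
    by (intro exI[of _ "rev (map flip Z')"]) (auto simp: hd_rev last_rev last_map hd_map)
qed

text \<open>The half-turned form of \<open>value_shift\<close>; what has to be checked is that the
  unmoved points and the corners of the flipped staircase are the flipped ones.\<close>

lemma (in staircase) value_shift':
  assumes "Z \<noteq> []" "chain Z" "set Z \<subseteq> X \<union> C ` {1..K}"
  shows "\<exists>Z'. Z' \<noteq> [] \<and> chain Z' \<and> set Z' \<subseteq> X \<union> U ` {1..K} \<and> length Z \<le> length Z' \<and>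
    snd (last Z') = snd (last Z) \<and> snd (hd Z) \<le> snd (hd Z')"
proof -
  interpret f: staircase K "\<lambda>i. - p (K + 2 - i)" "\<lambda>i. - u (K + 1 - i)" "uminus ` D" "\<lambda>s. - f' (- s)" "\<lambda>s. - f (- s)"
    by (rule staircase_flip)
  have X': "X = pts (D - p ` {2..K}) f'"
    using same by (auto simp: X_def mem_pts_iff)
  have rng: "(\<lambda>i. h (K + 2 - i)) ` {2..K} = h ` {2..K}" for h :: "nat \<Rightarrow> int"
  proof -
    have "(\<lambda>i. K + 2 - i) ` {2..K} = {2..K}"
    proof (intro equalityI subsetI)
      fix x assume "x \<in> {2..K}"
      then show "x \<in> (\<lambda>i. K + 2 - i) ` {2..K}" by (intro image_eqI[of _ _ "K + 2 - x"]) auto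
    qed auto
    then show ?thesis by (metis image_image)
  qed
  have "uminus ` D - (\<lambda>i. - p (K + 2 - i)) ` {2..K} = uminus ` (D - p ` {2..K})"
    using rng[of "\<lambda>i. - p i"] by (auto simp: image_iff)
  then have fX: "f.X = flip ` X" unfolding f.X_def X' by (simp add: pts_flip)
  have fU: "f.U i = flip (C (K + 1 - i))" if "i \<in> {1..K}" for i
    using that by (auto simp: flip_def Suc_diff_le)
  have fC: "f.C i = flip (U (K + 1 - i))" if "i \<in> {1..K}" for i
    using that by (auto simp: flip_def)
  let ?Z = "rev (map flip Z)"
  have "set ?Z \<subseteq> f.X \<union> f.U ` {1..K}"
  proof
    fix x assume "x \<in> set ?Z"
    then obtain z where z: "z \<in> set Z" "x = flip z" by auto
    then consider "z \<in> X" | i where "i \<in> {1..K}" "z = C i" using assms by auto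
    then show "x \<in> f.X \<union> f.U ` {1..K}"
    proof cases
      case (2 i)
      have "x = f.U (K + 1 - i)" using z fU[of "K + 1 - i"] 2 by (auto simp: flip_def)
      moreover have "K + 1 - i \<in> {1..K}" using 2 by auto
      ultimately show ?thesis by blast
    qed (use fX z in auto)
  qed
  moreover have "?Z \<noteq> []" "chain ?Z" using assms chain_flip by auto
  ultimately obtain Z' where
    Z': "Z' \<noteq> []" "chain Z'" "set Z' \<subseteq> f.X \<union> f.C ` {1..K}" "length ?Z \<le> length Z'"
      "snd (last Z') \<le> snd (last ?Z)" "snd (hd Z') = snd (hd ?Z)" using f.value_shift[of ?Z] by auto
  have "set (rev (map flip Z')) \<subseteq> X \<union> U ` {1..K}"
  proof
    fix x assume "x \<in> set (rev (map flip Z'))"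
    then obtain z where z: "z \<in> set Z'" "x = flip z" by auto
    then consider "z \<in> f.X" | i where "i \<in> {1..K}" "z = f.C i" using Z' by auto
    then show "x \<in> X \<union> U ` {1..K}"
    proof cases
      case (2 i)
      have "x = U (K + 1 - i)" using z fC[of i] 2 by simp
      moreover have "K + 1 - i \<in> {1..K}" using 2 by auto
      ultimately show ?thesis by blast
    qed (use fX z in auto)
  qed
  then show ?thesis using chain_flip[OF Z'(2)] assms(1) Z'
    by (intro exI[of _ "rev (map flip Z')"]) (auto simp: hd_rev last_rev last_map hd_map)
qed

subsection \<open>Existence and uniqueness of a staircase\<close>

text \<open>The height drops strictly along \<open>\<prec>\<close>. So its level sets are
  antichains, and for a set with \<open>short K\<close> only the levels from 1 to
  \<open>K - 1\<close> occur.\<close>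

definition height :: "(int \<times> int) set \<Rightarrow> int \<times> int \<Rightarrow> nat" where
  "height Y x = Max {length xs | xs. chain xs \<and> xs \<noteq> [] \<and> hd xs = x \<and> set xs \<subseteq> Y}"

context
  fixes K Y assumes sh: "short K Y"
begin

lemma finite_heights: "finite {length xs | xs. chain xs \<and> xs \<noteq> [] \<and> hd xs = x \<and> set xs \<subseteq> Y}"
  by (rule finite_subset[of _ "{..<K}"]) (use sh in \<open>auto simp: short_def\<close>)

lemma length_le_height: "\<lbrakk>chain xs; xs \<noteq> []; set xs \<subseteq> Y\<rbrakk> \<Longrightarrow> length xs \<le> height Y (hd xs)"
  unfolding height_def by (intro Max_ge[OF finite_heights]) auto

lemma height_chain:
  assumes "x \<in> Y"
  obtains xs where "chain xs" "xs \<noteq> []" "hd xs = x" "set xs \<subseteq> Y" "length xs = height Y x"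
proof -
  have "length [x] \<in> {length xs | xs. chain xs \<and> xs \<noteq> [] \<and> hd xs = x \<and> set xs \<subseteq> Y}"
    using assms by (intro CollectI exI[of _ "[x]"]) auto
  then have "height Y x \<in> {length xs | xs. chain xs \<and> xs \<noteq> [] \<and> hd xs = x \<and> set xs \<subseteq> Y}"
    unfolding height_def by (intro Max_in[OF finite_heights]) blast
  then show ?thesis using that by auto
qed

lemma height_bounds: "x \<in> Y \<Longrightarrow> 1 \<le> height Y x \<and> height Y x < K"
  by (metis height_chain sh shortD length_greater_0_conv Suc_leI One_nat_def)

lemma height_less: "\<lbrakk>x \<in> Y; y \<in> Y; x \<prec> y\<rbrakk> \<Longrightarrow> height Y y < height Y x"
proof -
  assume *: "x \<in> Y" "y \<in> Y" "x \<prec> y"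
  obtain xs where xs: "chain xs" "xs \<noteq> []" "hd xs = y" "set xs \<subseteq> Y" "length xs = height Y y"
    using height_chain *(2) by blast
  have "chain ([x] @ xs)" by (rule sorted_wrt_prepend[OF transp_prec]) (use * xs in auto)
  then show ?thesis using length_le_height[of "x # xs"] xs * by auto
qed

lemma height_tail:
  assumes "x \<in> Y" "1 < height Y x"
  obtains y where "y \<in> Y" "x \<prec> y" "height Y y = height Y x - 1"
proof -
  obtain xs where xs: "chain xs" "xs \<noteq> []" "hd xs = x" "set xs \<subseteq> Y" "length xs = height Y x"
    using height_chain assms by blast
  then obtain y ys where ys: "xs = x # y # ys" using assms
    by (cases xs; cases "tl xs") auto
  then have y: "y \<in> Y" "x \<prec> y" using xs by auto
  have "height Y x - 1 \<le> height Y y" using length_le_height[of "y # ys"] ys xs by auto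
  then show ?thesis using that y height_less[OF assms(1) y] by auto
qed

end

context staircase begin

text \<open>The staircase from \<open>U i\<close> on is a chain of \<open>Suc K - i\<close> points.
  A longer chain from \<open>U i\<close>, preceded by \<open>U 2, ..., U (i - 1)\<close>, would
  reach length \<open>K\<close>.\<close>

lemma height_U:
  assumes "2 \<le> i" "i \<le> K"
  shows "height (pts D f) (U i) = Suc K - i"
proof (rule antisym)
  obtain xs where xs: "chain xs" "xs \<noteq> []" "hd xs = U i" "set xs \<subseteq> pts D f" "length xs = height (pts D f) (U i)"
    using height_chain[OF short(1) U_mem[OF assms]] by metis
  have c: "chain (map U [2..<i])" using assms by (intro chain_map_upt UU) auto
  have "chain (map U [2..<i] @ xs)"
  proof (cases "i = 2")
    case False
    then have l: "last (map U [2..<i]) = U (i - 1)" "map U [2..<i] \<noteq> []" using assms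
      by (auto simp: last_map)
    have "U (i - 1) \<prec> U i" using assms False by (intro UU) auto
    then show ?thesis using sorted_wrt_prepend[OF transp_prec c xs(1) l(2) xs(2)] l xs by simp
  qed (use xs in simp)
  moreover have "set (map U [2..<i] @ xs) \<subseteq> pts D f" using xs U_mem assms by auto
  ultimately have "length (map U [2..<i] @ xs) < K" using shortD short by blast
  then show "height (pts D f) (U i) \<le> Suc K - i" using xs assms by simp
next
  have "chain (map U [i..<Suc K])" "set (map U [i..<Suc K]) \<subseteq> pts D f" "map U [i..<Suc K] \<noteq> []"
    using assms U_mem by (auto intro!: chain_map_upt UU simp del: upt_Suc)
  moreover have "hd (map U [i..<Suc K]) = U i" using assms by (simp add: upt_conv_Cons del: upt_Suc)
  ultimately show "Suc K - i \<le> height (pts D f) (U i)"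
    using length_le_height[OF short(1), of "map U [i..<Suc K]"] by (simp del: upt_Suc)
qed

text \<open>The staircase is the greedy one, so it can be read off from \<open>f\<close> and \<open>u 1\<close>. If some
  \<open>y\<close> were further to the right, a maximal chain from \<open>y\<close>, cut where it meets the staircase and
  completed by points \<open>C i\<close> on both sides, would have \<open>K\<close> points in \<open>pts D f'\<close>.\<close>

lemma U_rightmost:
  assumes i: "1 \<le> i" "i < K" and y: "y \<in> pts D f" "height (pts D f) y = K - i" "u i \<le> snd y"
  shows "fst y \<le> p (Suc i)"
proof (rule ccontr)
  let ?h = "height (pts D f)"
  assume "\<not> fst y \<le> p (Suc i)"
  obtain xs where xs: "chain xs" "xs \<noteq> []" "hd xs = y" "set xs \<subseteq> pts D f" "length xs = K - i"
    using height_chain[OF short(1) y(1)] y(2) by metis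
  have xt: "xs ! t \<in> pts D f" if "t < K - i" for t
    using nth_mem[of t xs] xs that by auto
  \<comment> \<open>Heights drop by at least one at each step, and the rest of the chain bounds each
    height from below; hence they drop by exactly one.\<close>
  have hx: "?h (xs ! t) = K - i - t" if "t < K - i" for t
    using that
  proof (induction "K - i - t" arbitrary: t rule: less_induct)
    case less
    have "length (drop t xs) \<le> ?h (hd (drop t xs))"
      using xs less.prems by (intro length_le_height[OF short(1)])
        (auto intro: sorted_wrt_drop dest: in_set_dropD)
    then have ge: "K - i - t \<le> ?h (xs ! t)" using xs less.prems by (simp add: hd_drop_conv_nth)
    have "?h (xs ! t) + t \<le> K - i" if "t < K - i" for t
      using that
    proof (induction t)
      case 0
      then show ?case using xs y by (simp add: hd_conv_nth)
    next
      case (Suc t)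
      have "xs ! t \<prec> xs ! Suc t" using sorted_wrt_nth_less[OF xs(1), of t "Suc t"] xs Suc.prems by auto
      then have "?h (xs ! Suc t) < ?h (xs ! t)" using xs Suc.prems
        by (intro height_less[OF short(1)]) auto
      then show ?case using Suc by auto
    qed
    then show ?case using ge less.prems by force
  qed
  have yr: "p (Suc i) < fst (xs ! 0)" using \<open>\<not> fst y \<le> p (Suc i)\<close> xs by (simp add: hd_conv_nth)
  \<comment> \<open>\<open>r\<close> is the first index at which the chain is no longer to the right
    of the staircase, or \<open>K - i\<close> if this never happens.\<close>
  define r where "r = (LEAST r. r = K - i \<or> (r < K - i \<and> fst (xs ! r) \<le> p (Suc (i + r))))"
  have r: "r = K - i \<or> (r < K - i \<and> fst (xs ! r) \<le> p (Suc (i + r)))"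
    unfolding r_def by (rule LeastI[of _ "K - i"]) simp
  have right: "p (Suc (i + t)) < fst (xs ! t)" if "t < r" for t
  proof -
    have "\<not> (t = K - i \<or> (t < K - i \<and> fst (xs ! t) \<le> p (Suc (i + t))))"
      using that unfolding r_def by (rule not_less_Least)
    then show ?thesis using that r by auto
  qed
  have r0: "0 < r" using r yr i by (cases r) auto
  have rK: "r \<le> K - i" using r by auto
  \<comment> \<open>The point \<open>xs ! t\<close> and the corner \<open>U (Suc (i + t))\<close>
    have the same height, so they are incomparable; being to the right of the corner, the point must
    be lower.\<close>
  have low: "snd (xs ! t) < u (Suc (i + t))" if t: "t < r" for t
  proof (rule ccontr)
    assume "\<not> snd (xs ! t) < u (Suc (i + t))"
    then have "U (Suc (i + t)) \<prec> xs ! t" using right[OF t] by (auto simp: prec_def)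
    then have "?h (xs ! t) < ?h (U (Suc (i + t)))"
      using t rK i by (intro height_less[OF short(1)] U_mem xt) auto
    then show False using hx[of t] height_U[of "Suc (i + t)"] t rK i by auto
  qed
  have unmod: "xs ! t \<in> X" if t: "t < r" for t
  proof (rule ccontr)
    assume "xs ! t \<notin> X"
    then obtain j where j: "2 \<le> j" "j \<le> K" "xs ! t = U j" using xt[of t] t rK pts_f by auto
    then have "Suc K - j = K - i - t" using hx[of t] height_U t rK by auto
    then have "j = Suc (i + t)" using j t rK i by auto
    then show False using right[OF t] j by simp
  qed
  \<comment> \<open>The three pieces have \<open>i\<close>, \<open>r\<close> and
    \<open>K - i - r\<close> points, in total \<open>K\<close>, and all of them lie on the graph of
    \<open>f'\<close>.\<close>
  let ?L = "map C [1..<Suc i] @ take r xs @ map C [i + r..<K]"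
  have "chain ?L"
  proof (rule glue)
    show "chain (map C [1..<Suc i])" using i by (intro chain_map_upt CC) auto
    show "chain (map C [i + r..<K])" using i by (intro chain_map_upt CC) auto
    show "chain (take r xs)" using xs by (intro sorted_wrt_take)
    show "take r xs \<noteq> []" using r0 xs by simp
  next
    fix a b assume a: "a \<in> set (map C [1..<Suc i])" and b: "b \<in> set (take r xs)"
    from a obtain j where j: "a = C j" "1 \<le> j" "j \<le> i" by auto
    have "b \<in> set xs" using b by (rule in_set_takeD)
    then have "b = y \<or> y \<prec> b" using xs by (cases xs) auto
    then have "fst y \<le> fst b" "snd y \<le> snd b" by (auto simp: prec_def)
    moreover have "p (Suc j) \<le> p (Suc i)" "u j \<le> u i" using j i by (auto intro!: p_le u_le)
    ultimately show "a \<prec> b" using j y \<open>\<not> fst y \<le> p (Suc i)\<close> by (auto simp: prec_def)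
  next
    fix a b assume a: "a \<in> set (take r xs)" and b: "b \<in> set (map C [i + r..<K])"
    from b obtain j where j: "b = C j" "i + r \<le> j" "j < K" by auto
    from a obtain t where t: "t < r" "a = xs ! t" using xs rK by (auto simp: in_set_conv_nth)
    have rlt: "r < K - i" using j rK by auto
    then have "fst (xs ! r) \<le> p (Suc (i + r))" using r by auto
    moreover have "fst (xs ! t) < fst (xs ! r)"
      using sorted_wrt_nth_less[OF xs(1), of t r] t rlt xs by (auto simp: prec_def)
    moreover have "p (Suc (i + r)) \<le> p (Suc j)" using j by (intro p_le) auto
    moreover have "u (Suc (i + t)) \<le> u j" using j t by (intro u_le) auto
    ultimately show "a \<prec> b" using low[OF t(1)] j t by (auto simp: prec_def)
  qed
  moreover have "set ?L \<subseteq> pts D f'"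
  proof -
    have "set (take r xs) \<subseteq> X"
    proof
      fix x assume "x \<in> set (take r xs)"
      then obtain t where "t < r" "x = xs ! t" using xs rK by (auto simp: in_set_conv_nth)
      then show "x \<in> X" using unmod by blast
    qed
    then show ?thesis using X_sub C_mem i by auto
  qed
  ultimately have "length ?L < K" using short shortD by blast
  then show False using xs rK i by (simp del: upt_Suc)
qed

end

text \<open>The greedy construction: the next corner is the rightmost point of the next lower height
  that is not below the current corner. The chain \<open>zs\<close> guarantees a point of height
  \<open>K - 1\<close> to begin with.\<close>

lemma staircase_exists:
  assumes K: "2 \<le> K" and D: "finite D" "D \<subseteq> {q<..<m}" and sh: "short K (pts D f)"
    and zs: "chain zs" "set zs \<subseteq> pts D f" "length zs = K - 1" "\<And>z. z \<in> set zs \<Longrightarrow> a \<le> snd z"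
  obtains p u f' where "staircase K p u D f f'" "p 1 = q" "p (Suc K) = m" "u 1 = a"
proof -
  let ?h = "height (pts D f)"
  define S where "S i v = {s \<in> D. ?h (s, f s) = K - i \<and> v \<le> f s}" for i v
  \<comment> \<open>\<open>g i\<close> holds position and value of corner \<open>i + 1\<close>. The
    starting pair \<open>(q, a)\<close> lies outside \<open>D\<close> and is not read off from
    \<open>f\<close>.\<close>
  define g where "g = rec_nat (q, a) (\<lambda>i x. (Max (S (Suc i) (snd x)), f (Max (S (Suc i) (snd x)))))"
  have g0: "g 0 = (q, a)" by (simp add: g_def)
  have gS: "g (Suc i) = (Max (S (Suc i) (snd (g i))), f (Max (S (Suc i) (snd (g i)))))" for i
    by (simp add: g_def)
  have finS: "finite (S i v)" for i v using D by (simp add: S_def)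
  have ne: "S (Suc i) (snd (g i)) \<noteq> {} \<and> fst (g i) < Max (S (Suc i) (snd (g i)))" if "Suc i < K" for i
    using that
  proof (induction i)
    case 0
    have z: "zs \<noteq> []" using zs K by auto
    then have "hd zs \<in> pts D f" "a \<le> snd (hd zs)" using zs by auto
    moreover have "K - 1 \<le> ?h (hd zs)" using length_le_height[OF sh zs(1) z zs(2)] zs(3) by simp
    moreover have "?h (hd zs) < K" using height_bounds[OF sh] calculation(1) by blast
    moreover have "hd zs = (fst (hd zs), f (fst (hd zs)))" "fst (hd zs) \<in> D"
      using calculation(1) by (auto simp: mem_pts_iff prod_eq_iff)
    ultimately have s: "fst (hd zs) \<in> S 1 a" unfolding S_def by (auto simp: mem_pts_iff)
    then have "Max (S 1 a) \<in> S 1 a" using finS Max_in by blast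
    then show ?case using s D by (auto simp: g0 S_def)
  next
    case (Suc i)
    let ?s = "Max (S (Suc i) (snd (g i)))"
    have "?s \<in> S (Suc i) (snd (g i))" using Suc finS Max_in by auto
    then have s: "(?s, f ?s) \<in> pts D f" "?h (?s, f ?s) = K - Suc i" by (auto simp: S_def mem_pts_iff)
    then have "1 < ?h (?s, f ?s)" using Suc.prems by linarith
    then obtain y where y: "y \<in> pts D f" "(?s, f ?s) \<prec> y" "?h y = ?h (?s, f ?s) - 1"
      by (rule height_tail[OF sh s(1)])
    then have yS: "fst y \<in> S (Suc (Suc i)) (snd (g (Suc i)))"
      using s(2) by (cases y) (auto simp: S_def gS mem_pts_iff prec_def)
    then have "fst y \<le> Max (S (Suc (Suc i)) (snd (g (Suc i))))" using finS by simp
    then show ?case using yS y(2) by (auto simp: gS prec_def)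
  qed
  define p where "p i = (if i = Suc K then m else fst (g (i - 1)))" for i
  define u where "u i = snd (g (i - 1))" for i
  have step: "p (Suc i) \<in> S i (u i)" "f (p (Suc i)) = u (Suc i)" "p i < p (Suc i)"
      "\<And>s. s \<in> S i (u i) \<Longrightarrow> s \<le> p (Suc i)" if "1 \<le> i" "i < K" for i
  proof -
    obtain j where j: "i = Suc j" using \<open>1 \<le> i\<close> by (cases i) auto
    have pS: "p (Suc i) = Max (S i (u i))" "p i = fst (g j)" "u (Suc i) = f (p (Suc i))"
      using that j by (auto simp: p_def u_def gS)
    then show "p (Suc i) \<in> S i (u i)" "f (p (Suc i)) = u (Suc i)" "p i < p (Suc i)"
      "\<And>s. s \<in> S i (u i) \<Longrightarrow> s \<le> p (Suc i)"
      using ne[of j] that finS Max_in[OF finS] j by (auto simp: u_def)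
  qed
  have Sp: "p i \<in> D" "f (p i) = u i" "?h (p i, f (p i)) = Suc K - i" "u (i - 1) \<le> u i" "p (i - 1) < p i"
    if "2 \<le> i" "i \<le> K" for i
    using step[of "i - 1"] that by (auto simp: S_def)
  have inj: "inj_on p {2..K}"
  proof (rule inj_onI)
    fix i j assume "i \<in> {2..K}" "j \<in> {2..K}" "p i = p j"
    then have "Suc K - i = Suc K - j" using Sp(3)[of i] Sp(3)[of j] by auto
    then show "i = j" using \<open>i \<in> {2..K}\<close> \<open>j \<in> {2..K}\<close> by auto
  qed
  define f' where "f' s = (if s \<in> p ` {2..K} then u (the_inv_into {2..K} p s - 1) else f s)" for s
  have f'p: "f' (p i) = u (i - 1)" if "2 \<le> i" "i \<le> K" for i
    using the_inv_into_f_f[OF inj, of i] that by (auto simp: f'_def)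
  have f'le: "f' s \<le> f s" for s
  proof (cases "s \<in> p ` {2..K}")
    case True
    then obtain i where "2 \<le> i" "i \<le> K" "s = p i" by auto
    then show ?thesis using f'p Sp by auto
  qed (simp add: f'_def)
  \<comment> \<open>Heights with respect to the old \<open>f\<close> still separate the points of a
    chain for \<open>f'\<close>: if \<open>s = p i\<close> and an unmoved \<open>t\<close> further
    right had the same height and a value at least \<open>u (i - 1)\<close>, then \<open>t\<close>
    would have been preferred to \<open>p i\<close>. With only \<open>K - 1\<close> heights
    available, chains for \<open>f'\<close> stay short.\<close>
  have heights_differ: "?h (s, f s) \<noteq> ?h (t, f t)" if st: "s \<in> D" "t \<in> D" "s < t" "f' s \<le> f' t" for s t
  proof (cases "s \<in> p ` {2..K}")
    case True
    then obtain i where i: "2 \<le> i" "i \<le> K" "s = p i" by auto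
    show ?thesis
    proof
      assume eq: "?h (s, f s) = ?h (t, f t)"
      show False
      proof (cases "t \<in> p ` {2..K}")
        case True
        then obtain j where j: "2 \<le> j" "j \<le> K" "t = p j" by auto
        then have "i = j" using Sp(3)[of i] Sp(3)[of j] i eq by auto
        then show False using i j st by simp
      next
        case False
        then have "f t = f' t" by (simp add: f'_def)
        then have "t \<in> S (i - 1) (u (i - 1))" using st i f'p[of i] eq Sp(3)[of i] by (auto simp: S_def)
        moreover have "1 \<le> i - 1" "i - 1 < K" "Suc (i - 1) = i" using i by auto
        ultimately show False using step(4)[of "i - 1" t] i st by simp
      qed
    qed
  next
    case False
    then have "f s \<le> f t" using st f'le[of t] by (auto simp: f'_def)
    then have "(s, f s) \<prec> (t, f t)" using st by (simp add: prec_def)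
    then show ?thesis using height_less[OF sh, of "(s, f s)" "(t, f t)"] st by (auto simp: mem_pts_iff)
  qed
  have "short K (pts D f')"
    unfolding short_def
  proof (intro allI impI)
    fix xs assume xs: "chain xs" "set xs \<subseteq> pts D f'"
    define \<eta> where "\<eta> x = ?h (fst x, f (fst x))" for x :: "int \<times> int"
    have "distinct (map \<eta> xs)"
      using xs
    proof (induction xs)
      case (Cons x xs)
      have "\<eta> x \<noteq> \<eta> y" if "y \<in> set xs" for y
      proof -
        have "x \<in> pts D f'" "y \<in> pts D f'" "x \<prec> y" using Cons.prems that by auto
        then show ?thesis using heights_differ[of "fst x" "fst y"] by (auto simp: \<eta>_def prec_def mem_pts_iff)
      qed
      then show ?case using Cons by auto
    qed simp
    moreover have "set (map \<eta> xs) \<subseteq> {1..<K}"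
    proof
      fix e assume "e \<in> set (map \<eta> xs)"
      then obtain x where "x \<in> set xs" "e = \<eta> x" by auto
      then show "e \<in> {1..<K}"
        using height_bounds[OF sh, of "(fst x, f (fst x))"] xs by (auto simp: \<eta>_def mem_pts_iff)
    qed
    ultimately have "length xs \<le> card {1..<K}"
      by (metis card_mono distinct_card finite_atLeastLessThan length_map)
    then show "length xs < K" using K by simp
  qed
  moreover have "p 1 = q" "p (Suc K) = m" "u 1 = a" using K by (auto simp: p_def u_def g0)
  moreover have "p i < p (Suc i)" if "1 \<le> i" "i \<le> K" for i
  proof (cases "i = K")
    case True
    have "p K \<in> D" using Sp K by auto
    then show ?thesis using D True \<open>p (Suc K) = m\<close> by auto
  qed (use that step in auto)
  ultimately have "staircase K p u D f f'"
    using K D sh Sp f'p step by unfold_locales (auto simp: f'_def S_def)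
  then show ?thesis using that \<open>p 1 = q\<close> \<open>p (Suc K) = m\<close> \<open>u 1 = a\<close> by blast
qed

text \<open>Given a common value \<open>u i\<close>, the next corner of either staircase has height
  \<open>K - i\<close> and is not lower than \<open>u i\<close>. So \<open>U_rightmost\<close>
  applies to it in the other staircase, and the two positions bound each other.\<close>

lemma staircase_unique:
  assumes "staircase K p u D f f'" "staircase K q v D f g'" and uv: "u 1 = v 1"
  shows "\<lbrakk>1 \<le> i; i \<le> K\<rbrakk> \<Longrightarrow> u i = v i" and "s \<in> D \<Longrightarrow> f' s = g' s"
proof -
  interpret a: staircase K p u D f f' by fact
  interpret b: staircase K q v D f g' by fact
  have u: "u i = v i \<and> (1 < i \<longrightarrow> p i = q i)" if "1 \<le> i" "i \<le> K" for i
    using that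
  proof (induction i)
    case (Suc i)
    show ?case
    proof (cases "i = 0")
      case False
      then have i: "1 \<le> i" "i < K" "u i = v i" using Suc by auto
      have "u i \<le> u (Suc i)" "v i \<le> v (Suc i)" using a.u_Suc[OF i(1,2)] b.u_Suc[OF i(1,2)] by auto
      then have "q (Suc i) \<le> p (Suc i)" "p (Suc i) \<le> q (Suc i)"
        using a.U_rightmost[OF i(1,2), of "(q (Suc i), v (Suc i))"] b.U_rightmost[OF i(1,2), of "(p (Suc i), u (Suc i))"]
          a.U_mem[of "Suc i"] b.U_mem[of "Suc i"] a.height_U[of "Suc i"] b.height_U[of "Suc i"] i by auto
      then have "p (Suc i) = q (Suc i)" by simp
      then show ?thesis using a.corner[of "Suc i"] b.corner[of "Suc i"] i by auto
    qed (use uv in simp)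
  qed simp
  then show "\<lbrakk>1 \<le> i; i \<le> K\<rbrakk> \<Longrightarrow> u i = v i" by blast
  have img: "p ` {2..K} = q ` {2..K}" using u by (intro image_cong) auto
  show "f' s = g' s" if s: "s \<in> D"
  proof (cases "s \<in> p ` {2..K}")
    case True
    then obtain i where i: "2 \<le> i" "i \<le> K" "s = p i" by auto
    then show ?thesis using a.corner[of i] b.corner[of i] u[of i] u[of "i - 1"] by auto
  next
    case False
    then show ?thesis using a.same b.same img s by auto
  qed
qed

lemma chain_hd_last:
  assumes "chain xs" "x \<in> set xs"
  shows "fst (hd xs) \<le> fst x \<and> snd (hd xs) \<le> snd x \<and> fst x \<le> fst (last xs) \<and> snd x \<le> snd (last xs)"
  using assms
proof (induction xs)
  case (Cons a xs)
  show ?case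
  proof (cases "xs = []")
    case False
    then have "a \<prec> last xs" using Cons.prems by simp
    then have a: "fst a \<le> fst (last xs)" "snd a \<le> snd (last xs)" by (auto simp: prec_def)
    show ?thesis
    proof (cases "x = a")
      case False
      then have x: "x \<in> set xs" "a \<prec> x" using Cons.prems by auto
      then show ?thesis using Cons.IH Cons.prems \<open>xs \<noteq> []\<close> by (auto simp: prec_def)
    qed (use a \<open>xs \<noteq> []\<close> in simp)
  qed (use Cons in auto)
qed simp

lemma chain_split:
  assumes "chain xs" "\<And>x y. x \<prec> y \<Longrightarrow> P y \<Longrightarrow> P x"
  obtains xs1 xs2 where "xs = xs1 @ xs2" "\<forall>x\<in>set xs1. P x" "\<forall>x\<in>set xs2. \<not> P x"
proof -
  have "\<not> P x" if "x \<in> set (dropWhile P xs)" for x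
    using assms(1) that by (induction xs) (auto split: if_splits dest: assms(2))
  then show ?thesis using that[of "takeWhile P xs" "dropWhile P xs"] set_takeWhileD[of _ P xs] by auto
qed

subsection \<open>Words\<close>

text \<open>
  For a word \<open>w\<close> (positions from 1 on), these are the two patterns: a letter followed, before
  position \<open>m\<close>, by a weakly increasing chain of \<open>K\<close> smaller letters; and the letter at \<open>j\<close> preceded
  by such a chain.
\<close>

definition drop_chain :: "nat \<Rightarrow> (int \<Rightarrow> int) \<Rightarrow> int \<Rightarrow> bool" where
  "drop_chain K w m \<longleftrightarrow> (\<exists>s xs. 1 \<le> s \<and> chain xs \<and> set xs \<subseteq> pts {s<..<m} w \<and> K \<le> length xs \<and> (\<forall>x\<in>set xs. snd x < w s))"

definition rise_chain :: "nat \<Rightarrow> (int \<Rightarrow> int) \<Rightarrow> int \<Rightarrow> bool" where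
  "rise_chain K w j \<longleftrightarrow> (\<exists>xs. chain xs \<and> set xs \<subseteq> pts {0<..<j} w \<and> K \<le> length xs \<and> (\<forall>x\<in>set xs. snd x < w j))"

text \<open>The rotation of whole words: \<open>w\<close> carries \<open>U 1, ..., U K\<close> and
  then \<open>M\<close> at \<open>m\<close>, while \<open>w'\<close> carries \<open>M\<close> at
  \<open>q\<close> and then \<open>C 1, ..., C K\<close>. The condition \<open>before\<close> makes
  \<open>q\<close> recoverable from \<open>w'\<close>, as the leftmost position in front of
  \<open>m\<close> whose letter exceeds \<open>u K\<close>.\<close>

locale word_staircase = staircase K p u D w w'
  for K p u D w w' +
  assumes pos: "1 \<le> p 1"
    and D_eq: "D = {s. p 1 < s \<and> s < p (Suc K) \<and> w s < w (p (Suc K))}"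
    and w_ends: "w (p 1) = u 1" "w' (p 1) = w (p (Suc K))" "w' (p (Suc K)) = u K"
    and top: "u K < w (p (Suc K))"
    and outside: "\<And>s. s \<notin> insert (p 1) (insert (p (Suc K)) D) \<Longrightarrow> w' s = w s"
    and before: "\<And>s. 1 \<le> s \<Longrightarrow> s < p 1 \<Longrightarrow> w s \<le> u K"
begin

abbreviation "q \<equiv> p 1"
abbreviation "m \<equiv> p (Suc K)"
abbreviation "M \<equiv> w m"

lemma q_less_m: "q < m" using p_less[of 1 "Suc K"] K by simp

lemma D_range: "s \<in> D \<Longrightarrow> q < s \<and> s < m"
  using D(2) by auto

lemma outside_range: "s < q \<or> m < s \<Longrightarrow> w' s = w s"
proof (rule outside)
  assume s: "s < q \<or> m < s"
  have "s \<notin> D" using D_range s by force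
  then show "s \<notin> insert q (insert m D)" using s q_less_m by auto
qed

lemma D_eq': "D = {s. q < s \<and> s < m \<and> w' s < M}"
proof -
  have "w' s < M" if "s \<in> D" for s
  proof (cases "s \<in> p ` {2..K}")
    case True
    then obtain i where i: "2 \<le> i" "i \<le> K" "s = p i" by auto
    then have "u (i - 1) \<le> u K" by (intro u_le) auto
    then show ?thesis using corner[of i] i top by auto
  next
    case False
    then show ?thesis using same D_eq that by auto
  qed
  moreover have "s \<in> D" if "q < s" "s < m" "w' s < M" for s
    using outside[of s] that D_eq by auto
  ultimately show ?thesis using D by auto
qed

lemma D_memI: "\<lbrakk>q < s; s < m; w s < M \<or> w' s < M\<rbrakk> \<Longrightarrow> s \<in> D"
  using D_eq D_eq' by blast

lemma D_less: "s \<in> D \<Longrightarrow> w s < M" "s \<in> D \<Longrightarrow> w' s < M"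
  using D_eq D_eq' by blast+

lemma XU: "X \<union> U ` {1..K} = pts (insert q D) w"
proof -
  have "{1..K} = insert 1 {2..K}" using K by auto
  then show ?thesis using pts_f w_ends by (auto simp: pts_def)
qed

lemma XC: "X \<union> C ` {1..K} = pts (insert m D) w'"
proof -
  have "{1..K} = insert K {1..<K}" using K by auto
  then show ?thesis using pts_f' w_ends by (auto simp: pts_def)
qed

lemma pts_outside:
  "y \<in> pts {s<..<q} w \<longleftrightarrow> y \<in> pts {s<..<q} w'" "y \<in> pts {m<..<j} w \<longleftrightarrow> y \<in> pts {m<..<j} w'"
  "\<lbrakk>y \<in> pts {s<..<q} v; m \<le> j\<rbrakk> \<Longrightarrow> y \<in> pts {s<..<j} v"
  "\<lbrakk>y \<in> pts {m<..<j} v; s < q\<rbrakk> \<Longrightarrow> y \<in> pts {s<..<j} v"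
proof -
  have "w' (fst y) = w (fst y)" if "fst y < q \<or> m < fst y"
    using that by (rule outside_range)
  then show "y \<in> pts {s<..<q} w \<longleftrightarrow> y \<in> pts {s<..<q} w'" "y \<in> pts {m<..<j} w \<longleftrightarrow> y \<in> pts {m<..<j} w'"
    by (auto simp: mem_pts_iff)
qed (use q_less_m in \<open>auto simp: mem_pts_iff\<close>)

text \<open>Letters smaller than \<open>N \<le> u K\<close> are smaller than \<open>M\<close>, so a
  chain of such letters can meet the stretch from \<open>q\<close> to \<open>m\<close> only in
  \<open>D\<close> or in the end that does not carry \<open>M\<close>.\<close>

lemma below_top:
  assumes "chain xs" "set xs \<subseteq> pts {s<..<j} v" "s < q" "m \<le> j"
    and v: "v = w \<or> v = w'" and N: "N \<le> u K" "\<And>x. x \<in> set xs \<Longrightarrow> snd x < N"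
  obtains xa xb xc where "xs = xa @ xb @ xc" "set xa \<subseteq> pts {s<..<q} v" "set xc \<subseteq> pts {m<..<j} v"
    "set xb \<subseteq> (if v = w then pts (insert q D) w else pts (insert m D) w')"
proof -
  obtain xa xr where a: "xs = xa @ xr" "\<forall>x\<in>set xa. fst x < q" "\<forall>x\<in>set xr. \<not> fst x < q"
    using chain_split[OF assms(1), of "\<lambda>x. fst x < q"] by (auto simp: prec_def)
  have "chain xr" using a assms(1) by (simp add: sorted_wrt_append)
  then obtain xb xc where b: "xr = xb @ xc" "\<forall>x\<in>set xb. fst x \<le> m" "\<forall>x\<in>set xc. \<not> fst x \<le> m"
    using chain_split[of xr "\<lambda>x. fst x \<le> m"] by (auto simp: prec_def)
  have "set xb \<subseteq> (if v = w then pts (insert q D) w else pts (insert m D) w')"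
  proof
    fix x assume x: "x \<in> set xb"
    then have "x \<in> pts {s<..<j} v" "\<not> fst x < q" "fst x \<le> m" "snd x < N"
      using a b assms(2) N(2)[of x] by auto
    then have 1: "q \<le> fst x" "fst x \<le> m" "snd x = v (fst x)" "v (fst x) < N"
      by (auto simp: mem_pts_iff)
    show "x \<in> (if v = w then pts (insert q D) w else pts (insert m D) w')"
    proof (cases "v = w")
      case True
      then have "fst x \<noteq> m" using 1 N top by auto
      then show ?thesis using 1 N top True by (auto simp: mem_pts_iff D_eq)
    next
      case False
      then have "v = w'" using v by simp
      then have "fst x \<noteq> q" using 1 N top w_ends by auto
      then show ?thesis using 1 N top False \<open>v = w'\<close> by (auto simp: mem_pts_iff D_eq')
    qed
  qed
  moreover have "set xa \<subseteq> pts {s<..<q} v"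
  proof
    fix x assume "x \<in> set xa"
    then have "x \<in> pts {s<..<j} v" "fst x < q" using a assms(2) by auto
    then show "x \<in> pts {s<..<q} v" by (auto simp: mem_pts_iff)
  qed
  moreover have "set xc \<subseteq> pts {m<..<j} v"
  proof
    fix x assume "x \<in> set xc"
    then have "x \<in> pts {s<..<j} v" "m < fst x" using a b assms(2) by auto
    then show "x \<in> pts {m<..<j} v" by (auto simp: mem_pts_iff)
  qed
  ultimately show ?thesis using that a b by auto
qed

lemma reassemble:
  assumes "chain (xa @ xb @ xc)" "chain xb'" "xb \<noteq> []" "snd (hd xb) \<le> snd (hd xb')" "snd (last xb') \<le> snd (last xb)"
    "\<And>x y. x \<in> set xa \<Longrightarrow> y \<in> set xb' \<Longrightarrow> fst x < fst y" "\<And>x y. x \<in> set xb' \<Longrightarrow> y \<in> set xc \<Longrightarrow> fst x < fst y"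
  shows "chain (xa @ xb' @ xc)"
proof -
  have "x \<prec> y" if "x \<in> set xa" "y \<in> set xb'" for x y
    using assms(1,3,4) assms(6)[OF that] that chain_hd_last[OF assms(2) that(2)]
    by (cases xb) (force simp: sorted_wrt_append prec_def)+
  moreover have "x \<prec> y" if "x \<in> set xb'" "y \<in> set xc" for x y
  proof -
    have "last xb \<prec> y" using assms(1,3) that by (auto simp: sorted_wrt_append)
    then show ?thesis using assms(5) assms(7)[OF that] chain_hd_last[OF assms(2) that(1)] by (auto simp: prec_def)
  qed
  ultimately show ?thesis using assms(1,2) by (auto simp: sorted_wrt_append)
qed

text \<open>Only the middle part of the chain needs rerouting. \<open>value_shift\<close> keeps its
  first letter and does not raise its last one, so the outer parts still fit. The bound
  \<open>N \<le> u K\<close> keeps the new part away from \<open>m\<close>, whose new letter is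
  \<open>u K\<close>.\<close>

lemma transfer:
  assumes "chain xs" "set xs \<subseteq> pts {s<..<j} w" "s < q" "m \<le> j" "N \<le> u K" "\<And>x. x \<in> set xs \<Longrightarrow> snd x < N"
  shows "\<exists>xs'. chain xs' \<and> set xs' \<subseteq> pts {s<..<j} w' \<and> length xs \<le> length xs' \<and> (\<forall>x\<in>set xs'. snd x < N)"
proof -
  obtain xa xb xc where "xs = xa @ xb @ xc" "set xa \<subseteq> pts {s<..<q} w" "set xc \<subseteq> pts {m<..<j} w"
    "set xb \<subseteq> (if w = w then pts (insert q D) w else pts (insert m D) w')"
    by (rule below_top[OF assms(1-4) disjI1[OF refl] assms(5,6)])
  then have x: "xs = xa @ xb @ xc" "set xa \<subseteq> pts {s<..<q} w" "set xc \<subseteq> pts {m<..<j} w"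
    "set xb \<subseteq> X \<union> U ` {1..K}" using XU by simp_all
  have unch: "set xa \<subseteq> pts {s<..<j} w'" "set xc \<subseteq> pts {s<..<j} w'"
    using x(2,3) pts_outside(1,2) pts_outside(3,4)[where v = w'] assms(3,4) by blast+
  show ?thesis
  proof (cases "xb = []")
    case True
    then show ?thesis using x unch assms by (intro exI[of _ xs]) auto
  next
    case False
    have "chain xb" using x assms by (auto simp: sorted_wrt_append)
    then obtain xb' where b: "xb' \<noteq> []" "chain xb'" "set xb' \<subseteq> X \<union> C ` {1..K}" "length xb \<le> length xb'"
      "snd (last xb') \<le> snd (last xb)" "snd (hd xb') = snd (hd xb)"
      using value_shift[OF False _ x(4)] by blast
    have b3: "set xb' \<subseteq> pts (insert m D) w'" using b(3) XC by simp
    have lt: "snd y < N" if "y \<in> set xb'" for y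
      using chain_hd_last[OF b(2) that] b(5) assms(6)[of "last xb"] x False by auto
    have D': "set xb' \<subseteq> pts D w'"
    proof
      fix y assume y: "y \<in> set xb'"
      have "fst y \<noteq> m" using lt[OF y] b3 y w_ends(3) assms(5) by (auto simp: mem_pts_iff)
      then show "y \<in> pts D w'" using b3 y by (auto simp: mem_pts_iff)
    qed
    have "chain (xa @ xb' @ xc)"
      using reassemble[OF assms(1)[unfolded x(1)] b(2) False] b(5,6) D' x(2,3) D by (force simp: mem_pts_iff)
    moreover have "set xb' \<subseteq> pts {s<..<j} w'" using D' D assms(3,4) by (force simp: mem_pts_iff)
    ultimately show ?thesis using x unch lt b(4) assms(6)
      by (intro exI[of _ "xa @ xb' @ xc"]) (auto simp: ball_Un)
  qed
qed

lemma transfer':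
  assumes "chain xs" "set xs \<subseteq> pts {s<..<j} w'" "s < q" "m \<le> j" "N \<le> u K" "\<And>x. x \<in> set xs \<Longrightarrow> snd x < N"
  shows "\<exists>xs'. chain xs' \<and> set xs' \<subseteq> pts {s<..<j} w \<and> length xs \<le> length xs' \<and> (\<forall>x\<in>set xs'. snd x < N)"
proof -
  have "w' \<noteq> w" using w_ends top u_le[of 1 K] K by auto
  obtain xa xb xc where "xs = xa @ xb @ xc" "set xa \<subseteq> pts {s<..<q} w'" "set xc \<subseteq> pts {m<..<j} w'"
    "set xb \<subseteq> (if w' = w then pts (insert q D) w else pts (insert m D) w')"
    by (rule below_top[OF assms(1-4) disjI2[OF refl] assms(5,6)])
  then have x: "xs = xa @ xb @ xc" "set xa \<subseteq> pts {s<..<q} w'" "set xc \<subseteq> pts {m<..<j} w'"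
    "set xb \<subseteq> X \<union> C ` {1..K}" using XC \<open>w' \<noteq> w\<close> by simp_all
  have unch: "set xa \<subseteq> pts {s<..<j} w" "set xc \<subseteq> pts {s<..<j} w"
    using x(2,3) pts_outside(1,2) pts_outside(3,4)[where v = w] assms(3,4) by blast+
  show ?thesis
  proof (cases "xb = []")
    case True
    then show ?thesis using x unch assms by (intro exI[of _ xs]) auto
  next
    case False
    have "chain xb" using x assms by (auto simp: sorted_wrt_append)
    then obtain xb' where b: "xb' \<noteq> []" "chain xb'" "set xb' \<subseteq> X \<union> U ` {1..K}" "length xb \<le> length xb'"
      "snd (last xb') = snd (last xb)" "snd (hd xb) \<le> snd (hd xb')"
      using value_shift'[OF False _ x(4)] by blast
    have b3: "set xb' \<subseteq> pts (insert q D) w" using b(3) XU by simp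
    have lt: "snd y < N" if "y \<in> set xb'" for y
      using chain_hd_last[OF b(2) that] b(5) assms(6)[of "last xb"] x False by auto
    have "chain (xa @ xb' @ xc)"
      using reassemble[OF assms(1)[unfolded x(1)] b(2) False] b(5,6) b3 x(2,3) D q_less_m by (force simp: mem_pts_iff)
    moreover have "set xb' \<subseteq> pts {s<..<j} w" using b3 D assms(3,4) q_less_m by (force simp: mem_pts_iff)
    ultimately show ?thesis using x unch lt b(4) assms(6)
      by (intro exI[of _ "xa @ xb' @ xc"]) (auto simp: ball_Un)
  qed
qed

text \<open>The cases depend on the large letter at \<open>s\<close>. To the left of
  \<open>q\<close> it is at most \<open>u K\<close> by \<open>before\<close>, and
  \<open>transfer\<close> or \<open>transfer'\<close> applies. From \<open>q\<close> on, a letter of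
  size at most \<open>M\<close> would force \<open>K\<close> chain points into \<open>D\<close>. A
  letter above \<open>M\<close> is itself unmoved, and the chain is rerouted by position. Treating
  \<open>w\<close> and \<open>w'\<close> symmetrically gives both directions.\<close>

lemma drop_chain_transfer:
  assumes v: "(v = w \<and> v' = w') \<or> (v = w' \<and> v' = w)" and "drop_chain K v m"
  shows "drop_chain K v' m"
proof -
  obtain s xs where s: "1 \<le> s" "chain xs" "set xs \<subseteq> pts {s<..<m} v" "K \<le> length xs" "\<And>x. x \<in> set xs \<Longrightarrow> snd x < v s"
    using assms(2) unfolding drop_chain_def by blast
  have "xs \<noteq> []" using s K by auto
  then obtain x where "x \<in> set xs" by (cases xs) auto
  then have "x \<in> pts {s<..<m} v" using s(3) by auto
  then have sm: "s < m" by (auto simp: mem_pts_iff)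
  consider "s < q" | "q \<le> s" "v s \<le> M" | "q \<le> s" "M < v s" by linarith
  then show ?thesis
  proof cases
    case 1
    then have eq: "w' s = w s" using outside_range by blast
    then have "v s \<le> u K" using before[OF s(1) 1] v by auto
    have "\<exists>xs'. chain xs' \<and> set xs' \<subseteq> pts {s<..<m} v' \<and> length xs \<le> length xs' \<and> (\<forall>x\<in>set xs'. snd x < v s)"
      using v
    proof
      assume "v = w \<and> v' = w'"
      then show ?thesis using transfer[OF s(2) _ 1 order_refl \<open>v s \<le> u K\<close> s(5)] s(3) by simp
    next
      assume "v = w' \<and> v' = w"
      then show ?thesis using transfer'[OF s(2) _ 1 order_refl \<open>v s \<le> u K\<close> s(5)] s(3) by simp
    qed
    then obtain xs' where x: "chain xs'" "set xs' \<subseteq> pts {s<..<m} v'" "length xs \<le> length xs'" "\<forall>x\<in>set xs'. snd x < v s"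
      by blast
    have "v' s = v s" "K \<le> length xs'" using v eq x(3) s(4) by auto
    then show ?thesis unfolding drop_chain_def using s(1) x by (intro exI[of _ s] exI[of _ xs']) simp
  next
    case 2
    have "set xs \<subseteq> pts D v"
    proof
      fix x assume x: "x \<in> set xs"
      then have "q < fst x" "fst x < m" "snd x = v (fst x)" "v (fst x) < M"
        using s(3) s(5)[OF x] 2 by (auto simp: mem_pts_iff)
      then show "x \<in> pts D v" using v D_memI by (auto simp: mem_pts_iff)
    qed
    then have "length xs < K" using v short s(2) shortD by metis
    then show ?thesis using s(4) by simp
  next
    case 3
    have "s \<noteq> q" using 3 v w_ends top u_le[of 1 K] K by auto
    moreover have "s \<notin> D" using D_less[of s] 3(2) v by auto
    ultimately have eq: "w' s = w s" using outside[of s] sm by auto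
    \<comment> \<open>The letters below \<open>M\<close> lie in \<open>D\<close> and are rerouted;
      those from \<open>M\<close> on are untouched by the rotation. The rerouted part must not end
      further right than before, which is what the position version provides.\<close>
    obtain xa xb where x: "xs = xa @ xb" "\<forall>x\<in>set xa. snd x < M" "\<forall>x\<in>set xb. \<not> snd x < M"
      using chain_split[OF s(2), of "\<lambda>x. snd x < M"] by (auto simp: prec_def)
    have xa: "set xa \<subseteq> pts D v"
    proof
      fix y assume y: "y \<in> set xa"
      then have "y \<in> pts {s<..<m} v" "snd y < M" using s(3) x by auto
      then have "q < fst y" "fst y < m" "snd y = v (fst y)" "v (fst y) < M"
        using 3 by (auto simp: mem_pts_iff)
      then show "y \<in> pts D v" using v D_memI by (auto simp: mem_pts_iff)
    qed
    have xb: "set xb \<subseteq> pts {s<..<m} v'"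
    proof
      fix y assume y: "y \<in> set xb"
      then have "y \<in> pts {s<..<m} v" "\<not> snd y < M" using s(3) x by auto
      then have *: "s < fst y" "fst y < m" "snd y = v (fst y)" "M \<le> v (fst y)"
        by (auto simp: mem_pts_iff)
      then have "fst y \<notin> D" using D_less[of "fst y"] v by auto
      then have "w' (fst y) = w (fst y)" using outside[of "fst y"] 3 * by auto
      then show "y \<in> pts {s<..<m} v'" using * v by (auto simp: mem_pts_iff)
    qed
    show ?thesis
    proof (cases "xa = []")
      case True
      have "v' s = v s" using v eq by auto
      then show ?thesis unfolding drop_chain_def using s x xb True by (intro exI[of _ s] exI[of _ xs]) simp
    next
      case False
      have ca: "chain xa" using x s by (simp add: sorted_wrt_append)
      obtain xa' where a: "xa' \<noteq> []" "chain xa'" "set xa' \<subseteq> pts D v'" "length xa \<le> length xa'"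
          "fst (last xa') \<le> fst (last xa)" "fst (hd xa) \<le> fst (hd xa')"
        using v
      proof
        assume "v = w \<and> v' = w'"
        then show ?thesis using position_shift'[OF False ca] xa that by force
      next
        assume "v = w' \<and> v' = w"
        then show ?thesis using position_shift[OF False ca] xa that by force
      qed
      have M': "snd y < M" if "y \<in> set xa'" for y
        using a(3) that v D_less by (fastforce simp: mem_pts_iff)
      have "y \<prec> z" if y: "y \<in> set xa'" and z: "z \<in> set xb" for y z
      proof -
        have "last xa \<prec> z" using s(2) x(1) False z by (auto simp: sorted_wrt_append)
        then show ?thesis using chain_hd_last[OF a(2) y] a(5) M'[OF y] x(3) z by (auto simp: prec_def)
      qed
      then have "chain (xa' @ xb)" using a s x by (auto simp: sorted_wrt_append)
      moreover have "set xa' \<subseteq> pts {s<..<m} v'"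
      proof
        fix y assume y: "y \<in> set xa'"
        have "hd xa \<in> set xs" using False x by simp
        then have "s < fst (hd xa)" using s(3) by (auto simp: mem_pts_iff)
        moreover have "y \<in> pts D v'" using a(3) y by auto
        ultimately show "y \<in> pts {s<..<m} v'"
          using chain_hd_last[OF a(2) y] a(6) D_range[of "fst y"] by (auto simp: mem_pts_iff)
      qed
      moreover have "\<forall>y\<in>set (xa' @ xb). snd y < v' s"
      proof
        fix y assume "y \<in> set (xa' @ xb)"
        moreover have "v' s = v s" using v eq by auto
        ultimately show "snd y < v' s" using M'[of y] 3(2) s(5)[of y] x(1) by auto
      qed
      moreover have "K \<le> length (xa' @ xb)" using s(4) x(1) a(4) by simp
      ultimately show ?thesis unfolding drop_chain_def using s(1) xb
        by (intro exI[of _ s] exI[of _ "xa' @ xb"]) simp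
    qed
  qed
qed

lemma UK: "chain (map U [1..<Suc K])" "set (map U [1..<Suc K]) \<subseteq> pts (insert q D) w"
  "\<And>x. x \<in> set (map U [1..<Suc K]) \<Longrightarrow> snd x \<le> u K"
  using XU K by (auto intro!: chain_map_upt UU u_le simp del: upt_Suc)

lemma CK: "chain (map C [1..<Suc K])" "set (map C [1..<Suc K]) \<subseteq> pts (insert m D) w'"
  "\<And>x. x \<in> set (map C [1..<Suc K]) \<Longrightarrow> snd x \<le> u K"
  using XC K by (auto intro!: chain_map_upt CC u_le simp del: upt_Suc)

lemma rise_chain_m: "rise_chain K w m"
proof -
  have "pts (insert q D) w \<subseteq> pts {0<..<m} w" using D_range pos q_less_m by (fastforce simp: mem_pts_iff)
  then have s: "set (map U [1..<Suc K]) \<subseteq> pts {0<..<m} w" using UK(2) by blast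
  have v: "\<forall>x\<in>set (map U [1..<Suc K]). snd x < M" using UK(3) top by (meson le_less_trans)
  show ?thesis unfolding rise_chain_def
    by (intro exI[of _ "map U [1..<Suc K]"] conjI UK(1) s v) (simp del: upt_Suc)
qed

lemma drop_chain_Suc_m: "drop_chain K w' (m + 1)"
proof -
  have "pts (insert m D) w' \<subseteq> pts {q<..<m + 1} w'" using D_range q_less_m by (fastforce simp: mem_pts_iff)
  then have s: "set (map C [1..<Suc K]) \<subseteq> pts {q<..<m + 1} w'" using CK(2) by blast
  have v: "\<forall>x\<in>set (map C [1..<Suc K]). snd x < w' q" using CK(3) top w_ends(2) by (metis le_less_trans)
  show ?thesis unfolding drop_chain_def
    by (intro exI[of _ q] exI[of _ "map C [1..<Suc K]"] conjI CK(1) s v pos) (simp del: upt_Suc)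
qed

lemma drop_chain_iff: "drop_chain K w m \<longleftrightarrow> drop_chain K w' m"
  using drop_chain_transfer by blast

text \<open>If the letter at \<open>j\<close> exceeds \<open>u K\<close>, both words have the
  pattern there, through \<open>U 1, ..., U K\<close> and \<open>C 1, ..., C K\<close>. Otherwise
  all chain letters are smaller than a bound of at most \<open>u K\<close>, and chains
  transfer.\<close>

lemma rise_chain_iff:
  assumes "m < j"
  shows "rise_chain K w j \<longleftrightarrow> rise_chain K w' j"
proof (cases "u K < w j")
  case True
  have eq: "w' j = w j" using outside_range assms by blast
  have "pts (insert q D) w \<subseteq> pts {0<..<j} w" "pts (insert m D) w' \<subseteq> pts {0<..<j} w'"
    using D_range pos q_less_m assms by (fastforce simp: mem_pts_iff)+
  then have s: "set (map U [1..<Suc K]) \<subseteq> pts {0<..<j} w" "set (map C [1..<Suc K]) \<subseteq> pts {0<..<j} w'"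
    using UK(2) CK(2) by blast+
  have v: "\<forall>x\<in>set (map U [1..<Suc K]). snd x < w j" "\<forall>x\<in>set (map C [1..<Suc K]). snd x < w' j"
    using UK(3) CK(3) True eq by (metis le_less_trans)+
  have "rise_chain K w j" unfolding rise_chain_def
    by (intro exI[of _ "map U [1..<Suc K]"] conjI UK(1) s(1) v(1)) (simp del: upt_Suc)
  moreover have "rise_chain K w' j" unfolding rise_chain_def
    by (intro exI[of _ "map C [1..<Suc K]"] conjI CK(1) s(2) v(2)) (simp del: upt_Suc)
  ultimately show ?thesis by simp
next
  case False
  have eq: "w' j = w j" using outside_range assms by blast
  have 0: "(0::int) < q" "m \<le> j" using pos assms by auto
  show ?thesis
  proof
    assume "rise_chain K w j"
    then obtain xs where x: "chain xs" "set xs \<subseteq> pts {0<..<j} w" "K \<le> length xs" "\<forall>x\<in>set xs. snd x < w j"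
      unfolding rise_chain_def by blast
    have "w j \<le> u K" using False by simp
    from transfer[OF x(1,2) 0 this] x(4) obtain xs' where
      "chain xs'" "set xs' \<subseteq> pts {0<..<j} w'" "length xs \<le> length xs'" "\<forall>x\<in>set xs'. snd x < w j" by blast
    then show "rise_chain K w' j" unfolding rise_chain_def using x(3) eq by (intro exI[of _ xs']) auto
  next
    assume "rise_chain K w' j"
    then obtain xs where x: "chain xs" "set xs \<subseteq> pts {0<..<j} w'" "K \<le> length xs" "\<forall>x\<in>set xs. snd x < w j"
      unfolding rise_chain_def using eq by auto
    have "w j \<le> u K" using False by simp
    from transfer'[OF x(1,2) 0 this] x(4) obtain xs' where
      "chain xs'" "set xs' \<subseteq> pts {0<..<j} w" "length xs \<le> length xs'" "\<forall>x\<in>set xs'. snd x < w j" by blast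
    then show "rise_chain K w j" unfolding rise_chain_def using x(3) by (intro exI[of _ xs']) auto
  qed
qed

end

lemma staircase_cong:
  assumes "staircase K p u D f f'" "\<And>s. s \<in> D \<Longrightarrow> g s = f s" "\<And>s. s \<in> D \<Longrightarrow> g' s = f' s"
  shows "staircase K p u D g g'"
proof -
  interpret staircase K p u D f f' by fact
  have "pts D g = pts D f" "pts D g' = pts D f'" using assms by (auto simp: pts_def)
  then show ?thesis using K p_Suc u_Suc D corner same short assms by unfold_locales auto
qed

text \<open>The construction for the inverse rotation: after a half-turn the prescribed last value
  \<open>b\<close> becomes the first one.\<close>

lemma staircase_exists':
  assumes K: "2 \<le> K" and D: "finite D" "D \<subseteq> {q<..<m}" and sh: "short K (pts D f)"
    and zs: "chain zs" "set zs \<subseteq> pts D f" "length zs = K - 1" "\<And>z. z \<in> set zs \<Longrightarrow> snd z \<le> b"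
  obtains p u g where "staircase K p u D g f" "p 1 = q" "p (Suc K) = m" "u K = b"
proof -
  have "finite (uminus ` D)" "uminus ` D \<subseteq> {- m<..<- q}" using D by auto
  moreover have "short K (pts (uminus ` D) (\<lambda>s. - f (- s)))" unfolding pts_flip by (rule short_flip[OF sh])
  moreover have "chain (rev (map flip zs))" "length (rev (map flip zs)) = K - 1"
    using zs by (auto intro: chain_flip)
  moreover have "set (rev (map flip zs)) \<subseteq> pts (uminus ` D) (\<lambda>s. - f (- s))"
    unfolding pts_flip using zs by auto
  moreover have "- b \<le> snd z" if "z \<in> set (rev (map flip zs))" for z
    using that zs(4) by auto
  ultimately obtain p u f' where s: "staircase K p u (uminus ` D) (\<lambda>s. - f (- s)) f'"
    "p 1 = - m" "p (Suc K) = - q" "u 1 = - b"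
    using staircase_exists[OF K, of "uminus ` D" "- m" "- q" "\<lambda>s. - f (- s)" "rev (map flip zs)" "- b"] by metis
  have "staircase K (\<lambda>i. - p (K + 2 - i)) (\<lambda>i. - u (K + 1 - i)) D (\<lambda>s. - f' (- s)) f"
    using staircase.staircase_flip[OF s(1)] by (simp add: image_image)
  then show ?thesis by (rule that) (use s in auto)
qed

context word_staircase begin

text \<open>Along \<open>q\<close>, the corners and \<open>m\<close>, the word \<open>w\<close>
  reads \<open>u 1, ..., u K, M\<close> and \<open>w'\<close> reads \<open>M, u 1, ..., u K\<close>;
  all other letters agree.\<close>

lemma mset_eq:
  assumes T: "finite T" "insert q (insert m D) \<subseteq> T"
  shows "image_mset w (mset_set T) = image_mset w' (mset_set T)"
proof -
  define P where "P = p ` {2..K}"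
  define R where "R = T - insert q (insert m P)"
  have inj: "inj_on p {2..K}"
  proof (rule inj_onI)
    fix i j assume "i \<in> {2..K}" "j \<in> {2..K}" "p i = p j"
    then show "i = j" using p_less[of i j] p_less[of j i] by (cases i j rule: linorder_cases) auto
  qed
  have PD: "P \<subseteq> D" using corner by (auto simp: P_def)
  then have n: "q \<notin> P" "m \<notin> P" "q \<noteq> m" using D_range q_less_m by auto
  have fin: "finite P" "finite R" using T by (auto simp: P_def R_def)
  have "T = insert q (insert m (P \<union> R))" using T PD by (auto simp: R_def)
  moreover have "q \<notin> insert m (P \<union> R)" "m \<notin> P \<union> R" "P \<inter> R = {}" using n by (auto simp: R_def)
  ultimately have T': "mset_set T = {#q#} + ({#m#} + (mset_set P + mset_set R))"
    using fin by (simp add: mset_set_Union)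
  have R: "image_mset w (mset_set R) = image_mset w' (mset_set R)"
    using fin same outside by (intro image_mset_cong) (force simp: R_def P_def)
  have mP: "mset_set P = image_mset p (mset_set {2..K})"
    unfolding P_def by (rule image_mset_mset_set[OF inj, symmetric])
  have w: "image_mset w (mset_set P) = image_mset u (mset_set {2..K})"
    unfolding mP multiset.map_comp using corner by (intro image_mset_cong) auto
  have "image_mset w' (mset_set P) = image_mset (\<lambda>i. u (i - 1)) (mset_set {2..K})"
    unfolding mP multiset.map_comp using corner by (intro image_mset_cong) auto
  also have "mset_set {2..K} = image_mset Suc (mset_set {1..<K})"
    using K by (simp add: image_mset_mset_set atLeastLessThanSuc_atLeastAtMost numeral_2_eq_2)
  finally have w': "image_mset w' (mset_set P) = image_mset u (mset_set {1..<K})"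
    by (simp add: multiset.map_comp o_def)
  have "insert 1 {2..K} = insert K {1..<K}" using K by auto
  moreover have "mset_set (insert 1 {2..K}) = {#1#} + mset_set {2..K}"
    "mset_set (insert K {1..<K}) = {#K#} + mset_set {1..<K}" by simp_all
  ultimately have "{#u 1#} + image_mset u (mset_set {2..K}) = {#u K#} + image_mset u (mset_set {1..<K})"
    by (metis image_mset_single image_mset_union)
  then show ?thesis unfolding T' by (simp add: R w w' w_ends[unfolded One_nat_def])
qed

end

lemma word_staircase_exists:
  assumes K: "2 \<le> K" and F: "\<not> drop_chain K w m" and J: "rise_chain K w m"
  obtains p u D w' where "word_staircase K p u D w w'" "p (Suc K) = m"
proof -
  define G where "G s \<longleftrightarrow> (\<exists>xs. chain ((s, w s) # xs) \<and> set ((s, w s) # xs) \<subseteq> pts {0<..<m} w \<and>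
    K \<le> Suc (length xs) \<and> (\<forall>x\<in>set ((s, w s) # xs). snd x < w m))" for s
  have start: "G (fst (hd xs))" if "chain xs" "set xs \<subseteq> pts {0<..<m} w" "K \<le> length xs" "\<forall>x\<in>set xs. snd x < w m" for xs
  proof -
    have "xs \<noteq> []" using that(3) K by auto
    then have xs: "xs = hd xs # tl xs" by simp
    moreover have "hd xs \<in> pts {0<..<m} w" using that(2) \<open>xs \<noteq> []\<close> by auto
    moreover from this have "hd xs = (fst (hd xs), w (fst (hd xs)))" by (simp add: mem_pts_iff prod_eq_iff)
    ultimately have "xs = (fst (hd xs), w (fst (hd xs))) # tl xs" by metis
    moreover have "K \<le> Suc (length (tl xs))" using that(3) by simp
    ultimately show ?thesis unfolding G_def using that by (intro exI[of _ "tl xs"]) metis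
  qed
  have "\<exists>s. G s" using J start unfolding rise_chain_def by blast
  moreover have fin: "finite {s. G s}"
    by (rule finite_subset[of _ "{0<..<m}"]) (auto simp: G_def mem_pts_iff)
  \<comment> \<open>Starting as far right as possible makes the stretch between \<open>q\<close> and
    \<open>m\<close> free of chains of \<open>K\<close> letters below \<open>w m\<close>.\<close>
  define q where "q = Max {s. G s}"
  ultimately have Gq: "G q" using Max_in[OF fin] unfolding q_def by auto
  then obtain xs where xs: "chain ((q, w q) # xs)" "set ((q, w q) # xs) \<subseteq> pts {0<..<m} w"
    "K \<le> Suc (length xs)" "\<forall>x\<in>set ((q, w q) # xs). snd x < w m" unfolding G_def by blast
  have q: "0 < q" "q < m" using xs(2) by (auto simp: mem_pts_iff)
  define D where "D = {s. q < s \<and> s < m \<and> w s < w m}"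
  have D: "finite D" "D \<subseteq> {q<..<m}" by (auto simp: D_def intro: finite_subset[of _ "{q<..<m}"])
  have sh: "short K (pts D w)"
    unfolding short_def
  proof (intro allI impI, rule ccontr)
    fix ys assume ys: "chain ys" "set ys \<subseteq> pts D w" "\<not> length ys < K"
    then have "set ys \<subseteq> pts {0<..<m} w" "\<forall>x\<in>set ys. snd x < w m"
      using q by (auto simp: D_def mem_pts_iff)
    then have "G (fst (hd ys))" using start ys by auto
    then have "fst (hd ys) \<le> q" unfolding q_def using fin by simp
    moreover have "hd ys \<in> pts D w" using ys K by (cases ys) auto
    ultimately show False by (auto simp: D_def mem_pts_iff)
  qed
  define zs where "zs = take (K - 1) xs"
  have "chain zs" using xs by (simp add: zs_def sorted_wrt_take)
  moreover have "set zs \<subseteq> pts D w"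
  proof
    fix z assume "z \<in> set zs"
    then have "z \<in> set xs" by (auto simp: zs_def dest: in_set_takeD)
    then have "z \<in> pts {0<..<m} w" "snd z < w m" "(q, w q) \<prec> z" using xs by auto
    then show "z \<in> pts D w" by (auto simp: D_def mem_pts_iff prec_def)
  qed
  moreover have "length zs = K - 1" using xs by (simp add: zs_def)
  moreover have "w q \<le> snd z" if "z \<in> set zs" for z
    using that xs by (auto simp: zs_def prec_def dest: in_set_takeD)
  ultimately obtain p u f' where s: "staircase K p u D w f'" "p 1 = q" "p (Suc K) = m" "u 1 = w q"
    using staircase_exists[OF K D sh] by metis
  define w' where "w' s = (if s = q then w m else if s = m then u K else if s \<in> D then f' s else w s)" for s
  have "staircase K p u D w w'"
    by (rule staircase_cong[OF s(1)]) (use D in \<open>auto simp: w'_def\<close>)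
  then interpret staircase K p u D w w' .
  have uK: "u K < w m"
    using corner[of K] K by (auto simp: D_def)
  have "word_staircase K p u D w w'"
  proof unfold_locales
    \<comment> \<open>A larger letter in front of \<open>q\<close>, followed by
      \<open>U 1, ..., U K\<close>, would be an occurrence of the first pattern before
      \<open>m\<close>.\<close>
    fix t assume t: "1 \<le> t" "t < p 1"
    show "w t \<le> u K"
    proof (rule ccontr)
      assume c: "\<not> w t \<le> u K"
      let ?L = "map U [1..<Suc K]"
      have 1: "chain ?L" by (intro chain_map_upt UU) auto
      have 2: "set ?L \<subseteq> pts {t<..<m} w"
      proof
        fix x assume "x \<in> set ?L"
        then obtain i where i: "1 \<le> i" "i \<le> K" "x = U i" by auto
        show "x \<in> pts {t<..<m} w"
        proof (cases "i = 1")
          case True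
          then show ?thesis using i s q t by (auto simp: mem_pts_iff)
        next
          case False
          then have "U i \<in> pts D w" using i by (intro U_mem) auto
          then show ?thesis using i D t s by (auto simp: mem_pts_iff)
        qed
      qed
      have 3: "\<forall>x\<in>set ?L. snd x < w t"
      proof
        fix x assume "x \<in> set ?L"
        then obtain i where i: "1 \<le> i" "i \<le> K" "x = U i" by auto
        then show "snd x < w t" using u_le[of i K] c by auto
      qed
      have "drop_chain K w m" unfolding drop_chain_def
        by (intro exI[of _ t] exI[of _ ?L] conjI t(1) 1 2 3) (simp del: upt_Suc)
      then show False using F by simp
    qed
  qed (use q s D uK in \<open>auto simp: w'_def D_def\<close>)
  then show ?thesis using that s by blast
qed

lemma word_staircase_exists':
  assumes K: "2 \<le> K" and F: "\<not> drop_chain K w' m" and F': "drop_chain K w' (m + 1)"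
  obtains p u D w where "word_staircase K p u D w w'" "p (Suc K) = m"
proof -
  obtain s xs where s: "1 \<le> s" "chain xs" "set xs \<subseteq> pts {s<..<m + 1} w'" "K \<le> length xs" "\<forall>x\<in>set xs. snd x < w' s"
    using F' unfolding drop_chain_def by blast
  have ne: "xs \<noteq> []" using s K by auto
  \<comment> \<open>Since no occurrence is complete before \<open>m\<close>, the chain must use
    position \<open>m\<close> itself.\<close>
  have lm: "fst (last xs) = m"
  proof (rule ccontr)
    assume "fst (last xs) \<noteq> m"
    moreover have "last xs \<in> pts {s<..<m + 1} w'" using s ne by auto
    ultimately have "fst (last xs) < m" by (auto simp: mem_pts_iff)
    then have "fst x < m" if "x \<in> set xs" for x using chain_hd_last[OF s(2) that] by auto
    then have "set xs \<subseteq> pts {s<..<m} w'" using s(3) by (auto simp: mem_pts_iff)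
    then have "drop_chain K w' m" unfolding drop_chain_def using s by blast
    then show False using F by simp
  qed
  define b where "b = w' m"
  have lb: "last xs = (m, b)"
  proof -
    have "last xs \<in> pts {s<..<m + 1} w'" using s(3) ne by auto
    then show ?thesis using lm by (simp add: mem_pts_iff b_def prod_eq_iff)
  qed
  define S where "S = {t. 1 \<le> t \<and> t < m \<and> b < w' t}"
  have fin: "finite S" by (rule finite_subset[of _ "{1..m}"]) (auto simp: S_def)
  have sS: "s \<in> S"
  proof -
    have "last xs \<in> set xs" using ne by simp
    then have "last xs \<in> pts {s<..<m + 1} w'" "snd (last xs) < w' s" using s by auto
    then show ?thesis using s(1) lb by (auto simp: S_def mem_pts_iff)
  qed
  \<comment> \<open>\<open>b\<close> is going to be \<open>u K\<close>, and \<open>before\<close>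
    requires all letters in front of \<open>q\<close> to be at most \<open>u K\<close>. So
    \<open>q\<close> has to be the first position with a larger letter.\<close>
  define q where "q = Min S"
  have "q \<in> S" unfolding q_def using fin sS Min_in by blast
  then have q: "1 \<le> q" "q < m" "b < w' q" by (auto simp: S_def)
  have qs: "q \<le> s" unfolding q_def using fin sS by simp
  define D where "D = {t. q < t \<and> t < m \<and> w' t < w' q}"
  have D: "finite D" "D \<subseteq> {q<..<m}" by (auto simp: D_def intro: finite_subset[of _ "{q<..<m}"])
  have sh: "short K (pts D w')"
    unfolding short_def
  proof (intro allI impI, rule ccontr)
    fix ys assume ys: "chain ys" "set ys \<subseteq> pts D w'" "\<not> length ys < K"
    then have "set ys \<subseteq> pts {q<..<m} w'" "\<forall>x\<in>set ys. snd x < w' q"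
      by (auto simp: D_def mem_pts_iff)
    then have "drop_chain K w' m" unfolding drop_chain_def using ys q by (intro exI[of _ q] exI[of _ ys]) auto
    then show False using F by simp
  qed
  \<comment> \<open>The point at \<open>m\<close> becomes the end corner \<open>C K\<close> outside
    \<open>D\<close>, so \<open>K - 1\<close> of the remaining chain points are retained.\<close>
  define zs where "zs = take (K - 1) (butlast xs)"
  have cb: "chain (butlast xs @ [(m, b)])" using s(2) lb ne by (metis append_butlast_last_id)
  then have "chain zs" by (simp add: zs_def sorted_wrt_take sorted_wrt_append)
  moreover have zz: "z \<in> pts {s<..<m} w' \<and> snd z \<le> b" if "z \<in> set zs" for z
  proof -
    have "z \<in> set (butlast xs)" using that by (auto simp: zs_def dest: in_set_takeD)
    then have "z \<in> pts {s<..<m + 1} w'" "z \<prec> (m, b)" using s(3) cb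
      by (auto simp: sorted_wrt_append dest: in_set_butlastD)
    then show ?thesis by (auto simp: mem_pts_iff prec_def)
  qed
  moreover have "set zs \<subseteq> pts D w'"
    using zz q qs by (force simp: D_def mem_pts_iff)
  moreover have "length zs = K - 1" using s by (simp add: zs_def)
  ultimately obtain p u g where g: "staircase K p u D g w'" "p 1 = q" "p (Suc K) = m" "u K = b"
    using staircase_exists'[OF K D sh, of zs b] by metis
  define w where "w t = (if t = q then u 1 else if t = m then w' q else if t \<in> D then g t else w' t)" for t
  have "staircase K p u D w w'"
    by (rule staircase_cong[OF g(1)]) (use D in \<open>auto simp: w_def\<close>)
  then interpret staircase K p u D w w' .
  have wD: "w t < w' q" if "t \<in> D" for t
  proof (cases "t \<in> p ` {2..K}")
    case True
    then obtain i where i: "2 \<le> i" "i \<le> K" "t = p i" by auto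
    then have "w t = u i" "u i \<le> u K" using corner[of i] by (auto intro: u_le)
    then show ?thesis using q g by auto
  next
    case False
    then show ?thesis using same[of t] that by (auto simp: D_def)
  qed
  have "word_staircase K p u D w w'"
  proof unfold_locales
    show "D = {s. p 1 < s \<and> s < p (Suc K) \<and> w s < w (p (Suc K))}"
    proof (intro set_eqI iffI)
      fix t assume t: "t \<in> D"
      then show "t \<in> {s. p 1 < s \<and> s < p (Suc K) \<and> w s < w (p (Suc K))}"
        using wD[OF t] D g q by (auto simp: w_def[of m])
    next
      fix t assume "t \<in> {s. p 1 < s \<and> s < p (Suc K) \<and> w s < w (p (Suc K))}"
      then have t: "q < t" "t < m" "w t < w' q" using g q by (auto simp: w_def[of m])
      show "t \<in> D"
      proof (rule ccontr)
        assume "t \<notin> D"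
        then have "w t = w' t" using t by (auto simp: w_def)
        then show False using t \<open>t \<notin> D\<close> by (auto simp: D_def)
      qed
    qed
    fix t assume t: "1 \<le> t" "t < p 1"
    then have "t \<notin> S" using Min_le[OF fin, of t] g(2) q_def by auto
    then have "w' t \<le> b" using t g q by (auto simp: S_def)
    moreover have "w t = w' t" using t g q D by (auto simp: w_def)
    ultimately show "w t \<le> u K" using g by simp
  qed (use q g D in \<open>auto simp: w_def b_def\<close>)
  then show ?thesis using that g by blast
qed

text \<open>If one rotation started further right, its chain \<open>U 1, ..., U K\<close> would lie
  in the set \<open>D\<close> of the other, where chains are shorter than \<open>K\<close>. Equal
  starts give equal sets \<open>D\<close>, and the staircases coincide.\<close>

lemma word_staircase_unique:
  assumes "word_staircase K p u D w w1" "word_staircase K q v E w w2" "p (Suc K) = q (Suc K)"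
  shows "w1 = w2"
proof -
  have le: "q 1 \<le> p 1"
    if "word_staircase K p u D w w1" "word_staircase K q v E w w2" "p (Suc K) = q (Suc K)"
    for p q u v D E w1 w2
  proof (rule ccontr)
    interpret a: word_staircase K p u D w w1 by fact
    interpret b: word_staircase K q v E w w2 by fact
    assume "\<not> q 1 \<le> p 1"
    then have "pts (insert (q 1) E) w \<subseteq> pts D w"
      using a.D_memI b.D_range b.D_less(1) b.q_less_m that(3) b.top b.w_ends b.u_le[of 1 K] b.K
      by (fastforce simp: mem_pts_iff)
    then have "length (map b.U [1..<Suc K]) < K"
      by (intro shortD[OF a.short(1) b.UK(1)] subset_trans[OF b.UK(2)])
    then show False by (simp del: upt_Suc)
  qed
  interpret a: word_staircase K p u D w w1 by fact
  interpret b: word_staircase K q v E w w2 by fact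
  have pq: "p 1 = q 1" using le[OF assms] le[OF assms(2,1)] assms(3) by auto
  then have DE: "D = E" using a.D_eq b.D_eq assms(3) by simp
  have "staircase K p u D w w1" "staircase K q v D w w2" "u 1 = v 1"
    using a.staircase_axioms b.staircase_axioms DE pq a.w_ends(1) b.w_ends(1) by auto
  note un = staircase_unique[OF this]
  show ?thesis
  proof
    fix s
    have "u K = v K" using un(1)[of K] a.K by simp
    then show "w1 s = w2 s"
    proof (cases "s \<in> insert (p 1) (insert (p (Suc K)) D)")
      case True
      then show ?thesis using un(2)[of s] a.w_ends(2,3) b.w_ends(2,3) pq assms(3) \<open>u K = v K\<close> by auto
    next
      case False
      then show ?thesis using a.outside[of s] b.outside[of s] pq DE assms(3) by metis
    qed
  qed
qed

text \<open>If one rotation started further right, the letter \<open>M\<close> at the start of the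
  other would violate its bound \<open>before\<close>. With equal starts, the half-turned staircases
  begin at the same value and coincide.\<close>

lemma word_staircase_unique':
  assumes "word_staircase K p u D w1 w'" "word_staircase K q v E w2 w'" "p (Suc K) = q (Suc K)"
  shows "w1 = w2"
proof -
  have le: "q 1 \<le> p 1"
    if "word_staircase K p u D w1 w'" "word_staircase K q v E w2 w'" "p (Suc K) = q (Suc K)"
    for p q u v D E w1 w2
  proof (rule ccontr)
    interpret a: word_staircase K p u D w1 w' by fact
    interpret b: word_staircase K q v E w2 w' by fact
    assume c: "\<not> q 1 \<le> p 1"
    then have "w2 (p 1) \<le> v K" using a.pos b.before by simp
    moreover have "w' (p 1) = w2 (p 1)" using c by (intro b.outside_range) auto
    moreover have "v K = u K" using a.w_ends b.w_ends that(3) by simp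
    ultimately show False using a.top a.w_ends by simp
  qed
  interpret a: word_staircase K p u D w1 w' by fact
  interpret b: word_staircase K q v E w2 w' by fact
  have pq: "p 1 = q 1" using le[OF assms] le[OF assms(2,1)] assms(3) by auto
  then have M: "w1 (p (Suc K)) = w2 (q (Suc K))" using a.w_ends b.w_ends by metis
  then have DE: "D = E" using a.D_eq' b.D_eq' assms(3) pq by simp
  have uv: "u K = v K" using a.w_ends(3) b.w_ends(3) assms(3) by simp
  note fl = a.staircase_flip b.staircase_flip[folded DE]
  have "- u (K + 1 - 1) = - v (K + 1 - 1)" using uv by simp
  note un = staircase_unique[OF fl this]
  have u1: "u 1 = v 1" using un(1)[of K] a.K by simp
  have fD: "w1 s = w2 s" if "s \<in> D" for s using un(2)[of "- s"] that by simp
  show ?thesis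
  proof
    fix s
    consider "s = p 1" | "s = p (Suc K)" | "s \<in> D" | "s \<notin> insert (p 1) (insert (p (Suc K)) D)" by blast
    then show "w1 s = w2 s"
    proof cases
      case 1
      then show ?thesis using u1 a.w_ends(1) b.w_ends(1) pq by metis
    next
      case 2
      then show ?thesis using M assms(3) by metis
    next
      case 4
      then show ?thesis using a.outside[of s] b.outside[of s] pq DE assms(3) by metis
    qed (rule fD)
  qed
qed

section \<open>Exchanging the two patterns one position at a time\<close>

definition words :: "int \<Rightarrow> (int \<Rightarrow> int) \<Rightarrow> (int \<Rightarrow> int) set" where
  "words n v = {w. (\<forall>s. s \<notin> {1..n} \<longrightarrow> w s = v s) \<and> image_mset w (mset_set {1..n}) = image_mset v (mset_set {1..n})}"

lemma finite_words: "finite (words n v)"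
proof (rule finite_subset)
  show "words n v \<subseteq> {w. (\<forall>s. (s \<in> {1..n} \<longrightarrow> w s \<in> v ` {1..n}) \<and> (s \<notin> {1..n} \<longrightarrow> w s = v s))}"
  proof
    fix w assume w: "w \<in> words n v"
    then have "set_mset (image_mset w (mset_set {1..n})) = set_mset (image_mset v (mset_set {1..n}))"
      by (simp add: words_def)
    then have "w ` {1..n} = v ` {1..n}" by simp
    then show "w \<in> {w. (\<forall>s. (s \<in> {1..n} \<longrightarrow> w s \<in> v ` {1..n}) \<and> (s \<notin> {1..n} \<longrightarrow> w s = v s))}"
      using w by (auto simp: words_def)
  qed
  show "finite {w. (\<forall>s. (s \<in> {1..n} \<longrightarrow> w s \<in> v ` {1..n}) \<and> (s \<notin> {1..n} \<longrightarrow> w s = v s))}"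
  proof -
    have "finite ((\<lambda>g s. if s \<in> {1..n} then g s else v s) ` ({1..n} \<rightarrow>\<^sub>E v ` {1..n}))"
      by (intro finite_imageI finite_PiE) auto
    moreover have "{w. (\<forall>s. (s \<in> {1..n} \<longrightarrow> w s \<in> v ` {1..n}) \<and> (s \<notin> {1..n} \<longrightarrow> w s = v s))} \<subseteq>
      (\<lambda>g s. if s \<in> {1..n} then g s else v s) ` ({1..n} \<rightarrow>\<^sub>E v ` {1..n})"
      by (auto intro!: image_eqI[of _ _ "restrict _ {1..n}"] simp: fun_eq_iff)
    ultimately show ?thesis by (rule finite_subset[rotated])
  qed
qed

text \<open>
  Moving \<open>i = j\<close> from \<open>1\<close> to \<open>n + 1\<close> interpolates between words avoiding the second pattern
  and words avoiding the first.
\<close>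

definition hybrid :: "nat \<Rightarrow> int \<Rightarrow> (int \<Rightarrow> int) \<Rightarrow> int \<Rightarrow> int \<Rightarrow> (int \<Rightarrow> int) set" where
  "hybrid K n v i j = {w \<in> words n v. \<not> drop_chain K w i \<and> (\<forall>t. j \<le> t \<and> t \<le> n \<longrightarrow> \<not> rise_chain K w t)}"

lemma drop_chain_mono: "drop_chain K w i \<Longrightarrow> i \<le> j \<Longrightarrow> drop_chain K w j"
  unfolding drop_chain_def by (force simp: subset_iff mem_pts_iff)

text \<open>Both sets arise from \<open>hybrid K n v m (m + 1)\<close>: one by removing the words
  with a rise chain at \<open>m\<close>, the other by removing those with a drop chain up to
  \<open>m\<close>. The rotation, as the relation \<open>\<rho>\<close>, matches the removed
  words.\<close>

lemma card_hybrid_step: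
  assumes K: "2 \<le> K" and m: "1 \<le> m" "m \<le> n"
  shows "card (hybrid K n v m m) = card (hybrid K n v (m + 1) (m + 1))"
proof -
  define \<Omega> where "\<Omega> = hybrid K n v m (m + 1)"
  have fin: "finite \<Omega>" unfolding \<Omega>_def hybrid_def using finite_words by simp
  have J: "hybrid K n v m m = \<Omega> - {w \<in> \<Omega>. rise_chain K w m}"
  proof -
    have "(\<forall>t. m \<le> t \<and> t \<le> n \<longrightarrow> \<not> rise_chain K w t) \<longleftrightarrow> \<not> rise_chain K w m \<and> (\<forall>t. m + 1 \<le> t \<and> t \<le> n \<longrightarrow> \<not> rise_chain K w t)" for w
    proof (intro iffI conjI allI impI)
      fix t assume *: "\<not> rise_chain K w m \<and> (\<forall>t. m + 1 \<le> t \<and> t \<le> n \<longrightarrow> \<not> rise_chain K w t)" "m \<le> t \<and> t \<le> n"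
      then show "\<not> rise_chain K w t" by (cases "t = m") auto
    qed (use m in auto)
    then show ?thesis unfolding \<Omega>_def hybrid_def by blast
  qed
  have F: "hybrid K n v (m + 1) (m + 1) = \<Omega> - {w \<in> \<Omega>. drop_chain K w (m + 1)}"
    unfolding \<Omega>_def hybrid_def using drop_chain_mono[of K _ m "m + 1"] by auto
  define \<rho> where "\<rho> w w' \<longleftrightarrow> (\<exists>p u D. word_staircase K p u D w w' \<and> p (Suc K) = m)" for w w'
  have \<rho>\<Omega>: "w \<in> \<Omega> \<longleftrightarrow> w' \<in> \<Omega>" "rise_chain K w m" "drop_chain K w' (m + 1)" if r: "\<rho> w w'" for w w'
  proof -
    obtain p u D where pu: "word_staircase K p u D w w'" "p (Suc K) = m" using r unfolding \<rho>_def by blast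
    interpret word_staircase K p u D w w' by fact
    show "rise_chain K w m" "drop_chain K w' (m + 1)" using rise_chain_m drop_chain_Suc_m pu by auto
    have "insert q (insert m D) \<subseteq> {1..n}" using pu(2) m pos q_less_m D_range by fastforce
    then have "image_mset w (mset_set {1..n}) = image_mset w' (mset_set {1..n})" "\<And>s. s \<notin> {1..n} \<Longrightarrow> w' s = w s"
      using mset_eq[of "{1..n}"] pu(2) outside_range pos m by auto
    then have "w \<in> words n v \<longleftrightarrow> w' \<in> words n v" by (auto simp: words_def)
    then show "w \<in> \<Omega> \<longleftrightarrow> w' \<in> \<Omega>" unfolding \<Omega>_def hybrid_def using drop_chain_iff rise_chain_iff pu(2) by auto
  qed
  have ex: "\<exists>w'. \<rho> w w'" if "w \<in> \<Omega>" "rise_chain K w m" for w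
  proof -
    have "\<not> drop_chain K w m" using that(1) by (simp add: \<Omega>_def hybrid_def)
    from word_staircase_exists[OF K this that(2)] show ?thesis unfolding \<rho>_def by metis
  qed
  have ex': "\<exists>w. \<rho> w w'" if "w' \<in> \<Omega>" "drop_chain K w' (m + 1)" for w'
  proof -
    have "\<not> drop_chain K w' m" using that(1) by (simp add: \<Omega>_def hybrid_def)
    from word_staircase_exists'[OF K this that(2)] show ?thesis unfolding \<rho>_def by metis
  qed
  have un: "\<rho> w w1 \<Longrightarrow> \<rho> w w2 \<Longrightarrow> w1 = w2" for w w1 w2
    unfolding \<rho>_def using word_staircase_unique by metis
  have un': "\<rho> w1 w' \<Longrightarrow> \<rho> w2 w' \<Longrightarrow> w1 = w2" for w' w1 w2
    unfolding \<rho>_def using word_staircase_unique' by metis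
  have "bij_betw (\<lambda>w. SOME w'. \<rho> w w') {w \<in> \<Omega>. rise_chain K w m} {w \<in> \<Omega>. drop_chain K w (m + 1)}"
  proof -
    have some: "\<rho> w (SOME w'. \<rho> w w')" if "w \<in> \<Omega>" "rise_chain K w m" for w
      using ex[OF that] by (rule someI_ex)
    show ?thesis
      unfolding bij_betw_def
    proof
      show "inj_on (\<lambda>w. SOME w'. \<rho> w w') {w \<in> \<Omega>. rise_chain K w m}"
        using some un' by (intro inj_onI) (metis (mono_tags, lifting) mem_Collect_eq)
      show "(\<lambda>w. SOME w'. \<rho> w w') ` {w \<in> \<Omega>. rise_chain K w m} = {w \<in> \<Omega>. drop_chain K w (m + 1)}"
      proof (intro equalityI subsetI)
        fix y assume "y \<in> (\<lambda>w. SOME w'. \<rho> w w') ` {w \<in> \<Omega>. rise_chain K w m}"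
        then show "y \<in> {w \<in> \<Omega>. drop_chain K w (m + 1)}" using some \<rho>\<Omega> by fast
      next
        fix y assume "y \<in> {w \<in> \<Omega>. drop_chain K w (m + 1)}"
        then obtain w where w: "\<rho> w y" "y \<in> \<Omega>" using ex' by blast
        then have "w \<in> \<Omega>" "rise_chain K w m" using \<rho>\<Omega> by blast+
        moreover have "y = (SOME w'. \<rho> w w')" using un[OF w(1) some] calculation by blast
        ultimately show "y \<in> (\<lambda>w. SOME w'. \<rho> w w') ` {w \<in> \<Omega>. rise_chain K w m}" by blast
      qed
    qed
  qed
  then have "card {w \<in> \<Omega>. rise_chain K w m} = card {w \<in> \<Omega>. drop_chain K w (m + 1)}" by (rule bij_betw_same_card)
  then show ?thesis unfolding J F using fin by (simp add: card_Diff_subset)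
qed

text \<open>At the start of the interpolation there is no room for a drop chain, at its end no
  position is left for a rise chain.\<close>

lemma card_words:
  assumes K: "2 \<le> K" and n: "0 \<le> n"
  shows "card {w \<in> words n v. \<not> drop_chain K w (n + 1)} = card {w \<in> words n v. \<forall>t. 1 \<le> t \<and> t \<le> n \<longrightarrow> \<not> rise_chain K w t}"
proof -
  have step: "card (hybrid K n v 1 1) = card (hybrid K n v (1 + int i) (1 + int i))" if "int i \<le> n" for i
    using that
  proof (induction i)
    case (Suc i)
    then show ?case using card_hybrid_step[OF K, of "1 + int i" n v] by (simp add: add.commute)
  qed simp
  have "\<not> drop_chain K w 1" for w
  proof
    assume "drop_chain K w 1"
    then obtain s xs where "1 \<le> s" "set xs \<subseteq> pts {s<..<1} w" "K \<le> length xs" unfolding drop_chain_def by blast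
    then show False using K by (cases xs) (auto simp: mem_pts_iff)
  qed
  then have "hybrid K n v 1 1 = {w \<in> words n v. \<forall>t. 1 \<le> t \<and> t \<le> n \<longrightarrow> \<not> rise_chain K w t}"
    by (simp add: hybrid_def)
  moreover have "hybrid K n v (1 + n) (1 + n) = {w \<in> words n v. \<not> drop_chain K w (n + 1)}"
    by (auto simp: hybrid_def add.commute)
  ultimately show ?thesis using step[of "nat n"] n by simp
qed

section \<open>Ranks with respect to an injective key\<close>

text \<open>Counting with \<open>\<le>\<close> makes the ranks start at 1, so that they can serve as
  positions of a permutation.\<close>

definition rank_on :: "'a set \<Rightarrow> ('a \<Rightarrow> 'b::linorder) \<Rightarrow> 'a \<Rightarrow> nat" where
  "rank_on A key x = card {y \<in> A. key y \<le> key x}"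

lemma rank_on_less:
  assumes "finite A" "inj_on key A" "x \<in> A" "y \<in> A"
  shows "rank_on A key x < rank_on A key y \<longleftrightarrow> key x < key y"
proof -
  have lt: "rank_on A key x < rank_on A key y" if "x \<in> A" "y \<in> A" "key x < key y" for x y
    unfolding rank_on_def
  proof (rule psubset_card_mono)
    have "y \<notin> {z \<in> A. key z \<le> key x}" "y \<in> {z \<in> A. key z \<le> key y}" using that by auto
    then show "{z \<in> A. key z \<le> key x} \<subset> {z \<in> A. key z \<le> key y}" using that by force
  qed (use assms in simp)
  have "x = y \<or> key x < key y \<or> key y < key x" using assms by (metis inj_onD linorder_cases)
  then show ?thesis using lt[of x y] lt[of y x] assms by auto
qed

lemma bij_rank_on:
  assumes "finite A" "inj_on key A"
  shows "bij_betw (rank_on A key) A {1..card A}"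
proof -
  have inj: "inj_on (rank_on A key) A"
    using rank_on_less[OF assms] assms(2) by (intro inj_onI) (metis inj_onD less_irrefl linorder_cases)
  have "rank_on A key x \<in> {1..card A}" if "x \<in> A" for x
  proof -
    have "{y \<in> A. key y \<le> key x} \<noteq> {}" "finite {y \<in> A. key y \<le> key x}" using that assms by auto
    then have "0 < card {y \<in> A. key y \<le> key x}" by (simp add: card_gt_0_iff)
    moreover have "card {y \<in> A. key y \<le> key x} \<le> card A" using assms by (intro card_mono) auto
    ultimately show ?thesis unfolding rank_on_def by simp
  qed
  then have "rank_on A key ` A \<subseteq> {1..card A}" by auto
  moreover have "card (rank_on A key ` A) = card {1..card A}" using card_image[OF inj] by simp
  ultimately have "rank_on A key ` A = {1..card A}" by (intro card_subset_eq) auto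
  then show ?thesis using inj by (simp add: bij_betw_def)
qed

subsection \<open>Permutations as words\<close>

text \<open>
  Cutting the positions after each element of \<open>S\<close> gives blocks; the word of \<open>\<pi>\<close> has at position \<open>s\<close>
  the number of the block that contains the value \<open>s\<close>.
\<close>

definition block :: "nat set \<Rightarrow> nat \<Rightarrow> nat" where
  "block S i = card {s \<in> S. s < i}"

definition word :: "nat set \<Rightarrow> (nat \<Rightarrow> nat) \<Rightarrow> int \<Rightarrow> int" where
  "word S \<pi> s = int (block S (inv \<pi> (nat s)))"

definition perms :: "nat \<Rightarrow> nat set \<Rightarrow> (nat \<Rightarrow> nat) set" where
  "perms n S = {\<pi>. \<pi> permutes {1..n} \<and> descent_set n \<pi> \<subseteq> S}"

locale descents_in =
  fixes n :: nat and S :: "nat set"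
  assumes S: "S \<subseteq> {1..<n}"
begin

lemma finite_S: "finite S"
  using S finite_subset by blast

lemma block_mono: "i \<le> j \<Longrightarrow> block S i \<le> block S j"
  unfolding block_def using finite_S by (intro card_mono) auto

lemma block_less: "block S i < block S j \<longleftrightarrow> (\<exists>s\<in>S. i \<le> s \<and> s < j)"
proof
  assume "block S i < block S j"
  then have "\<not> {s \<in> S. s < j} \<subseteq> {s \<in> S. s < i}"
    unfolding block_def using finite_S card_mono[of "{s \<in> S. s < i}" "{s \<in> S. s < j}"] by auto
  then show "\<exists>s\<in>S. i \<le> s \<and> s < j" by force
next
  assume "\<exists>s\<in>S. i \<le> s \<and> s < j"
  then obtain s where "s \<in> S" "i \<le> s" "s < j" by blast
  then have "s \<in> {s \<in> S. s < j}" "s \<notin> {s \<in> S. s < i}" "{s \<in> S. s < i} \<subseteq> {s \<in> S. s < j}" by auto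
  then have "{s \<in> S. s < i} \<subset> {s \<in> S. s < j}" by blast
  then show "block S i < block S j" unfolding block_def using finite_S by (intro psubset_card_mono) auto
qed

lemma ascending:
  assumes "\<And>t. i \<le> t \<Longrightarrow> t < j \<Longrightarrow> \<pi> t < \<pi> (Suc t)" "i < j"
  shows "\<pi> i < (\<pi> j :: nat)"
  using assms(2,1)
proof (induction j)
  case (Suc j)
  show ?case
  proof (cases "i = j")
    case False
    then have "\<pi> i < \<pi> j" using Suc by auto
    also have "\<pi> j < \<pi> (Suc j)" using Suc by auto
    finally show ?thesis .
  qed (use Suc in auto)
qed simp

lemma no_descent:
  assumes "\<pi> \<in> perms n S" "1 \<le> t" "t < n" "t \<notin> descent_set n \<pi>"
  shows "\<pi> t < \<pi> (Suc t)"
proof -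
  have "\<pi> t \<noteq> \<pi> (Suc t)" using assms(1) permutes_inj[of \<pi> "{1..n}"] injD[of \<pi> t "Suc t"] by (auto simp: perms_def)
  then show ?thesis using assms by (auto simp: descent_set_def)
qed

lemma same_block_less:
  assumes "\<pi> \<in> perms n S" "1 \<le> i" "i < j" "j \<le> n" "block S i = block S j"
  shows "\<pi> i < \<pi> j"
proof (rule ascending[OF _ assms(3)])
  fix t assume t: "i \<le> t" "t < j"
  then have "t \<notin> S" using assms(5) block_less[of i j] by auto
  then show "\<pi> t < \<pi> (Suc t)" using assms t by (intro no_descent) (auto simp: perms_def)
qed

lemma inv_mem: "\<pi> \<in> perms n S \<Longrightarrow> inv \<pi> x \<in> {1..n} \<longleftrightarrow> x \<in> {1..n}"
  using permutes_in_image[OF permutes_inv, of \<pi> "{1..n}" x] by (simp add: perms_def)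

lemma inv_inv: "\<pi> \<in> perms n S \<Longrightarrow> \<pi> (inv \<pi> x) = x" "\<pi> \<in> perms n S \<Longrightarrow> inv \<pi> (\<pi> x) = x"
  using permutes_inverses[of \<pi> "{1..n}" x] by (auto simp: perms_def)

text \<open>Blocks follow each other from left to right and entries increase inside a block, so
  positions are ordered lexicographically by block and value.\<close>

lemma inv_less:
  assumes \<pi>: "\<pi> \<in> perms n S" and "x \<in> {1..n}" "y \<in> {1..n}"
  shows "inv \<pi> x < inv \<pi> y \<longleftrightarrow> (block S (inv \<pi> x), x) < (block S (inv \<pi> y), y)"
proof -
  have lt: "(block S (inv \<pi> x), x) < (block S (inv \<pi> y), y)"
    if "inv \<pi> x < inv \<pi> y" "x \<in> {1..n}" "y \<in> {1..n}" for x y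
  proof -
    have "block S (inv \<pi> x) \<le> block S (inv \<pi> y)" using that by (intro block_mono) simp
    moreover have "x < y" if "block S (inv \<pi> x) = block S (inv \<pi> y)"
      using same_block_less[OF \<pi> _ _ _ that] inv_mem[OF \<pi>] \<open>inv \<pi> x < inv \<pi> y\<close> \<open>x \<in> {1..n}\<close> \<open>y \<in> {1..n}\<close>
      by (auto simp: inv_inv[OF \<pi>])
    ultimately show ?thesis
      by (cases "block S (inv \<pi> x) = block S (inv \<pi> y)") (auto simp: less_prod_def)
  qed
  have "inv \<pi> x = inv \<pi> y \<Longrightarrow> x = y" using inv_inv(1)[OF \<pi>] by metis
  then show ?thesis using lt[of x y] lt[of y x] assms(2,3) by (metis less_asym linorder_cases less_irrefl)
qed

text \<open>The right-hand side depends on \<open>\<pi>\<close> only through its word; this is what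
  makes \<open>word S\<close> injective.\<close>

lemma inv_eq_rank:
  assumes \<pi>: "\<pi> \<in> perms n S" and x: "x \<in> {1..n}"
  shows "inv \<pi> x = rank_on {1..n} (\<lambda>x. (block S (inv \<pi> x), x)) x"
proof -
  have "{y \<in> {1..n}. (block S (inv \<pi> y), y) \<le> (block S (inv \<pi> x), x)} = {y \<in> {1..n}. inv \<pi> y \<le> inv \<pi> x}"
    using inv_less[OF \<pi> x] by (auto simp: not_less[symmetric])
  also have "\<dots> = \<pi> ` {1..inv \<pi> x}"
  proof -
    have "y \<in> \<pi> ` {1..inv \<pi> x}" if "y \<in> {1..n}" "inv \<pi> y \<le> inv \<pi> x" for y
      using that inv_mem[OF \<pi>, of y] inv_inv(1)[OF \<pi>, of y] by (intro image_eqI[of _ _ "inv \<pi> y"]) auto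
    moreover have "\<pi> i \<in> {1..n} \<and> inv \<pi> (\<pi> i) \<le> inv \<pi> x" if "i \<in> {1..inv \<pi> x}" for i
      using that inv_mem[OF \<pi>, of "\<pi> i"] inv_mem[OF \<pi>, of x] inv_inv(2)[OF \<pi>, of i] x by auto
    ultimately show ?thesis by auto
  qed
  also have "card \<dots> = inv \<pi> x"
    using \<pi> by (subst card_image) (auto simp: perms_def intro: inj_on_subset[OF permutes_inj])
  finally show ?thesis unfolding rank_on_def by simp
qed

abbreviation "base \<equiv> (\<lambda>s::int. int (block S (nat s)))"

lemma mset_int: "mset_set {1..int n} = image_mset int (mset_set {1..n})"
proof -
  have "{1..int n} = int ` {1..n}" by (auto simp: image_int_atLeastAtMost)
  then show ?thesis by (simp add: image_mset_mset_set)
qed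

lemma word_mem:
  assumes \<pi>: "\<pi> \<in> perms n S"
  shows "word S \<pi> \<in> words (int n) base"
proof -
  have "image_mset (inv \<pi>) (mset_set {1..n}) = mset_set {1..n}"
    using \<pi> permutes_inv[of \<pi> "{1..n}"] by (auto simp: perms_def image_mset_mset_set permutes_inj_on permutes_image)
  then have "image_mset (\<lambda>i. int (block S i)) (image_mset (inv \<pi>) (mset_set {1..n})) =
      image_mset (\<lambda>i. int (block S i)) (mset_set {1..n})" by simp
  then have "image_mset (word S \<pi>) (mset_set {1..int n}) = image_mset base (mset_set {1..int n})"
    unfolding mset_int multiset.map_comp by (simp add: o_def word_def)
  moreover have "word S \<pi> s = base s" if "s \<notin> {1..int n}" for s
  proof -
    have "nat s \<notin> {1..n}" using that by auto
    then have "inv \<pi> (nat s) = nat s" using \<pi> permutes_inv[of \<pi> "{1..n}"] by (auto simp: perms_def permutes_not_in)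
    then show ?thesis by (simp add: word_def)
  qed
  ultimately show ?thesis by (simp add: words_def)
qed

lemma word_inj: "inj_on (word S) (perms n S)"
proof (rule inj_onI)
  fix \<pi> \<sigma> assume \<pi>: "\<pi> \<in> perms n S" and \<sigma>: "\<sigma> \<in> perms n S" and eq: "word S \<pi> = word S \<sigma>"
  have b: "block S (inv \<pi> x) = block S (inv \<sigma> x)" for x
    using fun_cong[OF eq, of "int x"] by (simp add: word_def)
  have "inv \<pi> x = inv \<sigma> x" for x
  proof (cases "x \<in> {1..n}")
    case True
    then show ?thesis using inv_eq_rank[OF \<pi> True] inv_eq_rank[OF \<sigma> True] b by simp
  next
    case False
    then show ?thesis using \<pi> \<sigma> permutes_inv by (metis (no_types, lifting) mem_Collect_eq perms_def permutes_not_in)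
  qed
  then have "inv \<pi> = inv \<sigma>" by blast
  then show "\<pi> = \<sigma>" using \<pi> \<sigma> by (metis (no_types, lifting) mem_Collect_eq perms_def permutes_inv_inv)
qed

lemma word_surj:
  assumes w: "w \<in> words (int n) base"
  shows "\<exists>\<pi>\<in>perms n S. word S \<pi> = w"
proof -
  have "image_mset (\<lambda>x. w (int x)) (mset_set {1..n}) = image_mset (\<lambda>x. int (block S x)) (mset_set {1..n})"
    using w unfolding words_def mset_int multiset.map_comp by (simp add: o_def)
  \<comment> \<open>\<open>\<rho>\<close> sends each value to some position in the block named by
    its letter, but need not sort the values inside a block. Ranking by block and value repairs
    this.\<close>
  then obtain \<rho> where \<rho>: "\<rho> permutes {1..n}" "\<forall>x\<in>{1..n}. w (int x) = int (block S (\<rho> x))"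
    using image_mset_eq_implies_permutes[of "{1..n}" "\<lambda>x. w (int x)" "\<lambda>x. int (block S x)"] by auto
  define b where "b x = block S (\<rho> x)" for x
  define key where "key x = (b x, x)" for x
  have inj: "inj_on key {1..n}" by (auto simp: inj_on_def key_def)
  define r where "r x = (if x \<in> {1..n} then rank_on {1..n} key x else x)" for x
  have bij: "bij_betw r {1..n} {1..n}"
    using bij_rank_on[OF _ inj] by (subst bij_betw_cong[of _ r "rank_on {1..n} key"]) (auto simp: r_def)
  have r: "r permutes {1..n}" by (rule bij_imp_permutes[OF bij]) (auto simp: r_def)
  have less: "r x < r y \<longleftrightarrow> key x < key y" if "x \<in> {1..n}" "y \<in> {1..n}" for x y
    using rank_on_less[OF _ inj] that by (simp add: r_def)
  have seg: "card {y \<in> {1..n}. b y < t} = card {i \<in> {1..n}. block S i < t}" for t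
  proof -
    have "{i \<in> {1..n}. block S i < t} = \<rho> ` {y \<in> {1..n}. b y < t}"
    proof (intro set_eqI iffI)
      fix i assume "i \<in> {i \<in> {1..n}. block S i < t}"
      then show "i \<in> \<rho> ` {y \<in> {1..n}. b y < t}"
        using permutes_inverses(1)[OF \<rho>(1), of i] permutes_in_image[OF permutes_inv[OF \<rho>(1)], of i]
        by (intro image_eqI[of _ _ "inv \<rho> i"]) (auto simp: b_def)
    next
      fix i assume "i \<in> \<rho> ` {y \<in> {1..n}. b y < t}"
      then show "i \<in> {i \<in> {1..n}. block S i < t}"
        using permutes_in_image[OF \<rho>(1)] by (auto simp: b_def)
    qed
    then show ?thesis using card_image[of \<rho> "{y \<in> {1..n}. b y < t}"] permutes_inj_on[OF \<rho>(1)] by auto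
  qed
  \<comment> \<open>The positions in blocks before \<open>t\<close> form an initial segment of
    \<open>{1..n}\<close>, so the size of this segment decides on which side a position
    lies.\<close>
  have init: "block S i < t \<longleftrightarrow> i \<le> card {y \<in> {1..n}. b y < t}" if i: "i \<in> {1..n}" for i t
  proof
    assume "block S i < t"
    then have "{1..i} \<subseteq> {i \<in> {1..n}. block S i < t}" using i by (auto intro: le_less_trans[OF block_mono])
    then have "card {1..i} \<le> card {i \<in> {1..n}. block S i < t}" by (intro card_mono) auto
    then show "i \<le> card {y \<in> {1..n}. b y < t}" unfolding seg by simp
  next
    assume le: "i \<le> card {y \<in> {1..n}. b y < t}"
    show "block S i < t"
    proof (rule ccontr)
      assume "\<not> block S i < t"
      then have "l < i" if "block S l < t" for l using block_mono[of i l] that by (cases "l < i") auto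
      then have "{i \<in> {1..n}. block S i < t} \<subseteq> {1..<i}" by auto
      then have "card {i \<in> {1..n}. block S i < t} \<le> card {1..<i}" by (intro card_mono) auto
      then show False using le i unfolding seg by auto
    qed
  qed
  have br: "block S (r x) = b x" if x: "x \<in> {1..n}" for x
  proof -
    have rx: "r x \<in> {1..n}" using permutes_in_image[OF r] x by blast
    have rr: "r x = card {y \<in> {1..n}. key y \<le> key x}" using x by (simp add: r_def rank_on_def)
    have "{y \<in> {1..n}. b y < b x} \<subset> {y \<in> {1..n}. key y \<le> key x}" using x by (auto simp: key_def less_eq_prod_def)
    then have "card {y \<in> {1..n}. b y < b x} < r x" unfolding rr by (intro psubset_card_mono) auto
    then have "\<not> block S (r x) < b x" using init[OF rx] by simp
    moreover have "r x \<le> card {y \<in> {1..n}. b y < Suc (b x)}"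
      unfolding rr by (intro card_mono) (auto simp: key_def less_eq_prod_def)
    then have "block S (r x) < Suc (b x)" using init[OF rx] by simp
    ultimately show ?thesis by simp
  qed
  let ?\<pi> = "inv r"
  have \<pi>p: "?\<pi> permutes {1..n}" by (rule permutes_inv[OF r])
  have ii: "inv ?\<pi> = r" by (rule permutes_inv_inv[OF r])
  have "descent_set n ?\<pi> \<subseteq> S"
  proof
    fix i assume "i \<in> descent_set n ?\<pi>"
    then have i: "1 \<le> i" "i < n" "?\<pi> (Suc i) < ?\<pi> i" by (auto simp: descent_set_def)
    have m: "?\<pi> i \<in> {1..n}" "?\<pi> (Suc i) \<in> {1..n}" using permutes_in_image[OF \<pi>p, of i] permutes_in_image[OF \<pi>p, of "Suc i"] i by auto
    have rr: "r (?\<pi> i) = i" "r (?\<pi> (Suc i)) = Suc i" using permutes_inverses[OF r] by auto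
    have "key (?\<pi> i) < key (?\<pi> (Suc i))" using less[OF m] rr by simp
    then have "b (?\<pi> i) < b (?\<pi> (Suc i))" using i by (auto simp: key_def less_prod_def)
    then have "block S i < block S (Suc i)" using br m rr by metis
    then show "i \<in> S" unfolding block_less by (auto simp: le_less_Suc_eq)
  qed
  then have "?\<pi> \<in> perms n S" using \<pi>p by (simp add: perms_def)
  moreover have "word S ?\<pi> = w"
  proof
    fix s
    show "word S ?\<pi> s = w s"
    proof (cases "s \<in> {1..int n}")
      case True
      then have "nat s \<in> {1..n}" "int (nat s) = s" by auto
      moreover from this have "w (int (nat s)) = int (block S (\<rho> (nat s)))" using \<rho>(2) by blast
      ultimately show ?thesis using br[of "nat s"] by (simp add: word_def ii b_def del: int_nat_eq)
    next
      case False
      then have "nat s \<notin> {1..n}" by auto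
      then show ?thesis using w False by (auto simp: word_def ii r_def words_def)
    qed
  qed
  ultimately show ?thesis by blast
qed

lemma bij_word: "bij_betw (word S) (perms n S) (words (int n) base)"
  unfolding bij_betw_def using word_inj word_mem word_surj by auto

end

subsection \<open>Pattern occurrences and high positions\<close>

text \<open>The number counts the steps of the increasing subsequence, not its entries; hence
  \<open>K - 1\<close> in the definition of \<open>highs\<close>. The condition
  \<open>1 \<le> i\<close> excludes the fixed point 0.\<close>

primrec ends_chain :: "(nat \<Rightarrow> nat) \<Rightarrow> nat \<Rightarrow> nat \<Rightarrow> bool" where
  "ends_chain \<pi> 0 j = True"
| "ends_chain \<pi> (Suc r) j = (\<exists>i. 1 \<le> i \<and> i < j \<and> \<pi> i < \<pi> j \<and> ends_chain \<pi> r i)"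

lemma ends_chain_seq:
  assumes "ends_chain \<pi> r j" "1 \<le> j"
  shows "\<exists>s. s (Suc r) = j \<and> (\<forall>a b. 1 \<le> a \<longrightarrow> a < b \<longrightarrow> b \<le> Suc r \<longrightarrow> s a < s b \<and> \<pi> (s a) < \<pi> (s b)) \<and>
    (\<forall>a. 1 \<le> a \<longrightarrow> a \<le> Suc r \<longrightarrow> 1 \<le> s a)"
  using assms
proof (induction r arbitrary: j)
  case 0
  then show ?case by (intro exI[of _ "\<lambda>_. j"]) auto
next
  case (Suc r)
  then obtain i where i: "1 \<le> i" "i < j" "\<pi> i < \<pi> j" "ends_chain \<pi> r i" by auto
  with Suc.IH obtain s where s: "s (Suc r) = i"
    "\<And>a b. 1 \<le> a \<Longrightarrow> a < b \<Longrightarrow> b \<le> Suc r \<Longrightarrow> s a < s b \<and> \<pi> (s a) < \<pi> (s b)"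
    "\<And>a. 1 \<le> a \<Longrightarrow> a \<le> Suc r \<Longrightarrow> 1 \<le> s a" by metis
  have "s a < j \<and> \<pi> (s a) < \<pi> j" if "1 \<le> a" "a \<le> Suc r" for a
    using s(1) s(2)[of a "Suc r"] that i by (cases "a = Suc r") auto
  note le = this
  let ?s = "s(Suc (Suc r) := j)"
  have "?s a < ?s b \<and> \<pi> (?s a) < \<pi> (?s b)" if "1 \<le> a" "a < b" "b \<le> Suc (Suc r)" for a b
    using le[of a] s(2)[of a b] that by (cases "b = Suc (Suc r)") auto
  moreover have "1 \<le> ?s a" if "1 \<le> a" "a \<le> Suc (Suc r)" for a
    using s(3)[of a] Suc.prems that by (cases "a = Suc (Suc r)") auto
  ultimately show ?case by (intro exI[of _ ?s]) simp
qed

lemma seq_ends_chain: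
  assumes "\<And>a. 1 \<le> a \<Longrightarrow> a \<le> r \<Longrightarrow> s a < s (Suc a) \<and> \<pi> (s a) < \<pi> (s (Suc a)) \<and> 1 \<le> s a"
  shows "ends_chain \<pi> r (s (Suc r))"
  using assms
proof (induction r)
  case (Suc r)
  then have "ends_chain \<pi> r (s (Suc r))" by simp
  then show ?case using Suc.prems[of "Suc r"] by auto
qed simp

definition highs :: "nat \<Rightarrow> nat \<Rightarrow> (nat \<Rightarrow> nat) \<Rightarrow> nat set" where
  "highs n K \<pi> = {j \<in> {1..n}. ends_chain \<pi> (K - 1) j}"

lemma occurrenceI:
  assumes "\<And>a b. 1 \<le> a \<Longrightarrow> a < b \<Longrightarrow> b \<le> k \<Longrightarrow> s a < s b" "\<And>a. 1 \<le> a \<Longrightarrow> a \<le> k \<Longrightarrow> s a \<in> {1..n}"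
    "\<And>a b. a \<in> {1..k} \<Longrightarrow> b \<in> {1..k} \<Longrightarrow> \<tau> a < \<tau> b \<Longrightarrow> \<pi> (s a) < \<pi> (s b)"
    "inj_on \<tau> {1..k}"
  shows "occurrence n k \<tau> \<pi> s"
  unfolding occurrence_def
proof (intro conjI ballI)
  show "strict_mono_on {1..k} s" using assms(1) by (intro strict_mono_onI) auto
  show "s ` {1..k} \<subseteq> {1..n}" using assms(2) by auto
  fix a b assume ab: "a \<in> {1..k}" "b \<in> {1..k}"
  consider "\<tau> a < \<tau> b" | "\<tau> b < \<tau> a" | "a = b" using inj_onD[OF assms(4) _ ab] by (meson linorder_cases)
  then show "\<pi> (s a) < \<pi> (s b) \<longleftrightarrow> \<tau> a < \<tau> b"
    using assms(3)[OF ab] assms(3)[OF ab(2,1)] by cases auto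
qed

lemma occurrence_less:
  assumes "occurrence n k \<tau> \<pi> s" "1 \<le> a" "a < b" "b \<le> k"
  shows "s a < s b" "1 \<le> s a" "s b \<le> n"
  using assms by (auto simp: occurrence_def strict_mono_on_def image_subset_iff)

lemma occurrence_iff:
  assumes "occurrence n k \<tau> \<pi> s" "1 \<le> a" "a \<le> k" "1 \<le> b" "b \<le> k"
  shows "\<pi> (s a) < \<pi> (s b) \<longleftrightarrow> \<tau> a < \<tau> b"
  using assms by (auto simp: occurrence_def)

text \<open>The descent condition involves only the last two entries of an occurrence. The entries
  before them merely witness that position \<open>i\<close> is high.\<close>

lemma contains_H_iff:
  assumes K: "2 \<le> K"
  shows "contains_H n (Suc K) \<pi> \<longleftrightarrow>
    (\<exists>i\<in>highs n K \<pi>. \<exists>j\<le>n. \<pi> i < \<pi> j \<and> (\<exists>d\<in>descent_set n \<pi>. i \<le> d \<and> d < j))"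
proof
  assume "contains_H n (Suc K) \<pi>"
  then obtain s d where s: "occurrence n (Suc K) (pattern_J (Suc K)) \<pi> s"
    and d: "d \<in> descent_set n \<pi>" "s K \<le> d" "d < s (Suc K)" unfolding contains_H_def by auto
  have "ends_chain \<pi> (K - 1) (s (Suc (K - 1)))"
  proof (rule seq_ends_chain)
    fix a assume "1 \<le> a" "a \<le> K - 1"
    then show "s a < s (Suc a) \<and> \<pi> (s a) < \<pi> (s (Suc a)) \<and> 1 \<le> s a"
      using occurrence_less[OF s, of a "Suc a"] occurrence_iff[OF s, of a "Suc a"] by (auto simp: pattern_J_def)
  qed
  then have "s K \<in> highs n K \<pi>" using occurrence_less[OF s, of 1 K] occurrence_less[OF s, of K "Suc K"] K
    by (auto simp: highs_def)
  moreover have "\<pi> (s K) < \<pi> (s (Suc K))" "s (Suc K) \<le> n"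
    using occurrence_iff[OF s, of K "Suc K"] occurrence_less[OF s, of K "Suc K"] K by (auto simp: pattern_J_def)
  ultimately show "\<exists>i\<in>highs n K \<pi>. \<exists>j\<le>n. \<pi> i < \<pi> j \<and> (\<exists>d\<in>descent_set n \<pi>. i \<le> d \<and> d < j)"
    using d by blast
next
  assume "\<exists>i\<in>highs n K \<pi>. \<exists>j\<le>n. \<pi> i < \<pi> j \<and> (\<exists>d\<in>descent_set n \<pi>. i \<le> d \<and> d < j)"
  then obtain i j d where ij: "i \<in> highs n K \<pi>" "j \<le> n" "\<pi> i < \<pi> j" "d \<in> descent_set n \<pi>" "i \<le> d" "d < j" by blast
  have i: "ends_chain \<pi> (K - 1) i" "1 \<le> i" "i \<le> n" using ij by (auto simp: highs_def)
  obtain s where s: "s K = i" "\<And>a b. 1 \<le> a \<Longrightarrow> a < b \<Longrightarrow> b \<le> K \<Longrightarrow> s a < s b \<and> \<pi> (s a) < \<pi> (s b)"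
    "\<And>a. 1 \<le> a \<Longrightarrow> a \<le> K \<Longrightarrow> 1 \<le> s a" using ends_chain_seq[OF i(1,2)] K by auto
  have le: "s a \<le> i \<and> \<pi> (s a) \<le> \<pi> i" if "1 \<le> a" "a \<le> K" for a
    using s(1) s(2)[of a K] that by (cases "a = K") auto
  let ?s = "s(Suc K := j)"
  have "occurrence n (Suc K) (pattern_J (Suc K)) \<pi> ?s"
  proof (rule occurrenceI)
    fix a b assume "1 \<le> a" "a < b" "b \<le> Suc K"
    then show "?s a < ?s b" using s(2)[of a b] le[of a] ij by (auto simp: le_Suc_eq)
  next
    fix a assume "1 \<le> a" "a \<le> Suc K"
    then show "?s a \<in> {1..n}" using s(3)[of a] le[of a] ij i by (auto simp: le_Suc_eq)
  next
    fix a b assume "a \<in> {1..Suc K}" "b \<in> {1..Suc K}" "pattern_J (Suc K) a < pattern_J (Suc K) b"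
    then show "\<pi> (?s a) < \<pi> (?s b)" using s(2)[of a b] le[of a] ij by (auto simp: le_Suc_eq pattern_J_def)
  qed (auto simp: pattern_J_def inj_on_def)
  then show "contains_H n (Suc K) \<pi>" unfolding contains_H_def using ij s(1) K by (intro exI[of _ ?s]) auto
qed

text \<open>Without its peak, an occurrence is an increasing sequence of \<open>K\<close> entries
  ending right after a descent. Conversely, the top of a descent into a high position can be
  inserted as the peak.\<close>

lemma contains_Q_iff:
  assumes K: "2 \<le> K"
  shows "contains_Q n (Suc K) \<pi> \<longleftrightarrow> (\<exists>d\<in>descent_set n \<pi>. Suc d \<in> highs n K \<pi>)"
proof
  assume "contains_Q n (Suc K) \<pi>"
  then obtain s where s: "occurrence n (Suc K) (pattern_G (Suc K)) \<pi> s"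
    and d: "\<pi> (s (Suc K) - 1) > \<pi> (s (Suc K))" unfolding contains_Q_def by auto
  define t where "t a = (if a = K then s (Suc K) else s a)" for a
  have "ends_chain \<pi> (K - 1) (t (Suc (K - 1)))"
  proof (rule seq_ends_chain)
    fix a assume a: "1 \<le> a" "a \<le> K - 1"
    show "t a < t (Suc a) \<and> \<pi> (t a) < \<pi> (t (Suc a)) \<and> 1 \<le> t a"
    proof (cases "Suc a = K")
      case True
      then show ?thesis using a occurrence_less[OF s, of a "Suc K"] occurrence_iff[OF s, of a "Suc K"]
        by (auto simp: pattern_G_def t_def)
    next
      case False
      then show ?thesis using a occurrence_less[OF s, of a "Suc a"] occurrence_iff[OF s, of a "Suc a"]
        by (auto simp: pattern_G_def t_def)
    qed
  qed
  then have "ends_chain \<pi> (K - 1) (s (Suc K))" using K by (simp add: t_def)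
  moreover have "1 \<le> s K" "s K < s (Suc K)" "s (Suc K) \<le> n" using occurrence_less[OF s, of K "Suc K"] K by auto
  ultimately show "\<exists>d\<in>descent_set n \<pi>. Suc d \<in> highs n K \<pi>"
    using d by (intro bexI[of _ "s (Suc K) - 1"]) (auto simp: highs_def descent_set_def)
next
  assume "\<exists>d\<in>descent_set n \<pi>. Suc d \<in> highs n K \<pi>"
  then obtain d where d: "1 \<le> d" "d < n" "\<pi> (Suc d) < \<pi> d" "ends_chain \<pi> (K - 1) (Suc d)"
    by (auto simp: highs_def descent_set_def)
  obtain s where s: "s K = Suc d" "\<And>a b. 1 \<le> a \<Longrightarrow> a < b \<Longrightarrow> b \<le> K \<Longrightarrow> s a < s b \<and> \<pi> (s a) < \<pi> (s b)"
    "\<And>a. 1 \<le> a \<Longrightarrow> a \<le> K \<Longrightarrow> 1 \<le> s a" using ends_chain_seq[OF d(4)] K by auto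
  \<comment> \<open>The entry at \<open>d\<close> is larger than the one at \<open>Suc d\<close>, so
    \<open>d\<close> is not among the chain positions and all of the earlier ones precede it. With
    the peak at \<open>d\<close>, the required run of ascents is empty.\<close>
  have le: "s a < d \<and> \<pi> (s a) < \<pi> (Suc d)" if "1 \<le> a" "a < K" for a
  proof -
    have "s a < Suc d" "\<pi> (s a) < \<pi> (Suc d)" using s(1) s(2)[of a K] that by auto
    moreover from this have "s a \<noteq> d" using d by auto
    ultimately show ?thesis by simp
  qed
  define t where "t a = (if a = K then d else if a = Suc K then Suc d else s a)" for a
  have c: "a < K \<or> a = K \<or> a = Suc K" if "a \<le> Suc K" for a using that by auto
  have "occurrence n (Suc K) (pattern_G (Suc K)) \<pi> t"
  proof (rule occurrenceI)
    fix a b assume "1 \<le> a" "a < b" "b \<le> Suc K"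
    then show "t a < t b" using s(2)[of a b] le[of a] c[of b] by (auto simp: t_def)
  next
    fix a assume "1 \<le> a" "a \<le> Suc K"
    then show "t a \<in> {1..n}" using s(3)[of a] le[of a] d c[of a] by (auto simp: t_def)
  next
    fix a b assume "a \<in> {1..Suc K}" "b \<in> {1..Suc K}" "pattern_G (Suc K) a < pattern_G (Suc K) b"
    then show "\<pi> (t a) < \<pi> (t b)" using s(2)[of a b] le[of a] d c[of a] c[of b]
      by (auto simp: t_def pattern_G_def split: if_splits)
  next
    show "inj_on (pattern_G (Suc K)) {1..Suc K}" by (auto simp: inj_on_def pattern_G_def split: if_splits)
  qed
  then show "contains_Q n (Suc K) \<pi>" unfolding contains_Q_def using d
    by (intro exI[of _ t]) (auto simp: t_def)
qed

context descents_in begin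

lemma word_at: "\<pi> \<in> perms n S \<Longrightarrow> word S \<pi> (int (\<pi> i)) = int (block S i)"
  by (simp add: word_def inv_inv)

lemma block_inv_le:
  assumes "\<pi> \<in> perms n S" "x \<in> {1..n}" "y \<in> {1..n}" "x < y" "block S (inv \<pi> x) \<le> block S (inv \<pi> y)"
  shows "inv \<pi> x < inv \<pi> y"
  using assms by (simp add: inv_less less_prod_def)

lemma block_less_pos: "block S i < block S j \<Longrightarrow> i < j"
  using block_mono[of j i] by (meson not_less)

text \<open>The last entry of an occurrence is the smallest, so in the word it comes before the
  others and carries the largest letter. Its letter is strictly larger because no block contains an
  entry followed by a smaller one.\<close>

lemma avoids_F_iff:
  assumes \<pi>: "\<pi> \<in> perms n S" and K: "2 \<le> K"
  shows "avoids n (Suc K) (pattern_F (Suc K)) \<pi> \<longleftrightarrow> \<not> drop_chain K (word S \<pi>) (int n + 1)"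
proof -
  have perm: "\<pi> permutes {1..n}" using \<pi> by (simp add: perms_def)
  have "(\<exists>s. occurrence n (Suc K) (pattern_F (Suc K)) \<pi> s) \<longleftrightarrow> drop_chain K (word S \<pi>) (int n + 1)"
  proof
    assume "\<exists>s. occurrence n (Suc K) (pattern_F (Suc K)) \<pi> s"
    then obtain s where s: "occurrence n (Suc K) (pattern_F (Suc K)) \<pi> s" by blast
    define P where "P a = (int (\<pi> (s a)), word S \<pi> (int (\<pi> (s a))))" for a
    have rng: "s a \<in> {1..n}" if "a \<in> {1..Suc K}" for a
    proof -
      have "s ` {1..Suc K} \<subseteq> {1..n}" using s by (simp add: occurrence_def)
      then show ?thesis using that by blast
    qed
    have rng': "\<pi> (s a) \<in> {1..n}" if "a \<in> {1..Suc K}" for a using rng[OF that] permutes_in_image[OF perm] by blast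
    have lt: "\<pi> (s (Suc K)) < \<pi> (s a) \<and> block S (s a) < block S (s (Suc K))" if "a \<in> {1..K}" for a
    proof
      show lt: "\<pi> (s (Suc K)) < \<pi> (s a)" using occurrence_iff[OF s, of "Suc K" a] that by (auto simp: pattern_F_def)
      have sl: "s a < s (Suc K)" using occurrence_less[OF s, of a "Suc K"] that by auto
      have "block S (s a) \<noteq> block S (s (Suc K))"
        using same_block_less[OF \<pi> _ sl] rng[of a] rng[of "Suc K"] that lt by auto
      then show "block S (s a) < block S (s (Suc K))" using block_mono[of "s a" "s (Suc K)"] sl by simp
    qed
    have "chain (map P [1..<Suc K])"
    proof (rule chain_map_upt)
      fix a b assume ab: "1 \<le> a" "a < b" "b < Suc K"
      then show "P a \<prec> P b" using occurrence_less[OF s, of a b] occurrence_iff[OF s, of a b] block_mono[of "s a" "s b"]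
        by (auto simp: P_def prec_def word_at[OF \<pi>] pattern_F_def)
    qed
    moreover have "set (map P [1..<Suc K]) \<subseteq> pts {int (\<pi> (s (Suc K)))<..<int n + 1} (word S \<pi>)"
      using lt rng' by (auto simp: P_def mem_pts_iff simp del: upt_Suc)
    moreover have "\<forall>x\<in>set (map P [1..<Suc K]). snd x < word S \<pi> (int (\<pi> (s (Suc K))))"
      using lt by (auto simp: P_def word_at[OF \<pi>] simp del: upt_Suc)
    moreover have "1 \<le> int (\<pi> (s (Suc K)))" using rng'[of "Suc K"] by simp
    ultimately show "drop_chain K (word S \<pi>) (int n + 1)" unfolding drop_chain_def
      by (intro exI[of _ "int (\<pi> (s (Suc K)))"] exI[of _ "map P [1..<Suc K]"] conjI) (simp_all del: upt_Suc set_map)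
  next
    assume "drop_chain K (word S \<pi>) (int n + 1)"
    then obtain t xs where t: "1 \<le> t" "chain xs" "set xs \<subseteq> pts {t<..<int n + 1} (word S \<pi>)" "K \<le> length xs"
      "\<forall>x\<in>set xs. snd x < word S \<pi> t" unfolding drop_chain_def by blast
    define v where "v a = (if a = Suc K then nat t else nat (fst (xs ! (a - 1))))" for a
    define s where "s a = inv \<pi> (v a)" for a
    have x: "t < fst (xs ! (a - 1)) \<and> fst (xs ! (a - 1)) \<le> int n \<and> snd (xs ! (a - 1)) = int (block S (s a)) \<and>
        snd (xs ! (a - 1)) < word S \<pi> t" if "1 \<le> a" "a \<le> K" for a
    proof -
      have "xs ! (a - 1) \<in> set xs" using that t by simp
      then have "xs ! (a - 1) \<in> pts {t<..<int n + 1} (word S \<pi>)" "snd (xs ! (a - 1)) < word S \<pi> t" using t by auto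
      then show ?thesis using that by (auto simp: mem_pts_iff word_def s_def v_def)
    qed
    have vk: "nat t \<in> {1..n}" using x[of 1] K t by auto
    have vrng: "v a \<in> {1..n}" if "1 \<le> a" "a \<le> Suc K" for a
      using x[of a] vk that t by (cases "a = Suc K") (auto simp: v_def)
    have \<pi>s: "\<pi> (s a) = v a" for a by (simp add: s_def inv_inv[OF \<pi>])
    have inc: "v a < v b \<and> s a < s b" if "1 \<le> a" "a < b" "b \<le> K" for a b
    proof -
      have p: "xs ! (a - 1) \<prec> xs ! (b - 1)" using that t by (intro sorted_wrt_nth_less[OF t(2)]) auto
      then have "v a < v b" using x[of a] t that by (auto simp: v_def prec_def)
      moreover have "block S (s a) \<le> block S (s b)" using p x[of a] x[of b] that by (auto simp: prec_def)
      ultimately show ?thesis using block_inv_le[OF \<pi>, of "v a" "v b"] vrng[of a] vrng[of b] that by (auto simp: s_def)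
    qed
    have last: "v (Suc K) < v a \<and> s a < s (Suc K)" if "1 \<le> a" "a \<le> K" for a
    proof
      show "v (Suc K) < v a" using x[OF that] t that by (auto simp: v_def)
      have "block S (s a) < block S (s (Suc K))" using x[OF that] that by (auto simp: word_def s_def v_def)
      then show "s a < s (Suc K)" by (rule block_less_pos)
    qed
    have "occurrence n (Suc K) (pattern_F (Suc K)) \<pi> s"
    proof (rule occurrenceI)
      fix a b assume "1 \<le> a" "a < b" "b \<le> Suc K"
      then show "s a < s b" using inc[of a b] last[of a] by (cases "b = Suc K") auto
    next
      fix a assume "1 \<le> a" "a \<le> Suc K"
      then show "s a \<in> {1..n}" using vrng inv_mem[OF \<pi>] by (simp add: s_def)
    next
      fix a b assume "a \<in> {1..Suc K}" "b \<in> {1..Suc K}" "pattern_F (Suc K) a < pattern_F (Suc K) b"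
      then show "\<pi> (s a) < \<pi> (s b)" unfolding \<pi>s using inc[of a b] last[of b]
        by (auto simp: pattern_F_def le_Suc_eq split: if_splits)
    next
      show "inj_on (pattern_F (Suc K)) {1..Suc K}" by (auto simp: inj_on_def pattern_F_def split: if_splits)
    qed
    then show "\<exists>s. occurrence n (Suc K) (pattern_F (Suc K)) \<pi> s" by blast
  qed
  then show ?thesis by (simp add: avoids_def)
qed

lemma perm_pos:
  assumes \<pi>: "\<pi> \<in> perms n S" and "1 \<le> i"
  shows "0 < \<pi> i"
proof (rule ccontr)
  assume "\<not> 0 < \<pi> i"
  then have "\<pi> i = \<pi> 0" using \<pi> by (auto simp: perms_def permutes_not_in)
  then show False using assms permutes_inj[of \<pi> "{1..n}"] injD[of \<pi> i 0] by (auto simp: perms_def)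
qed

text \<open>Along an increasing subsequence the values increase strictly and the blocks weakly, so
  its pairs of value and block form a chain in the word.\<close>

lemma ends_chain_chain:
  assumes \<pi>: "\<pi> \<in> perms n S"
  shows "\<lbrakk>ends_chain \<pi> r i; 1 \<le> i\<rbrakk> \<Longrightarrow> \<exists>xs. length xs = r \<and> chain (xs @ [(int (\<pi> i), int (block S i))]) \<and>
    set (xs @ [(int (\<pi> i), int (block S i))]) \<subseteq> pts {0<..<int (\<pi> i) + 1} (word S \<pi>)"
proof (induction r arbitrary: i)
  have mem: "(int (\<pi> i), int (block S i)) \<in> pts {0<..<int (\<pi> i) + 1} (word S \<pi>)" if "1 \<le> i" for i
    using perm_pos[OF \<pi> that] by (auto simp: mem_pts_iff word_at[OF \<pi>])
  case 0
  then show ?case using mem by (intro exI[of _ "[]"]) auto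
next
  case (Suc r)
  then obtain h where h: "1 \<le> h" "h < i" "\<pi> h < \<pi> i" "ends_chain \<pi> r h" by auto
  with Suc.IH obtain xs where xs: "length xs = r" "chain (xs @ [(int (\<pi> h), int (block S h))])"
    "set (xs @ [(int (\<pi> h), int (block S h))]) \<subseteq> pts {0<..<int (\<pi> h) + 1} (word S \<pi>)" by blast
  let ?x = "(int (\<pi> h), int (block S h))" and ?y = "(int (\<pi> i), int (block S i))"
  have "?x \<prec> ?y" using h block_mono[of h i] by (auto simp: prec_def)
  then have "chain ((xs @ [?x]) @ [?y])"
    by (intro sorted_wrt_prepend[OF transp_prec xs(2)]) auto
  moreover have "set ((xs @ [?x]) @ [?y]) \<subseteq> pts {0<..<int (\<pi> i) + 1} (word S \<pi>)"
    using xs(3) h perm_pos[OF \<pi>, of i] by (auto simp: mem_pts_iff word_at[OF \<pi>])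
  ultimately show ?case using xs(1) by (intro exI[of _ "xs @ [?x]"]) simp
qed

text \<open>Conversely, larger values in the same or a later block stand further to the right, so a
  chain in the word is an increasing subsequence.\<close>

lemma chain_ends_chain:
  assumes \<pi>: "\<pi> \<in> perms n S"
  shows "\<lbrakk>chain (xs @ [x]); set (xs @ [x]) \<subseteq> pts {0<..<int n + 1} (word S \<pi>)\<rbrakk> \<Longrightarrow>
    ends_chain \<pi> (length xs) (inv \<pi> (nat (fst x)))"
proof (induction xs arbitrary: x rule: rev_induct)
  case (snoc y ys)
  have y: "ends_chain \<pi> (length ys) (inv \<pi> (nat (fst y)))" using snoc by (auto simp: sorted_wrt_append)
  have xy: "y \<prec> x" using snoc.prems(1) by (simp add: sorted_wrt_append)
  have m: "nat (fst x) \<in> {1..n}" "nat (fst y) \<in> {1..n}" using snoc.prems(2) by (auto simp: mem_pts_iff)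
  have b: "snd x = int (block S (inv \<pi> (nat (fst x))))" "snd y = int (block S (inv \<pi> (nat (fst y))))"
    using snoc.prems(2) by (auto simp: mem_pts_iff word_def)
  have l: "nat (fst y) < nat (fst x)" using xy m by (auto simp: prec_def)
  have "inv \<pi> (nat (fst y)) < inv \<pi> (nat (fst x))"
    using block_inv_le[OF \<pi> m(2,1) l] xy b by (auto simp: prec_def)
  moreover have "1 \<le> inv \<pi> (nat (fst y))" using inv_mem[OF \<pi>, of "nat (fst y)"] m by auto
  ultimately have "ends_chain \<pi> (Suc (length ys)) (inv \<pi> (nat (fst x)))"
    using y l by (auto simp: inv_inv[OF \<pi>])
  then show ?case by simp
qed simp

text \<open>Point number \<open>K\<close> of a chain in the word is a high entry. The pattern thus
  says that a high entry has a larger entry in a strictly later block.\<close>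

lemma no_rise_chain_iff:
  assumes \<pi>: "\<pi> \<in> perms n S" and K: "2 \<le> K"
  shows "(\<forall>t. 1 \<le> t \<and> t \<le> int n \<longrightarrow> \<not> rise_chain K (word S \<pi>) t) \<longleftrightarrow>
    (\<forall>i\<in>highs n K \<pi>. \<forall>j\<le>n. block S i < block S j \<longrightarrow> \<pi> j < \<pi> i)"
proof
  assume a: "\<forall>t. 1 \<le> t \<and> t \<le> int n \<longrightarrow> \<not> rise_chain K (word S \<pi>) t"
  show "\<forall>i\<in>highs n K \<pi>. \<forall>j\<le>n. block S i < block S j \<longrightarrow> \<pi> j < \<pi> i"
  proof (intro ballI allI impI, rule ccontr)
    fix i j assume i: "i \<in> highs n K \<pi>" and j: "j \<le> n" "block S i < block S j" "\<not> \<pi> j < \<pi> i"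
    have ij: "i < j" using block_less_pos j by blast
    have "\<pi> i \<noteq> \<pi> j" using \<pi> ij permutes_inj[of \<pi> "{1..n}"] injD[of \<pi> i j] by (auto simp: perms_def)
    then have lt: "\<pi> i < \<pi> j" using j by simp
    have "1 \<le> i" "ends_chain \<pi> (K - 1) i" using i by (auto simp: highs_def)
    then obtain xs where xs: "length xs = K - 1" "chain (xs @ [(int (\<pi> i), int (block S i))])"
      "set (xs @ [(int (\<pi> i), int (block S i))]) \<subseteq> pts {0<..<int (\<pi> i) + 1} (word S \<pi>)"
      using ends_chain_chain[OF \<pi>] by blast
    let ?xs = "xs @ [(int (\<pi> i), int (block S i))]"
    have "\<pi> j \<in> {1..n}" using permutes_in_image[of \<pi> "{1..n}" j] \<pi> j ij by (auto simp: perms_def)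
    moreover have "rise_chain K (word S \<pi>) (int (\<pi> j))" unfolding rise_chain_def
    proof (intro exI[of _ ?xs] conjI ballI)
      show "set ?xs \<subseteq> pts {0<..<int (\<pi> j)} (word S \<pi>)"
      proof
        fix x assume "x \<in> set ?xs"
        then have "x \<in> pts {0<..<int (\<pi> i) + 1} (word S \<pi>)" using xs(3) by blast
        then show "x \<in> pts {0<..<int (\<pi> j)} (word S \<pi>)" using lt by (auto simp: mem_pts_iff)
      qed
      fix x assume "x \<in> set ?xs"
      then have "snd x \<le> snd (last ?xs)" using chain_hd_last[OF xs(2)] by blast
      then show "snd x < word S \<pi> (int (\<pi> j))" using j(2) by (simp add: word_at[OF \<pi>])
    qed (use xs K in auto)
    ultimately show False using a by auto
  qed
next
  assume a: "\<forall>i\<in>highs n K \<pi>. \<forall>j\<le>n. block S i < block S j \<longrightarrow> \<pi> j < \<pi> i"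
  show "\<forall>t. 1 \<le> t \<and> t \<le> int n \<longrightarrow> \<not> rise_chain K (word S \<pi>) t"
  proof (intro allI impI notI)
    fix t assume t: "1 \<le> t \<and> t \<le> int n" and "rise_chain K (word S \<pi>) t"
    then obtain xs where xs: "chain xs" "set xs \<subseteq> pts {0<..<t} (word S \<pi>)" "K \<le> length xs"
      "\<forall>x\<in>set xs. snd x < word S \<pi> t" unfolding rise_chain_def by blast
    let ?ys = "take (K - 1) xs" and ?x = "xs ! (K - 1)"
    have tk: "take K xs = ?ys @ [?x]" using xs(3) K take_Suc_conv_app_nth[of "K - 1" xs] by simp
    have c: "chain (?ys @ [?x])" using sorted_wrt_take[OF xs(1), of K] tk by simp
    have sub: "set (?ys @ [?x]) \<subseteq> set xs" unfolding tk[symmetric] by (rule set_take_subset)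
    moreover have "pts {0<..<t} (word S \<pi>) \<subseteq> pts {0<..<int n + 1} (word S \<pi>)" using t by (auto simp: mem_pts_iff)
    ultimately have "set (?ys @ [?x]) \<subseteq> pts {0<..<int n + 1} (word S \<pi>)" using xs(2) by blast
    from chain_ends_chain[OF \<pi> c this] have l: "ends_chain \<pi> (K - 1) (inv \<pi> (nat (fst ?x)))" using xs(3) K by simp
    have x: "?x \<in> set xs" using sub by simp
    then have xp: "?x \<in> pts {0<..<t} (word S \<pi>)" "snd ?x < word S \<pi> t" using xs by auto
    then have xm: "nat (fst ?x) \<in> {1..n}" using t by (auto simp: mem_pts_iff)
    let ?i = "inv \<pi> (nat (fst ?x))" and ?j = "inv \<pi> (nat t)"
    have "?i \<in> highs n K \<pi>" using l inv_mem[OF \<pi>, of "nat (fst ?x)"] xm by (auto simp: highs_def)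
    moreover have "?j \<le> n" using inv_mem[OF \<pi>, of "nat t"] t by auto
    moreover have "block S ?i < block S ?j" using xp by (auto simp: mem_pts_iff word_def)
    ultimately have "\<pi> ?j < \<pi> ?i" using a by blast
    then have "nat t < nat (fst ?x)" by (simp add: inv_inv[OF \<pi>])
    then show False using xp by (auto simp: mem_pts_iff)
  qed
qed

end

lemma ends_chain_antimono: "ends_chain \<pi> (Suc r) j \<Longrightarrow> ends_chain \<pi> r j"
  by (induction r arbitrary: j) auto

lemma high_up: "\<lbrakk>i \<in> highs n K \<pi>; i < j; j \<le> n; \<pi> i < \<pi> j\<rbrakk> \<Longrightarrow> j \<in> highs n K \<pi>"
  using ends_chain_antimono[of \<pi> "K - 1" j] by (auto simp: highs_def)

text \<open>Pass from a high position to a predecessor that ends a chain with \<open>K - 2\<close>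
  steps, and repeat as long as the predecessor is high. So being high is always witnessed by a low
  entry, which no rearrangement of high entries disturbs.\<close>

lemma low_below:
  assumes K: "2 \<le> K"
  shows "j \<in> highs n K \<pi> \<Longrightarrow> \<exists>z. 1 \<le> z \<and> z < j \<and> z \<notin> highs n K \<pi> \<and> \<pi> z < \<pi> j \<and> ends_chain \<pi> (K - 2) z"
proof (induction j rule: less_induct)
  case (less j)
  have "K - 1 = Suc (K - 2)" using K by simp
  then obtain i where i: "1 \<le> i" "i < j" "\<pi> i < \<pi> j" "ends_chain \<pi> (K - 2) i" using less.prems by (auto simp: highs_def)
  show ?case
  proof (cases "i \<in> highs n K \<pi>")
    case True
    then obtain z where "1 \<le> z" "z < i" "z \<notin> highs n K \<pi>" "\<pi> z < \<pi> i" "ends_chain \<pi> (K - 2) z"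
      using less.IH i by blast
    then show ?thesis using i by (intro exI[of _ z]) auto
  qed (use i in blast)
qed

subsection \<open>Rearranging the high entries\<close>

text \<open>On \<open>H\<close> this value is constant exactly along the maximal runs of consecutive
  positions, and it grows from one run to the next.\<close>

definition run :: "nat set \<Rightarrow> nat \<Rightarrow> nat" where
  "run H i = card {l. l \<notin> H \<and> 1 \<le> l \<and> l < i}"

lemma run_mono: "i \<le> j \<Longrightarrow> run H i \<le> run H j"
  unfolding run_def by (intro card_mono) auto

lemma run_less_iff:
  assumes "i \<in> H" "1 \<le> i"
  shows "run H i < run H j \<longleftrightarrow> (\<exists>l. l \<notin> H \<and> i < l \<and> l < j)"
proof
  assume "run H i < run H j"
  then have "\<not> {l. l \<notin> H \<and> 1 \<le> l \<and> l < j} \<subseteq> {l. l \<notin> H \<and> 1 \<le> l \<and> l < i}"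
    unfolding run_def using card_mono[of "{l. l \<notin> H \<and> 1 \<le> l \<and> l < i}" "{l. l \<notin> H \<and> 1 \<le> l \<and> l < j}"] by auto
  then obtain l where "l \<notin> H" "l < j" "\<not> l < i" by auto
  then show "\<exists>l. l \<notin> H \<and> i < l \<and> l < j" using assms by (metis linorder_neqE_nat)
next
  assume "\<exists>l. l \<notin> H \<and> i < l \<and> l < j"
  then obtain l where l: "l \<notin> H" "i < l" "l < j" by blast
  then have "l \<in> {l. l \<notin> H \<and> 1 \<le> l \<and> l < j}" "l \<notin> {l. l \<notin> H \<and> 1 \<le> l \<and> l < i}"
    "{l. l \<notin> H \<and> 1 \<le> l \<and> l < i} \<subseteq> {l. l \<notin> H \<and> 1 \<le> l \<and> l < j}" using assms by auto
  then have "{l. l \<notin> H \<and> 1 \<le> l \<and> l < i} \<subset> {l. l \<notin> H \<and> 1 \<le> l \<and> l < j}" by blast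
  then show "run H i < run H j" unfolding run_def by (intro psubset_card_mono) auto
qed

context descents_in begin

lemma perms_neq: "\<pi> \<in> perms n S \<Longrightarrow> i \<noteq> j \<Longrightarrow> \<pi> i \<noteq> \<pi> j"
  using permutes_inj[of \<pi> "{1..n}"] injD[of \<pi> i j] by (auto simp: perms_def)

text \<open>A low position lies on the same side of a whole run. So the low witnesses of high
  entries remain to the left of them (\<open>C1\<close>), and every high entry stays larger than
  each low entry to its right (\<open>C2\<close>). Hence the set of high positions does not
  change.\<close>

lemma resort:
  assumes \<pi>: "\<pi> \<in> perms n S" and K: "2 \<le> K" and H: "H = highs n K \<pi>"
    and \<theta>: "bij_betw \<theta> H H" "\<And>i. i \<in> H \<Longrightarrow> run H (\<theta> i) = run H i"
    and asc: "\<And>i. \<lbrakk>i \<in> H; Suc i \<in> H; i \<notin> S\<rbrakk> \<Longrightarrow> \<pi> (\<theta> i) < \<pi> (\<theta> (Suc i))"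
  defines "\<sigma> \<equiv> (\<lambda>i. if i \<in> H then \<pi> (\<theta> i) else \<pi> i)"
  shows "\<sigma> \<in> perms n S" "highs n K \<sigma> = H"
proof -
  have Hn: "H \<subseteq> {1..n}" using H by (auto simp: highs_def)
  have \<theta>H: "\<theta> i \<in> H" if "i \<in> H" for i using \<theta>(1) that by (auto simp: bij_betw_def)
  have samerun: "\<theta> i < l \<longleftrightarrow> i < l" if i: "i \<in> H" and l: "l \<notin> H" "1 \<le> l" for i l
  proof -
    have "i < l \<longleftrightarrow> run H i < run H (Suc l)" if "i \<in> H" for i
    proof
      assume "i < l"
      moreover have "1 \<le> i" using that Hn by auto
      ultimately show "run H i < run H (Suc l)" using run_less_iff[OF that, of "Suc l"] l by auto
    next
      assume "run H i < run H (Suc l)"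
      then have "\<not> Suc l \<le> i" using run_mono[of "Suc l" i H] by auto
      then show "i < l" using l that by (cases "i = l") auto
    qed
    then show ?thesis using \<theta>(2)[OF i] \<theta>H[OF i] i by metis
  qed
  have C1: "\<exists>z. 1 \<le> z \<and> z < j \<and> z \<notin> H \<and> \<pi> z < \<sigma> j \<and> ends_chain \<pi> (K - 2) z" if j: "j \<in> H" for j
  proof -
    obtain z where z: "1 \<le> z" "z < \<theta> j" "z \<notin> H" "\<pi> z < \<pi> (\<theta> j)" "ends_chain \<pi> (K - 2) z"
      using low_below[OF K] \<theta>H[OF j] H by blast
    have "\<not> j < z" using samerun[OF j z(3,1)] z(2) by simp
    then have "z < j" using z(3) j by (cases "z = j") auto
    then show ?thesis using z j by (auto simp: \<sigma>_def)
  qed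
  have C2: "\<pi> l < \<sigma> h" if "l \<in> {1..n}" "l \<notin> H" "h \<in> H" "h < l" for l h
  proof (rule ccontr)
    assume "\<not> \<pi> l < \<sigma> h"
    moreover have "\<theta> h < l" using samerun that by simp
    moreover have "\<pi> (\<theta> h) \<noteq> \<pi> l" using perms_neq[OF \<pi>] \<theta>H[OF that(3)] that(2) by metis
    ultimately have "l \<in> H" using high_up[of "\<theta> h" n K \<pi> l] \<theta>H[OF that(3)] that H by (auto simp: \<sigma>_def)
    then show False using that by simp
  qed
  have low1: "ends_chain \<sigma> t i" if "ends_chain \<pi> t i" "i \<in> {1..n}" "i \<notin> H" for t i
    using that
  proof (induction t arbitrary: i)
    case (Suc t)
    then obtain h where h: "1 \<le> h" "h < i" "\<pi> h < \<pi> i" "ends_chain \<pi> t h" by auto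
    then have "h \<notin> H" using high_up[of h n K \<pi> i] Suc.prems H by auto
    then have "ends_chain \<sigma> t h" "\<sigma> h < \<sigma> i" using Suc h by (auto simp: \<sigma>_def)
    then show ?case using h by auto
  qed simp
  have low2: "ends_chain \<pi> t i" if "ends_chain \<sigma> t i" "i \<in> {1..n}" "i \<notin> H" for t i
    using that
  proof (induction t arbitrary: i)
    case (Suc t)
    then obtain h where h: "1 \<le> h" "h < i" "\<sigma> h < \<sigma> i" "ends_chain \<sigma> t h" by auto
    then have "h \<notin> H" using C2[of i h] Suc.prems by (auto simp: \<sigma>_def)
    then have "ends_chain \<pi> t h" "\<pi> h < \<pi> i" using Suc h by (auto simp: \<sigma>_def)
    then show ?case using h by auto
  qed simp
  have K1: "K - 1 = Suc (K - 2)" using K by simp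
  show highs: "highs n K \<sigma> = H"
  proof (intro set_eqI iffI)
    fix i assume i: "i \<in> highs n K \<sigma>"
    show "i \<in> H"
    proof (rule ccontr)
      assume "i \<notin> H"
      then have "ends_chain \<pi> (K - 1) i" using low2 i by (auto simp: highs_def)
      then show False using \<open>i \<notin> H\<close> i H by (auto simp: highs_def)
    qed
  next
    fix j assume j: "j \<in> H"
    then obtain z where z: "1 \<le> z" "z < j" "z \<notin> H" "\<pi> z < \<sigma> j" "ends_chain \<pi> (K - 2) z" using C1 by blast
    then have "ends_chain \<sigma> (K - 2) z" "\<sigma> z < \<sigma> j" using low1[of "K - 2" z] Hn j by (auto simp: \<sigma>_def)
    then have "ends_chain \<sigma> (K - 1) j" unfolding K1 using z by auto
    then show "j \<in> highs n K \<sigma>" using Hn j by (auto simp: highs_def)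
  qed
  have perm: "\<pi> permutes {1..n}" using \<pi> by (simp add: perms_def)
  define \<theta>' where "\<theta>' i = (if i \<in> H then \<theta> i else i)" for i
  have "bij_betw \<theta>' H H" using \<theta>(1) by (subst bij_betw_cong[of _ \<theta>' \<theta>]) (auto simp: \<theta>'_def)
  then have "\<theta>' permutes H" by (rule bij_imp_permutes) (auto simp: \<theta>'_def)
  then have "\<theta>' permutes {1..n}" using Hn by (rule permutes_subset)
  then have "\<pi> \<circ> \<theta>' permutes {1..n}" using perm by (rule permutes_compose)
  moreover have "\<pi> \<circ> \<theta>' = \<sigma>" by (auto simp: \<sigma>_def \<theta>'_def fun_eq_iff)
  ultimately have \<sigma>p: "\<sigma> permutes {1..n}" by simp
  have "\<sigma> i < \<sigma> (Suc i)" if i: "1 \<le> i" "i < n" "i \<notin> S" for i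
  proof -
    have \<pi>i: "\<pi> i < \<pi> (Suc i)" using no_descent[OF \<pi> i(1,2)] i(3) \<pi> by (auto simp: perms_def)
    consider "i \<in> H" | "i \<notin> H" "Suc i \<notin> H" | "i \<notin> H" "Suc i \<in> H" by blast
    then show ?thesis
    proof cases
      case 1
      then have "Suc i \<in> H" using high_up[of i n K \<pi> "Suc i"] \<pi>i i H by auto
      then show ?thesis using asc[OF 1 _ i(3)] 1 by (simp add: \<sigma>_def)
    next
      case 2
      then show ?thesis using \<pi>i by (simp add: \<sigma>_def)
    next
      case 3
      \<comment> \<open>If the ascent failed, the low witness \<open>z\<close> of
        \<open>Suc i\<close> would be to the left of and below the entry at \<open>i\<close>, and
        \<open>i\<close> would be high.\<close>
      obtain z where z: "1 \<le> z" "z < Suc i" "z \<notin> H" "\<pi> z < \<sigma> (Suc i)" "ends_chain \<pi> (K - 2) z" using C1[OF 3(2)] by blast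
      show ?thesis
      proof (rule ccontr)
        assume c: "\<not> \<sigma> i < \<sigma> (Suc i)"
        then have "\<pi> z < \<pi> i" using z(4) 3 by (simp add: \<sigma>_def)
        moreover from this have "z < i" using z(2) by (cases "z = i") auto
        ultimately have "ends_chain \<pi> (K - 1) i" unfolding K1 using z by auto
        then have "i \<in> H" using H i by (auto simp: highs_def)
        then show False using 3 by simp
      qed
    qed
  qed
  then have "descent_set n \<sigma> \<subseteq> S" by (force simp: descent_set_def)
  then show "\<sigma> \<in> perms n S" using \<sigma>p by (simp add: perms_def)
qed

text \<open>
  In the classes below the relative order of the high entries is dictated by \<open>b\<close>: they decrease
  between different \<open>b\<close>-levels and increase inside one. Taking blocks as levels gives the
  permutations whose word avoids the second pattern, and taking maximal runs of consecutive
  high positions gives the permutations avoiding \<open>H\<^sub>k\<close> and \<open>Q\<^sub>k\<close>.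
\<close>

definition level_class :: "nat \<Rightarrow> (nat set \<Rightarrow> nat \<Rightarrow> nat) \<Rightarrow> (nat \<Rightarrow> nat) set" where
  "level_class K b = {\<pi> \<in> perms n S. \<forall>i\<in>highs n K \<pi>. \<forall>j\<in>highs n K \<pi>. i < j \<longrightarrow>
     (\<pi> i < \<pi> j \<longleftrightarrow> b (highs n K \<pi>) i = b (highs n K \<pi>) j)}"

text \<open>Every level lies inside one run, so all admissible \<open>b\<close> agree that high
  entries decrease from run to run. Adjacent high positions not separated by \<open>S\<close> share
  a level, so the ascents required there are present.\<close>

definition admissible :: "nat \<Rightarrow> (nat set \<Rightarrow> nat \<Rightarrow> nat) \<Rightarrow> bool" where
  "admissible K b \<longleftrightarrow> (\<forall>\<pi>\<in>perms n S. \<forall>i\<in>highs n K \<pi>. \<forall>j\<in>highs n K \<pi>.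
     (i \<le> j \<longrightarrow> b (highs n K \<pi>) i \<le> b (highs n K \<pi>) j) \<and>
     (run (highs n K \<pi>) i < run (highs n K \<pi>) j \<longrightarrow> b (highs n K \<pi>) i < b (highs n K \<pi>) j) \<and>
     (j = Suc i \<and> i \<notin> S \<longrightarrow> b (highs n K \<pi>) i = b (highs n K \<pi>) j))"

text \<open>A low position between two runs begins a new block: in the block of the earlier high
  entry it would carry a larger entry and thus be high.\<close>

lemma admissible_block:
  shows "admissible K (\<lambda>_. block S)"
  unfolding admissible_def
proof (intro ballI conjI impI)
  fix \<pi> i j assume \<pi>: "\<pi> \<in> perms n S" and i: "i \<in> highs n K \<pi>" and j: "j \<in> highs n K \<pi>"
  have i1: "1 \<le> i" "j \<le> n" using i j by (auto simp: highs_def)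
  show "i \<le> j \<Longrightarrow> block S i \<le> block S j" by (rule block_mono)
  show "block S i = block S j" if "j = Suc i \<and> i \<notin> S"
    using block_less[of i j] block_mono[of i j] that by (auto simp: le_less less_Suc_eq_le dest: antisym)
  assume "run (highs n K \<pi>) i < run (highs n K \<pi>) j"
  then obtain l where l: "l \<notin> highs n K \<pi>" "i < l" "l < j" using run_less_iff[OF i i1(1)] by blast
  have "block S i \<noteq> block S l"
  proof
    assume "block S i = block S l"
    then have "\<pi> i < \<pi> l" using same_block_less[OF \<pi>] i1 l by simp
    then show False using high_up[OF i l(2)] l i1 by simp
  qed
  then show "block S i < block S j" using block_mono[of i l] block_mono[of l j] l by linarith
qed

lemma admissible_run: "admissible K run"
  unfolding admissible_def
proof (intro ballI conjI impI)
  fix \<pi> i j assume \<pi>: "\<pi> \<in> perms n S" and i: "i \<in> highs n K \<pi>" and j: "j \<in> highs n K \<pi>"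
  have "1 \<le> i" using i by (auto simp: highs_def)
  show "run (highs n K \<pi>) i = run (highs n K \<pi>) j" if "j = Suc i \<and> i \<notin> S"
    using run_less_iff[OF i \<open>1 \<le> i\<close>, of j] run_mono[of i j "highs n K \<pi>"] that by auto
qed (auto intro: run_mono)

lemma finite_perms: "finite (perms n S)"
  by (rule finite_subset[OF _ finite_permutations[of "{1..n}"]]) (auto simp: perms_def)

text \<open>The high entries are put into the order that \<open>c\<close> prescribes. Since
  \<open>b\<close> and \<open>c\<close> are arbitrary, the inequality gives equality by exchanging
  them.\<close>

lemma card_level_class_le:
  assumes K: "2 \<le> K" and b: "admissible K b" and c: "admissible K c"
  shows "card (level_class K b) \<le> card (level_class K c)"
proof -
  \<comment> \<open>The negative sign makes later levels smaller, while the second component makes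
    entries increase inside a level: this is the order that the class prescribes.\<close>
  define key where "key b H i = (- int (b H i), i)" for b :: "nat set \<Rightarrow> nat \<Rightarrow> nat" and H i
  \<comment> \<open>\<open>\<theta> H i\<close> is the position whose old entry has the rank that
    the new order demands at \<open>i\<close>.\<close>
  define \<theta> where "\<theta> H i = the_inv_into H (rank_on H (key b H)) (rank_on H (key c H) i)" for H i
  define \<Phi> where "\<Phi> \<pi> i = (if i \<in> highs n K \<pi> then \<pi> (\<theta> (highs n K \<pi>) i) else \<pi> i)" for \<pi> i
  have inj: "inj_on (key a H) H" for a H by (auto simp: inj_on_def key_def)
  have key_less: "key a (highs n K \<pi>) i < key a (highs n K \<pi>) j \<longleftrightarrow> a (highs n K \<pi>) i = a (highs n K \<pi>) j"
    if "admissible K a" "\<pi> \<in> perms n S" "i \<in> highs n K \<pi>" "j \<in> highs n K \<pi>" "i < j" for a \<pi> i j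
  proof -
    have "a (highs n K \<pi>) i \<le> a (highs n K \<pi>) j" using that unfolding admissible_def by auto
    then show ?thesis using that(5) by (auto simp: key_def less_prod_def)
  qed
  have ord: "\<pi> i < \<pi> j \<longleftrightarrow> key b (highs n K \<pi>) i < key b (highs n K \<pi>) j"
    if \<pi>: "\<pi> \<in> level_class K b" and ij: "i \<in> highs n K \<pi>" "j \<in> highs n K \<pi>" for \<pi> i j
  proof -
    have p: "\<pi> \<in> perms n S" using \<pi> by (simp add: level_class_def)
    have 1: "\<pi> i < \<pi> j \<longleftrightarrow> key b (highs n K \<pi>) i < key b (highs n K \<pi>) j"
      if "i \<in> highs n K \<pi>" "j \<in> highs n K \<pi>" "i < j" for i j
      using key_less[OF b p that] \<pi> that by (auto simp: level_class_def)
    consider "i < j" | "i = j" | "j < i" by linarith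
    then show ?thesis
    proof cases
      case 3
      have "\<pi> i < \<pi> j \<longleftrightarrow> \<not> \<pi> j < \<pi> i" using perms_neq[OF p, of i j] 3 by auto
      moreover have "key b (highs n K \<pi>) i \<noteq> key b (highs n K \<pi>) j" using 3 by (simp add: key_def)
      ultimately show ?thesis using 1[OF ij(2,1) 3] by auto
    qed (use 1 ij in auto)
  qed
  \<comment> \<open>For every admissible order the entries of later runs come below and those of
    earlier runs above. So the rank determines the run, and matching ranks moves entries only inside
    runs.\<close>
  have rank_bounds: "card {y \<in> H. run H x < run H y} < rank_on H (key a H) x"
    "rank_on H (key a H) x \<le> card {y \<in> H. run H x \<le> run H y}"
    if a: "admissible K a" and \<pi>: "\<pi> \<in> perms n S" "H = highs n K \<pi>" and x: "x \<in> H" for a \<pi> H x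
  proof -
    have fin: "finite H" using \<pi> by (auto simp: highs_def)
    have lt: "key a H y < key a H x" if "y \<in> H" "x \<in> H" "run H x < run H y" for x y
      using a \<pi> that unfolding admissible_def by (auto simp: key_def less_prod_def)
    have "{y \<in> H. run H x < run H y} \<subseteq> {y \<in> H. key a H y \<le> key a H x}"
      using lt[OF _ x] less_imp_le by blast
    moreover have "x \<in> {y \<in> H. key a H y \<le> key a H x}" "x \<notin> {y \<in> H. run H x < run H y}" using x by auto
    ultimately have "{y \<in> H. run H x < run H y} \<subset> {y \<in> H. key a H y \<le> key a H x}" by blast
    then show "card {y \<in> H. run H x < run H y} < rank_on H (key a H) x"
      unfolding rank_on_def using fin by (intro psubset_card_mono) auto
    have "{y \<in> H. key a H y \<le> key a H x} \<subseteq> {y \<in> H. run H x \<le> run H y}" using lt x by (force simp: not_le[symmetric])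
    then show "rank_on H (key a H) x \<le> card {y \<in> H. run H x \<le> run H y}"
      unfolding rank_on_def using fin by (intro card_mono) auto
  qed
  have \<theta>: "bij_betw (\<theta> H) H H" "\<And>i. i \<in> H \<Longrightarrow> rank_on H (key b H) (\<theta> H i) = rank_on H (key c H) i" if "finite H" for H
  proof -
    note bb = bij_rank_on[OF that inj, of b] and cc = bij_rank_on[OF that inj, of c]
    have "bij_betw (the_inv_into H (rank_on H (key b H)) \<circ> rank_on H (key c H)) H H"
      using cc bij_betw_the_inv_into[OF bb] by (rule bij_betw_trans)
    then show "bij_betw (\<theta> H) H H" by (simp add: \<theta>_def[abs_def] o_def)
    fix i assume "i \<in> H"
    then have "rank_on H (key c H) i \<in> rank_on H (key b H) ` H" using bb cc by (auto simp: bij_betw_def)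
    then show "rank_on H (key b H) (\<theta> H i) = rank_on H (key c H) i"
      unfolding \<theta>_def using bb by (intro f_the_inv_into_f) (auto simp: bij_betw_def)
  qed
  have main: "\<Phi> \<pi> \<in> level_class K c" "highs n K (\<Phi> \<pi>) = highs n K \<pi>" if \<pi>: "\<pi> \<in> level_class K b" for \<pi>
  proof -
    have p: "\<pi> \<in> perms n S" using \<pi> by (simp add: level_class_def)
    define H where "H = highs n K \<pi>"
    have fin: "finite H" by (auto simp: H_def highs_def)
    have \<theta>H: "\<theta> H i \<in> H" if "i \<in> H" for i using \<theta>(1)[OF fin] that by (auto simp: bij_betw_def)
    have less: "\<pi> (\<theta> H i) < \<pi> (\<theta> H j) \<longleftrightarrow> key c H i < key c H j" if "i \<in> H" "j \<in> H" for i j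
      using ord[OF \<pi>, folded H_def, OF \<theta>H[OF that(1)] \<theta>H[OF that(2)]] \<theta>(2)[OF fin that(1)] \<theta>(2)[OF fin that(2)]
        rank_on_less[OF fin inj, of "\<theta> H i" "\<theta> H j" b] rank_on_less[OF fin inj, of i j c] \<theta>H that by simp
    have run: "run H (\<theta> H i) = run H i" if i: "i \<in> H" for i
    proof (rule ccontr)
      note B = rank_bounds[OF b p H_def \<theta>H[OF i]] and C = rank_bounds[OF c p H_def i]
      have mono: "card {y \<in> H. t \<le> run H y} \<le> card {y \<in> H. s < run H y}" if "s < t" for s t
        using fin that by (intro card_mono) auto
      assume "run H (\<theta> H i) \<noteq> run H i"
      then consider "run H (\<theta> H i) < run H i" | "run H i < run H (\<theta> H i)" by linarith
      then show False
      proof cases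
        case 1
        show False using B(1) C(2) mono[OF 1] \<theta>(2)[OF fin i] by linarith
      next
        case 2
        show False using B(2) C(1) mono[OF 2] \<theta>(2)[OF fin i] by linarith
      qed
    qed
    have \<Phi>: "\<Phi> \<pi> = (\<lambda>i. if i \<in> H then \<pi> (\<theta> H i) else \<pi> i)" by (simp add: \<Phi>_def H_def fun_eq_iff)
    have asc: "\<pi> (\<theta> H i) < \<pi> (\<theta> H (Suc i))" if "i \<in> H" "Suc i \<in> H" "i \<notin> S" for i
    proof -
      have "c H i = c H (Suc i)" using c p that unfolding admissible_def H_def by blast
      then show ?thesis using less[OF that(1,2)] key_less[OF c p, folded H_def, OF that(1,2)] by simp
    qed
    note r = resort[OF p K H_def \<theta>(1)[OF fin] run asc, folded \<Phi>]
    show "highs n K (\<Phi> \<pi>) = highs n K \<pi>" using r(2) by (simp add: H_def)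
    have "\<Phi> \<pi> i < \<Phi> \<pi> j \<longleftrightarrow> c H i = c H j" if "i \<in> H" "j \<in> H" "i < j" for i j
      using less[OF that(1,2)] key_less[OF c p, folded H_def, OF that] that by (simp add: \<Phi>)
    then show "\<Phi> \<pi> \<in> level_class K c" using r by (simp add: level_class_def)
  qed
  have "inj_on \<Phi> (level_class K b)"
  proof (rule inj_onI)
    fix \<pi> \<sigma> assume \<pi>: "\<pi> \<in> level_class K b" and \<sigma>: "\<sigma> \<in> level_class K b" and eq: "\<Phi> \<pi> = \<Phi> \<sigma>"
    define H where "H = highs n K \<pi>"
    \<comment> \<open>The rearrangement preserves the high positions, so both permutations were
      rearranged by the same \<open>\<theta> H\<close>, which can be undone.\<close>
    have H: "highs n K \<sigma> = H" using main(2)[OF \<pi>] main(2)[OF \<sigma>] eq by (simp add: H_def)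
    have fin: "finite H" by (auto simp: H_def highs_def)
    show "\<pi> = \<sigma>"
    proof
      fix i show "\<pi> i = \<sigma> i"
      proof (cases "i \<in> H")
        case True
        then obtain j where "j \<in> H" "i = \<theta> H j" using \<theta>(1)[OF fin] by (auto simp: bij_betw_def)
        then show ?thesis using fun_cong[OF eq, of j] H by (simp add: \<Phi>_def H_def)
      next
        case False
        then show ?thesis using fun_cong[OF eq, of i] H by (simp add: \<Phi>_def H_def)
      qed
    qed
  qed
  moreover have "\<Phi> ` level_class K b \<subseteq> level_class K c" using main(1) by blast
  moreover have "finite (level_class K c)" using finite_perms by (auto simp: level_class_def)
  ultimately show ?thesis by (rule card_inj_on_le)
qed

text \<open>A later entry larger than a high one is itself high, so it makes no difference whether
  \<open>j\<close> ranges over high positions or over all positions.\<close>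

lemma level_class_block:
  "level_class K (\<lambda>_. block S) =
    {\<pi> \<in> perms n S. \<forall>i\<in>highs n K \<pi>. \<forall>j\<le>n. block S i < block S j \<longrightarrow> \<pi> j < \<pi> i}"
proof (intro set_eqI iffI)
  fix \<pi> assume \<pi>: "\<pi> \<in> level_class K (\<lambda>_. block S)"
  then have p: "\<pi> \<in> perms n S" by (simp add: level_class_def)
  have "\<pi> j < \<pi> i" if "i \<in> highs n K \<pi>" "j \<le> n" "block S i < block S j" for i j
  proof (rule ccontr)
    assume "\<not> \<pi> j < \<pi> i"
    moreover have ij: "i < j" using that(3) by (rule block_less_pos)
    ultimately have "\<pi> i < \<pi> j" using perms_neq[OF p, of i j] by simp
    then have "j \<in> highs n K \<pi>" using high_up ij that by blast
    then show False using \<pi> \<open>\<pi> i < \<pi> j\<close> that ij by (auto simp: level_class_def)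
  qed
  then show "\<pi> \<in> {\<pi> \<in> perms n S. \<forall>i\<in>highs n K \<pi>. \<forall>j\<le>n. block S i < block S j \<longrightarrow> \<pi> j < \<pi> i}"
    using p by blast
next
  fix \<pi> assume \<pi>: "\<pi> \<in> {\<pi> \<in> perms n S. \<forall>i\<in>highs n K \<pi>. \<forall>j\<le>n. block S i < block S j \<longrightarrow> \<pi> j < \<pi> i}"
  have "\<pi> i < \<pi> j \<longleftrightarrow> block S i = block S j" if "i \<in> highs n K \<pi>" "j \<in> highs n K \<pi>" "i < j" for i j
  proof
    have ij: "1 \<le> i" "j \<le> n" using that by (auto simp: highs_def)
    assume "\<pi> i < \<pi> j"
    then have "\<not> block S i < block S j" using \<pi> that(1) ij(2) by force
    then show "block S i = block S j" using block_mono[of i j] that(3) by simp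
  next
    have ij: "1 \<le> i" "j \<le> n" using that by (auto simp: highs_def)
    assume "block S i = block S j"
    then show "\<pi> i < \<pi> j" using same_block_less \<pi> ij that(3) by blast
  qed
  then show "\<pi> \<in> level_class K (\<lambda>_. block S)" using \<pi> by (simp add: level_class_def)
qed

text \<open>Avoiding the second pattern, \<open>Q\<close>, means that no descent leads into a high
  position, which makes the runs increasing. Avoiding \<open>H\<close> makes the entries of later
  runs smaller, because the low position between two runs forces a descent.\<close>

lemma level_class_run:
  assumes K: "2 \<le> K"
  shows "level_class K run = {\<pi> \<in> perms n S. \<not> contains_H n (Suc K) \<pi> \<and> \<not> contains_Q n (Suc K) \<pi>}"
proof (intro set_eqI iffI)
  fix \<pi> assume \<pi>: "\<pi> \<in> level_class K run"
  define H where "H = highs n K \<pi>"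
  have p: "\<pi> \<in> perms n S" using \<pi> by (simp add: level_class_def)
  have ord: "\<pi> i < \<pi> j \<longleftrightarrow> run H i = run H j" if "i \<in> H" "j \<in> H" "i < j" for i j
    using \<pi> that by (simp add: level_class_def H_def)
  have "\<not> contains_Q n (Suc K) \<pi>"
  proof
    assume "contains_Q n (Suc K) \<pi>"
    then obtain d where d: "d \<in> descent_set n \<pi>" "Suc d \<in> H" using contains_Q_iff[OF K] H_def by blast
    then have d': "1 \<le> d" "d < n" "\<pi> (Suc d) < \<pi> d" by (auto simp: descent_set_def)
    show False
    proof (cases "d \<in> H")
      case True
      have "run H d = run H (Suc d)"
        using run_less_iff[OF True d'(1), of "Suc d"] run_mono[of d "Suc d" H] by auto
      then show False using ord[OF True d(2)] d' by simp
    next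
      case False
      obtain z where z: "1 \<le> z" "z < Suc d" "\<pi> z < \<pi> (Suc d)" "ends_chain \<pi> (K - 2) z"
        using low_below[OF K] d(2) H_def by blast
      then have "z \<noteq> d" using d' by auto
      then have "ends_chain \<pi> (Suc (K - 2)) d" using z d' by auto
      moreover have "Suc (K - 2) = K - 1" using K by simp
      ultimately show False using False d' by (auto simp: H_def highs_def)
    qed
  qed
  moreover have "\<not> contains_H n (Suc K) \<pi>"
  proof
    assume "contains_H n (Suc K) \<pi>"
    then obtain i j d where ij: "i \<in> H" "j \<le> n" "\<pi> i < \<pi> j" "d \<in> descent_set n \<pi>" "i \<le> d" "d < j"
      unfolding contains_H_iff[OF K] H_def by blast
    then have jH: "j \<in> H" using high_up[of i n K \<pi> j] by (simp add: H_def)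
    have i1: "1 \<le> i" using ij by (auto simp: H_def highs_def)
    have "run H i = run H j" using ord[OF ij(1) jH] ij by simp
    then have all: "l \<in> H" if "i \<le> l" "l \<le> j" for l
      using run_less_iff[OF ij(1) i1, of j] that ij(1) jH by (metis less_irrefl le_neq_implies_less)
    have dd: "d \<in> H" "Suc d \<in> H" using all ij by auto
    have "run H d = run H (Suc d)"
      using run_less_iff[OF dd(1), of "Suc d"] run_mono[of d "Suc d" H] i1 ij by auto
    then have "\<pi> d < \<pi> (Suc d)" using ord[OF dd] by simp
    then show False using ij by (simp add: descent_set_def)
  qed
  ultimately show "\<pi> \<in> {\<pi> \<in> perms n S. \<not> contains_H n (Suc K) \<pi> \<and> \<not> contains_Q n (Suc K) \<pi>}" using p by simp
next
  fix \<pi> assume \<pi>: "\<pi> \<in> {\<pi> \<in> perms n S. \<not> contains_H n (Suc K) \<pi> \<and> \<not> contains_Q n (Suc K) \<pi>}"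
  define H where "H = highs n K \<pi>"
  have p: "\<pi> \<in> perms n S" using \<pi> by simp
  have hq: "\<And>d. d \<in> descent_set n \<pi> \<Longrightarrow> Suc d \<notin> H"
    "\<And>i j d. \<lbrakk>i \<in> H; j \<le> n; d \<in> descent_set n \<pi>; i \<le> d; d < j\<rbrakk> \<Longrightarrow> \<not> \<pi> i < \<pi> j"
    using \<pi> unfolding contains_H_iff[OF K] contains_Q_iff[OF K] H_def by blast+
  have "\<pi> i < \<pi> j \<longleftrightarrow> run H i = run H j" if ij: "i \<in> H" "j \<in> H" "i < j" for i j
  proof
    have b: "1 \<le> i" "j \<le> n" using ij by (auto simp: H_def highs_def)
    assume "run H i = run H j"
    then have all: "l \<in> H" if "i \<le> l" "l \<le> j" for l
      using run_less_iff[OF ij(1) b(1), of j] that ij by (metis less_irrefl le_neq_implies_less)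
    show "\<pi> i < \<pi> j"
    proof (rule ascending[OF _ ij(3)])
      fix t assume t: "i \<le> t" "t < j"
      then have "t \<notin> descent_set n \<pi>" using hq(1) all[of "Suc t"] by auto
      then show "\<pi> t < \<pi> (Suc t)" using no_descent[OF p] t b by simp
    qed
  next
    have b: "1 \<le> i" "j \<le> n" using ij by (auto simp: H_def highs_def)
    assume lt: "\<pi> i < \<pi> j"
    show "run H i = run H j"
    proof (rule ccontr)
      assume "run H i \<noteq> run H j"
      then have "run H i < run H j" using run_mono[of i j H] ij by simp
      then obtain l where l: "l \<notin> H" "i < l" "l < j" using run_less_iff[OF ij(1) b(1)] by blast
      \<comment> \<open>The low entry at \<open>l\<close> is smaller than the high one at
        \<open>i\<close>, so there is a descent between them, and hence one between \<open>i\<close>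
        and \<open>j\<close>.\<close>
      have "\<not> \<pi> i < \<pi> l" using high_up[of i n K \<pi> l] ij l b by (auto simp: H_def)
      then obtain t where t: "i \<le> t" "t < l" "\<not> \<pi> t < \<pi> (Suc t)" using ascending[of i l \<pi>] l by blast
      then have "t \<in> descent_set n \<pi>" using no_descent[OF p, of t] b l by auto
      then show False using hq(2)[OF ij(1) b(2), of t] t l lt by simp
    qed
  qed
  then show "\<pi> \<in> level_class K run" using p by (simp add: level_class_def H_def)
qed

lemma bij_card_filter: "bij_betw f A B \<Longrightarrow> card {x \<in> A. P (f x)} = card {y \<in> B. P y}"
  by (intro bij_betw_same_card[of f]) (auto simp: bij_betw_def inj_on_def)

lemma card_descents_subset:
  assumes K: "2 \<le> K"
  shows "card {\<pi> \<in> S_F n (Suc K). descent_set n \<pi> \<subseteq> S} = card {\<pi> \<in> S_HQ n (Suc K). descent_set n \<pi> \<subseteq> S}"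
proof -
  have "{\<pi> \<in> S_F n (Suc K). descent_set n \<pi> \<subseteq> S} = {\<pi> \<in> perms n S. \<not> drop_chain K (word S \<pi>) (int n + 1)}"
    using avoids_F_iff[OF _ K] by (auto simp: S_F_def perms_def)
  also have "card \<dots> = card {w \<in> words (int n) base. \<not> drop_chain K w (int n + 1)}"
    by (rule bij_card_filter[OF bij_word])
  also have "\<dots> = card {w \<in> words (int n) base. \<forall>t. 1 \<le> t \<and> t \<le> int n \<longrightarrow> \<not> rise_chain K w t}"
    by (rule card_words[OF K]) simp
  also have "\<dots> = card {\<pi> \<in> perms n S. \<forall>t. 1 \<le> t \<and> t \<le> int n \<longrightarrow> \<not> rise_chain K (word S \<pi>) t}"
    by (rule bij_card_filter[OF bij_word, symmetric])
  also have "{\<pi> \<in> perms n S. \<forall>t. 1 \<le> t \<and> t \<le> int n \<longrightarrow> \<not> rise_chain K (word S \<pi>) t} = level_class K (\<lambda>_. block S)"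
    unfolding level_class_block using no_rise_chain_iff[OF _ K] by blast
  also have "card \<dots> = card (level_class K run)"
    by (intro antisym card_level_class_le K admissible_block admissible_run)
  also have "level_class K run = {\<pi> \<in> S_HQ n (Suc K). descent_set n \<pi> \<subseteq> S}"
    unfolding level_class_run[OF K] by (auto simp: S_HQ_def perms_def)
  finally show ?thesis .
qed

end

section \<open>From counts to a descent-preserving bijection\<close>

text \<open>The objects with \<open>d x \<subseteq> S\<close> split according to the exact value of
  \<open>d x\<close>; by induction the proper subsets of \<open>S\<close> contribute equally on both
  sides and can be subtracted.\<close>

lemma card_fibre_eq:
  assumes fin: "finite A" "finite B" "finite U"
    and eq: "\<And>S. S \<subseteq> U \<Longrightarrow> card {x \<in> A. d x \<subseteq> S} = card {x \<in> B. d x \<subseteq> S}"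
  shows "S \<subseteq> U \<Longrightarrow> card {x \<in> A. d x = S} = card {x \<in> B. d x = S}"
proof (induction "card S" arbitrary: S rule: less_induct)
  case less
  have S: "finite S" using less.prems fin finite_subset by blast
  have split: "card {x \<in> C. d x \<subseteq> S} = card {x \<in> C. d x = S} + (\<Sum>T\<in>Pow S - {S}. card {x \<in> C. d x = T})"
    if "finite C" for C
  proof -
    have "{x \<in> C. d x \<subseteq> S} = (\<Union>T\<in>Pow S. {x \<in> C. d x = T})" by auto
    also have "card \<dots> = (\<Sum>T\<in>Pow S. card {x \<in> C. d x = T})"
      using S that by (intro card_UN_disjoint) auto
    finally show ?thesis using S by (simp add: sum.remove[of "Pow S" S])
  qed
  have "(\<Sum>T\<in>Pow S - {S}. card {x \<in> A. d x = T}) = (\<Sum>T\<in>Pow S - {S}. card {x \<in> B. d x = T})"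
  proof (rule sum.cong)
    fix T assume "T \<in> Pow S - {S}"
    then show "card {x \<in> A. d x = T} = card {x \<in> B. d x = T}"
      using less.prems S by (intro less.hyps psubset_card_mono) auto
  qed simp
  then show ?case using split[OF fin(1)] split[OF fin(2)] eq[OF less.prems] by simp
qed

text \<open>Fibres of equal finite size admit bijections, and these combine to one on the whole set
  because \<open>d\<close> tells the fibres apart.\<close>

lemma bij_preserving:
  assumes fin: "finite A" "finite B" and eq: "\<And>t. card {x \<in> A. d x = t} = card {x \<in> B. d x = t}"
  shows "\<exists>\<Phi>. bij_betw \<Phi> A B \<and> (\<forall>x\<in>A. d (\<Phi> x) = d x)"
proof -
  have "\<exists>g. bij_betw g {x \<in> A. d x = t} {x \<in> B. d x = t}" for t
    using fin eq by (intro finite_same_card_bij) auto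
  then obtain g where g: "\<And>t. bij_betw (g t) {x \<in> A. d x = t} {x \<in> B. d x = t}" by metis
  define \<Phi> where "\<Phi> x = g (d x) x" for x
  have \<Phi>: "\<Phi> x \<in> B \<and> d (\<Phi> x) = d x" if "x \<in> A" for x
    using bij_betwE[OF g[of "d x"]] that by (auto simp: \<Phi>_def)
  have "inj_on \<Phi> A"
  proof (rule inj_onI)
    fix x y assume xy: "x \<in> A" "y \<in> A" "\<Phi> x = \<Phi> y"
    then have "d x = d y" using \<Phi> by metis
    then show "x = y" using xy bij_betw_imp_inj_on[OF g[of "d y"]] by (auto simp: \<Phi>_def inj_on_def)
  qed
  moreover have "y \<in> \<Phi> ` A" if "y \<in> B" for y
  proof -
    have "y \<in> g (d y) ` {x \<in> A. d x = d y}" using g[of "d y"] that by (auto simp: bij_betw_def)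
    then obtain x where "x \<in> A" "d x = d y" "y = g (d y) x" by auto
    then show ?thesis by (intro image_eqI[of _ _ x]) (auto simp: \<Phi>_def)
  qed
  ultimately have "bij_betw \<Phi> A B" using \<Phi> by (auto simp: bij_betw_def)
  then show ?thesis using \<Phi> by blast
qed

theorem theorem3:
  fixes k n :: nat
  assumes "k \<ge> 3" and "n \<ge> 1"
  shows "\<exists>\<Phi>. bij_betw \<Phi> (S_F n k) (S_HQ n k) \<and>
             (\<forall>\<pi>\<in>S_F n k. descent_set n (\<Phi> \<pi>) = descent_set n \<pi>)"
proof (rule bij_preserving)
  have "finite {\<pi>. \<pi> permutes {1..n}}" by (simp add: finite_permutations)
  then show fin: "finite (S_F n k)" "finite (S_HQ n k)" by (auto simp: S_F_def S_HQ_def)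
  fix D
  have sub: "card {\<pi> \<in> S_F n k. descent_set n \<pi> \<subseteq> S} = card {\<pi> \<in> S_HQ n k. descent_set n \<pi> \<subseteq> S}"
    if "S \<subseteq> {1..<n}" for S
    using descents_in.card_descents_subset[of n S "k - 1"] that assms by (simp add: descents_in_def)
  show "card {\<pi> \<in> S_F n k. descent_set n \<pi> = D} = card {\<pi> \<in> S_HQ n k. descent_set n \<pi> = D}"
  proof (cases "D \<subseteq> {1..<n}")
    case True
    show ?thesis by (rule card_fibre_eq[OF fin _ sub True]) auto
  next
    case False
    moreover have "descent_set n \<pi> \<subseteq> {1..<n}" for \<pi> by (auto simp: descent_set_def)
    ultimately have "{\<pi> \<in> S_F n k. descent_set n \<pi> = D} = {}" "{\<pi> \<in> S_HQ n k. descent_set n \<pi> = D} = {}" by auto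
    then show ?thesis by (simp only:)
  qed
qed

end
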